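(* Let $T>0$, $d\ge 1$, and let $\mu=\{\mu_t\}_{0\le t\le T}$ be a continuous family of Borel probability measures on $\mathbb{R}^d$ with densities $p(t,x)=d\mu_t/dx$. Let $K:\mathbb{R}^{d+1}\to\mathbb{R}$ define the translation-invariant kernel $K(\xi,\eta)=K(\xi-\eta)$ with RKHS $(\mathcal{H},\langle\cdot,\cdot\rangle,\|\cdot\|)$. Suppose: (A1) $K\in C(\mathbb{R}^{d+1})\cap L^1(\mathbb{R}^{d+1})$ is positive definite and $\mathcal{H}$ is universal on every compact subset of $[0,T]\times\mathbb{R}^d$, understood in the sense that $\mathrm{supp}\,\widehat K=\mathbb{R}^{d+1}$; (A2) $\int_{\mathbb{R}^{d+1}}(1+|z|^2)\widehat K(z)\,dz<\infty$; (A3) $p\in C([0,T];L^1(\mathbb{R}^d))\cap L^\infty([0,T]\times\mathbb{R}^d)$, each $p(t,\cdot)$ is a probability density on $\mathbb{R}^d$, and $\partial_tp\in L^1((0,T)\times\mathbb{R}^d)$ in the weak sense. Suppose moreover that $V_0(\mu)<\infty$. Let $\{\varepsilon_n\}_{n\ge1}$ and $\{\lambda_n\}_{n\ge 1}$ be positive sequences with $\varepsilon_n\to0$ and $\lambda_n\to+\infty$, and for each $n$ let $u_n\in\mathcal{U}$ satisfy $$J_{\lambda_n}(u_n)\le\inf_{u\in\mathcal{U}}J_{\lambda_n}(u)+\varepsilon_n .$$ Then $$\lim_{n\to\infty}\lambda_n\int_0^T\|H_t^{u_n}\|^2\,dt=0,\qquad \lim_{n\to\infty}J_{\lambda_n}(u_n)=V_0(\mu),\qquad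 \sup_{\lambda>0}\inf_{u\in\mathcal{U}}J_\lambda(u)=V_0(\mu).$$ Moreover, the problem of minimizing $\int_0^T\int_{\mathbb{R}^d}|u|^2p\,dx\,dt$ over $u\in\mathcal{U}_0$ admits a minimizer $u^\ast\in\mathcal{U}_0$, unique up to $p(t,x)\,dt\,dx$-null sets, and $$u_n\longrightarrow u^\ast\quad\text{in }L^2([0,T]\times\mathbb{R}^d;\mathbb{R}^d,p(t,x)\,dt\,dx)\quad\text{as }n\to\infty .$$
   Context: Fourier transform: $\widehat K(z)=(2\pi)^{-(d+1)/2}\int_{\mathbb{R}^{d+1}}e^{-iz^{\mathsf T}\xi}K(\xi)\,d\xi$; under (A1), $\widehat K\ge0$. $\mathcal{H}$ is the real RKHS of functions on $\mathbb{R}^{d+1}$ (points written $(t,x)$, $t\in\mathbb{R}$, $x\in\mathbb{R}^d$) with reproducing kernel $K(t,x,s,y)=K((t,x)-(s,y))$. $L^q(A;\mathbb{R}^m,\nu)$ is the space of Borel functions $f:A\to\mathbb{R}^m$ with $\int_A|f|^q\,d\nu<\infty$. Class $\mathcal{U}$: all $u\in L^1([0,T]\times\mathbb{R}^d;\mathbb{R}^d,p(t,x)\,dt\,dx)$ such that $\mathrm{div}_x(pu)\in L^1((0,T)\times\mathbb{R}^d)$ in the weak (distributional) sense. Class $\mathcal{U}_0$: all $u\in\mathcal{U}$ such that for every $\varphi\in C_b^1([0,T]\times\mathbb{R}^d)$ (bounded, $C^1$ with bounded first derivatives) and every $t\in[0,T]$, $$\int_{\mathbb{R}^d}\varphi(t,x)p(t,x)\,dx-\int_{\mathbb{R}^d}\varphi(0,x)p(0,x)\,dx=\int_0^t\int_{\mathbb{R}^d}\bigl(\partial_s\varphi+u(s,x)^{\mathsf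 T}\nabla_x\varphi\bigr)p(s,x)\,dx\,ds .$$ $V_0(\mu):=\inf_{u\in\mathcal{U}_0}\int_{[0,T]\times\mathbb{R}^d}|u(t,x)|^2p(t,x)\,dx\,dt$. Operator: $\mathcal{A}^u\varphi=\partial_t\varphi+u^{\mathsf T}\nabla_x\varphi$; $\mathcal{A}^u_{r,y}$ means that $\mathcal{A}^u$ acts on the variable $(r,y)$ (with coefficient $u(r,y)$). For $u\in L^1([0,T]\times\mathbb{R}^d;\mathbb{R}^d,p\,dt\,dx)$ and $s\in[0,T]$, the function $$H_s^u(t,x):=\int_0^s\int_{\mathbb{R}^d}p(r,y)\,\mathcal{A}^u_{r,y}K(t,x,r,y)\,dy\,dr-\int_{\mathbb{R}^d}p(s,y)K(t,x,s,y)\,dy+\int_{\mathbb{R}^d}p(0,y)K(t,x,0,y)\,dy$$ is an element of $\mathcal{H}$ under (A1)--(A3). Penalized functional ($\lambda>0$, $u\in\mathcal{U}$, values in $[0,+\infty]$): $$J_\lambda(u)=\int_0^T\int_{\mathbb{R}^d}|u(t,x)|^2p(t,x)\,dx\,dt+\lambda\int_0^T\|H_t^u\|^2\,dt .$$ *)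

theory Defs
  imports "HOL-Probability.Probability"
begin

definition fourier :: "('a::euclidean_space \<Rightarrow> real) \<Rightarrow> 'a \<Rightarrow> complex" where
  "fourier K z =
     of_real ((2 * pi) powr (- real DIM('a) / 2)) *
     (LINT \<xi>|lborel. exp (- \<i> * of_real (z \<bullet> \<xi>)) * of_real (K \<xi>))"

text \<open>
  Positive definiteness of a translation-invariant real kernel, in the sense of real kernels:
  symmetry has to be required separately because the coefficients are real.
\<close>

definition positive_definite :: "('a::real_vector \<Rightarrow> real) \<Rightarrow> bool" where
  "positive_definite K \<longleftrightarrow>
     (\<forall>x. K (- x) = K x) \<and>
     (\<forall>F c. finite F \<longrightarrow> 0 \<le> (\<Sum>x\<in>F. \<Sum>y\<in>F. c x * c y * K (x - y)))"

definition support :: "('a::topological_space \<Rightarrow> 'b::zero) \<Rightarrow> 'a set" where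
  "support f = closure {z. f z \<noteq> 0}"

text \<open>
  \<open>is_rkhs k H ip\<close>: the function space \<open>H\<close> with inner product \<open>ip\<close> (only meaningful on
  \<open>H \<times> H\<close>) is the real Hilbert space with reproducing kernel \<open>k\<close>.  By the Moore--Aronszajn
  theorem, for a positive definite \<open>k\<close> such a space exists and \<open>H\<close> as well as the values of \<open>ip\<close>
  on \<open>H \<times> H\<close> are determined by \<open>k\<close>.
\<close>

definition inner_product_on :: "('a \<Rightarrow> real) set \<Rightarrow> (('a \<Rightarrow> real) \<Rightarrow> ('a \<Rightarrow> real) \<Rightarrow> real) \<Rightarrow> bool" where
  "inner_product_on H ip \<longleftrightarrow>
     (\<lambda>x. 0) \<in> H \<and>
     (\<forall>f\<in>H. \<forall>g\<in>H. (\<lambda>x. f x + g x) \<in> H) \<and>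
     (\<forall>c. \<forall>f\<in>H. (\<lambda>x. c * f x) \<in> H) \<and>
     (\<forall>f\<in>H. \<forall>g\<in>H. ip f g = ip g f) \<and>
     (\<forall>f\<in>H. \<forall>g\<in>H. \<forall>h\<in>H. ip (\<lambda>x. f x + g x) h = ip f h + ip g h) \<and>
     (\<forall>c. \<forall>f\<in>H. \<forall>g\<in>H. ip (\<lambda>x. c * f x) g = c * ip f g) \<and>
     (\<forall>f\<in>H. 0 \<le> ip f f \<and> (ip f f = 0 \<longrightarrow> f = (\<lambda>x. 0)))"

definition rkhs_norm :: "(('a \<Rightarrow> real) \<Rightarrow> ('a \<Rightarrow> real) \<Rightarrow> real) \<Rightarrow> ('a \<Rightarrow> real) \<Rightarrow> real" where
  "rkhs_norm ip f = sqrt (ip f f)"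

definition complete_for :: "('a \<Rightarrow> real) set \<Rightarrow> (('a \<Rightarrow> real) \<Rightarrow> ('a \<Rightarrow> real) \<Rightarrow> real) \<Rightarrow> bool" where
  "complete_for H ip \<longleftrightarrow>
     (\<forall>F :: nat \<Rightarrow> 'a \<Rightarrow> real.
        (\<forall>n. F n \<in> H) \<and>
        (\<forall>e>0. \<exists>N. \<forall>m\<ge>N. \<forall>n\<ge>N. rkhs_norm ip (\<lambda>x. F m x - F n x) < e)
        \<longrightarrow> (\<exists>f\<in>H. (\<lambda>n. rkhs_norm ip (\<lambda>x. F n x - f x)) \<longlonglongrightarrow> 0))"

definition is_rkhs ::
    "('a \<Rightarrow> 'a \<Rightarrow> real) \<Rightarrow> ('a \<Rightarrow> real) set \<Rightarrow> (('a \<Rightarrow> real) \<Rightarrow> ('a \<Rightarrow> real) \<Rightarrow> real) \<Rightarrow> bool" where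
  "is_rkhs k H ip \<longleftrightarrow>
     inner_product_on H ip \<and> complete_for H ip \<and>
     (\<forall>z. k z \<in> H) \<and> (\<forall>f\<in>H. \<forall>z. ip f (k z) = f z)"

text \<open>
  The time derivative is taken within \<open>[0,T]\<close>, hence one-sided at the two end points.
\<close>

definition time_deriv :: "real \<Rightarrow> (real \<times> (real^'d) \<Rightarrow> real) \<Rightarrow> real \<times> (real^'d) \<Rightarrow> real" where
  "time_deriv T \<phi> = (\<lambda>(t, x). vector_derivative (\<lambda>s. \<phi> (s, x)) (at t within {0..T}))"

definition space_grad :: "(real \<times> (real^'d) \<Rightarrow> real) \<Rightarrow> real \<times> (real^'d) \<Rightarrow> real^'d" where
  "space_grad \<phi> = (\<lambda>(t, x). \<chi> i. deriv (\<lambda>h. \<phi> (t, x + h *\<^sub>R axis i 1)) 0)"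

definition transport_op ::
    "real \<Rightarrow> (real \<times> (real^'d) \<Rightarrow> real^'d) \<Rightarrow> (real \<times> (real^'d) \<Rightarrow> real) \<Rightarrow> real \<times> (real^'d) \<Rightarrow> real" where
  "transport_op T u \<phi> z = time_deriv T \<phi> z + u z \<bullet> space_grad \<phi> z"

text \<open>
  \<open>C\<^sub>b\<^sup>1([0,T] \<times> \<real>\<^sup>d)\<close>; the vector field \<open>D\<close> below is the full space-time gradient.
\<close>

definition C1_bounded :: "real \<Rightarrow> (real \<times> (real^'d) \<Rightarrow> real) set" where
  "C1_bounded T =
     {\<phi>. bounded (\<phi> ` ({0..T} \<times> UNIV)) \<and>
         (\<exists>D. (\<forall>z\<in>{0..T} \<times> UNIV. (\<phi> has_derivative (\<lambda>h. D z \<bullet> h)) (at z within {0..T} \<times> UNIV)) \<and>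
              continuous_on ({0..T} \<times> UNIV) D \<and> bounded (D ` ({0..T} \<times> UNIV)))}"

primrec C_k :: "nat \<Rightarrow> ('a::euclidean_space \<Rightarrow> real) \<Rightarrow> bool" where
  "C_k 0 f \<longleftrightarrow> continuous_on UNIV f"
| "C_k (Suc k) f \<longleftrightarrow>
     (\<forall>x. f differentiable (at x)) \<and> (\<forall>b\<in>Basis. C_k k (\<lambda>x. frechet_derivative f (at x) b))"

definition test_functions :: "'a::euclidean_space set \<Rightarrow> ('a \<Rightarrow> real) set" where
  "test_functions \<Omega> = {\<phi>. (\<forall>k. C_k k \<phi>) \<and> compact (support \<phi>) \<and> support \<phi> \<subseteq> \<Omega>}"

definition weak_time_deriv_L1 :: "real \<Rightarrow> (real \<times> (real^'d) \<Rightarrow> real) \<Rightarrow> bool" where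
  "weak_time_deriv_L1 T q \<longleftrightarrow>
     (\<exists>g. set_integrable lborel ({0<..<T} \<times> UNIV) g \<and>
        (\<forall>\<phi>\<in>test_functions ({0<..<T} \<times> UNIV).
           (LINT z:{0<..<T} \<times> UNIV|lborel. q z * time_deriv T \<phi> z) =
           - (LINT z:{0<..<T} \<times> UNIV|lborel. g z * \<phi> z)))"

definition weak_div_L1 :: "real \<Rightarrow> (real \<times> (real^'d) \<Rightarrow> real^'d) \<Rightarrow> bool" where
  "weak_div_L1 T w \<longleftrightarrow>
     (\<exists>g. set_integrable lborel ({0<..<T} \<times> UNIV) g \<and>
        (\<forall>\<phi>\<in>test_functions ({0<..<T} \<times> UNIV).
           (LINT z:{0<..<T} \<times> UNIV|lborel. w z \<bullet> space_grad \<phi> z) =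
           - (LINT z:{0<..<T} \<times> UNIV|lborel. g z * \<phi> z)))"

definition weakly_continuous_on :: "real set \<Rightarrow> (real \<Rightarrow> 'a::topological_space measure) \<Rightarrow> bool" where
  "weakly_continuous_on I \<mu> \<longleftrightarrow>
     (\<forall>f :: 'a \<Rightarrow> real. continuous_on UNIV f \<and> bounded (range f) \<longrightarrow>
        continuous_on I (\<lambda>t. LINT x|\<mu> t. f x))"

text \<open>
  The measure \<open>p(t,x) dt dx\<close> on \<open>[0,T] \<times> \<real>\<^sup>d\<close>.  Functions on \<open>[0,T] \<times> \<real>\<^sup>d\<close> are represented by
  functions on the whole of \<open>\<real> \<times> \<real>\<^sup>d\<close> whose values outside this set are irrelevant: measurability
  and integrability below refer to the restricted space.
\<close>

definition spacetime_measure :: "real \<Rightarrow> (real \<times> (real^'d) \<Rightarrow> real) \<Rightarrow> (real \<times> (real^'d)) measure" where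
  "spacetime_measure T p = density (restrict_space lborel ({0..T} \<times> UNIV)) (\<lambda>z. ennreal (p z))"

definition class_U :: "real \<Rightarrow> (real \<times> (real^'d) \<Rightarrow> real) \<Rightarrow> (real \<times> (real^'d) \<Rightarrow> real^'d) set" where
  "class_U T p =
     {u. integrable (spacetime_measure T p) u \<and> weak_div_L1 T (\<lambda>z. p z *\<^sub>R u z)}"

definition class_U0 :: "real \<Rightarrow> (real \<times> (real^'d) \<Rightarrow> real) \<Rightarrow> (real \<times> (real^'d) \<Rightarrow> real^'d) set" where
  "class_U0 T p =
     {u \<in> class_U T p. \<forall>\<phi>\<in>C1_bounded T. \<forall>t\<in>{0..T}.
        (LINT x|lborel. \<phi> (t, x) * p (t, x)) - (LINT x|lborel. \<phi> (0, x) * p (0, x)) =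
        (LINT z:{0..t} \<times> UNIV|lborel. transport_op T u \<phi> z * p z)}"

definition energy :: "real \<Rightarrow> (real \<times> (real^'d) \<Rightarrow> real) \<Rightarrow> (real \<times> (real^'d) \<Rightarrow> real^'d) \<Rightarrow> ennreal" where
  "energy T p u = (\<integral>\<^sup>+z. ennreal ((norm (u z))\<^sup>2) \<partial>spacetime_measure T p)"

definition V0 :: "real \<Rightarrow> (real \<times> (real^'d) \<Rightarrow> real) \<Rightarrow> ennreal" where
  "V0 T p = (INF u\<in>class_U0 T p. energy T p u)"

definition residual ::
    "real \<Rightarrow> (real \<times> (real^'d) \<Rightarrow> real) \<Rightarrow> (real \<times> (real^'d) \<Rightarrow> real) \<Rightarrow>
     (real \<times> (real^'d) \<Rightarrow> real^'d) \<Rightarrow> real \<Rightarrow> real \<times> (real^'d) \<Rightarrow> real" where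
  "residual T p K u s = (\<lambda>w.
     (LINT z:{0..s} \<times> UNIV|lborel. p z * transport_op T u (\<lambda>z'. K (w - z')) z)
     - (LINT y|lborel. p (s, y) * K (w - (s, y)))
     + (LINT y|lborel. p (0, y) * K (w - (0, y))))"

definition penalty ::
    "real \<Rightarrow> (real \<times> (real^'d) \<Rightarrow> real) \<Rightarrow> (real \<times> (real^'d) \<Rightarrow> real) \<Rightarrow>
     ((real \<times> (real^'d) \<Rightarrow> real) \<Rightarrow> (real \<times> (real^'d) \<Rightarrow> real) \<Rightarrow> real) \<Rightarrow>
     (real \<times> (real^'d) \<Rightarrow> real^'d) \<Rightarrow> ennreal" where
  "penalty T p K ip u = (\<integral>\<^sup>+t\<in>{0..T}. ennreal ((rkhs_norm ip (residual T p K u t))\<^sup>2) \<partial>lborel)"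

definition J ::
    "real \<Rightarrow> (real \<times> (real^'d) \<Rightarrow> real) \<Rightarrow> (real \<times> (real^'d) \<Rightarrow> real) \<Rightarrow>
     ((real \<times> (real^'d) \<Rightarrow> real) \<Rightarrow> (real \<times> (real^'d) \<Rightarrow> real) \<Rightarrow> real) \<Rightarrow>
     real \<Rightarrow> (real \<times> (real^'d) \<Rightarrow> real^'d) \<Rightarrow> ennreal" where
  "J T p K ip lam u = energy T p u + ennreal lam * penalty T p K ip u"

end

theory Submission
  imports Defs
begin

text \<open>
  The cost \<open>J\<^bsub>\<lambda>\<^esub>\<close> is a sum of squared seminorms of affine functions of \<open>u\<close>, so the parallelogram identity
  makes near-minimisers for growing \<open>\<lambda>\<close> Cauchy in \<open>L\<^sup>2(p dt dx)\<close>; no weak compactness is needed.  Since the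
  penalties tend to \<open>0\<close>, the residual of the limit vanishes.  Writing \<open>K\<close> as a Fourier integral, a
  vanishing residual says that \<open>fourier K\<close> times the transform of the continuity-equation functional is
  \<open>0\<close>; full support of \<open>fourier K\<close> then kills that functional on all exponentials, hence on Gaussians and, by
  mollification, on all of \<open>C\<^sub>b\<^sup>1\<close>.  So the limit lies in \<open>class_U0\<close> and its energy is squeezed between
  \<open>sup inf J\<^bsub>\<lambda>\<^esub>\<close> and \<open>V0\<close>.
\<close>

section \<open>Reproducing kernel Hilbert spaces\<close>

text \<open>\<open>rkhs_norm\<close> is meaningful only on \<open>H\<close>, so each residual must
  first be shown to lie in \<open>H\<close>, with a squared norm measurable in time. Both are done
  by duality with finite combinations of kernel sections, without \<open>H\<close>-valued integrals:
  the continuity-equation functional is bounded by the sup norms of a test function and its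
  gradient, and for combinations these are bounded by the \<open>H\<close> norm, because the second
  moment in (A2) gives K 0 - K h <= C |h|^2. Test functions live only on the closed strip, while
  Fourier analysis needs the whole space. They are extended constantly in time; the gradient then
  jumps, but only on two null hyperplanes, so the annihilation lemma is stated for Lipschitz
  functions whose gradient is continuous almost everywhere where the momentum is nonzero. Fields
  nearly optimal for different \<lambda> are compared at the smaller one: J increases with
  \<lambda>, and the infimum there is already close to its limit. The weak divergence demanded of
  the limit field comes out of the continuity equation, as minus the weak time derivative of
  p.\<close>

locale rkhs =
  fixes k :: "'a \<Rightarrow> 'a \<Rightarrow> real" and H ip
  assumes rkhs: "is_rkhs k H ip"
begin

lemma
  shows zero_mem: "(\<lambda>x. 0) \<in> H"
    and add_mem: "f \<in> H \<Longrightarrow> g \<in> H \<Longrightarrow> (\<lambda>x. f x + g x) \<in> H"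
    and scale_mem: "f \<in> H \<Longrightarrow> (\<lambda>x. c * f x) \<in> H"
    and ip_commute: "f \<in> H \<Longrightarrow> g \<in> H \<Longrightarrow> ip f g = ip g f"
    and ip_add_left: "f \<in> H \<Longrightarrow> g \<in> H \<Longrightarrow> h \<in> H \<Longrightarrow> ip (\<lambda>x. f x + g x) h = ip f h + ip g h"
    and ip_scale_left: "f \<in> H \<Longrightarrow> g \<in> H \<Longrightarrow> ip (\<lambda>x. c * f x) g = c * ip f g"
    and ip_nonneg: "f \<in> H \<Longrightarrow> 0 \<le> ip f f"
    and kernel_mem: "k z \<in> H"
    and reproducing: "f \<in> H \<Longrightarrow> ip f (k z) = f z"
proof -
  note I = rkhs[unfolded is_rkhs_def inner_product_on_def]
  note J = I[THEN conjunct1]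
  show "(\<lambda>x. 0) \<in> H" by (rule J[THEN conjunct1])
  note J = J[THEN conjunct2]
  show "f \<in> H \<Longrightarrow> g \<in> H \<Longrightarrow> (\<lambda>x. f x + g x) \<in> H" by (rule J[THEN conjunct1, rule_format])
  note J = J[THEN conjunct2]
  show "f \<in> H \<Longrightarrow> (\<lambda>x. c * f x) \<in> H" by (rule J[THEN conjunct1, rule_format])
  note J = J[THEN conjunct2]
  show "f \<in> H \<Longrightarrow> g \<in> H \<Longrightarrow> ip f g = ip g f" by (rule J[THEN conjunct1, rule_format])
  note J = J[THEN conjunct2]
  show "f \<in> H \<Longrightarrow> g \<in> H \<Longrightarrow> h \<in> H \<Longrightarrow> ip (\<lambda>x. f x + g x) h = ip f h + ip g h"
    by (rule J[THEN conjunct1, rule_format])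
  note J = J[THEN conjunct2]
  show "f \<in> H \<Longrightarrow> g \<in> H \<Longrightarrow> ip (\<lambda>x. c * f x) g = c * ip f g" by (rule J[THEN conjunct1, rule_format])
  note J = J[THEN conjunct2, rule_format, THEN conjunct1]
  show "f \<in> H \<Longrightarrow> 0 \<le> ip f f" by (rule J)
  show "k z \<in> H" by (rule I[THEN conjunct2, THEN conjunct2, THEN conjunct1, rule_format])
  show "f \<in> H \<Longrightarrow> ip f (k z) = f z" by (rule I[THEN conjunct2, THEN conjunct2, THEN conjunct2, rule_format])
qed

lemma ip_add_right:
  assumes "f \<in> H" "g \<in> H" "h \<in> H"
  shows "ip h (\<lambda>x. f x + g x) = ip h f + ip h g"
  unfolding ip_commute[OF assms(3) add_mem[OF assms(1,2)]] ip_add_left[OF assms]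
  by (simp only: ip_commute[OF assms(3,1)] ip_commute[OF assms(3,2)])

lemma ip_scale_right:
  assumes "f \<in> H" "g \<in> H"
  shows "ip g (\<lambda>x. c * f x) = c * ip g f"
  unfolding ip_commute[OF assms(2) scale_mem[OF assms(1)]] ip_scale_left[OF assms]
  by (simp only: ip_commute[OF assms(2,1)])

lemma ip_zero: "ip (\<lambda>x. 0) (\<lambda>x. 0) = 0"
  using ip_scale_left[of "\<lambda>x. 0" "\<lambda>x. 0" 0] zero_mem by simp

lemma diff_scale_mem: "f \<in> H \<Longrightarrow> g \<in> H \<Longrightarrow> (\<lambda>x. f x - s * g x) \<in> H"
  using add_mem[of f "\<lambda>x. (- s) * g x"] scale_mem[of g "- s"] by simp

lemma diff_mem: "f \<in> H \<Longrightarrow> g \<in> H \<Longrightarrow> (\<lambda>x. f x - g x) \<in> H"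
  using diff_scale_mem[of f g 1] by simp

lemma ip_lincomb:
  assumes "f \<in> H" "g \<in> H"
  shows "ip (\<lambda>x. a * f x + b * g x) (\<lambda>x. a * f x + b * g x) = a\<^sup>2 * ip f f + 2 * a * b * ip f g + b\<^sup>2 * ip g g"
  using assms ip_commute[of f g]
  by (simp add: ip_add_left ip_add_right ip_scale_left ip_scale_right add_mem scale_mem power2_eq_square algebra_simps)

lemma ip_diff_scale:
  assumes "f \<in> H" "g \<in> H"
  shows "ip (\<lambda>x. f x - s * g x) (\<lambda>x. f x - s * g x) = ip f f - 2 * s * ip f g + s\<^sup>2 * ip g g"
  using ip_lincomb[OF assms, of 1 "- s"] by simp

lemma ip_diff:
  assumes "f \<in> H" "g \<in> H"
  shows "ip (\<lambda>x. f x - g x) (\<lambda>x. f x - g x) = ip f f - 2 * ip f g + ip g g"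
  using ip_diff_scale[OF assms, of 1] by simp

text \<open>Only convexity is kept for the penalty. The surplus, a quarter of the squared norm of f
  - g, is dropped because the energy term alone provides the distance between
  near-minimisers.\<close>

lemma ip_midpoint_le:
  assumes "f \<in> H" "g \<in> H"
  shows "ip (\<lambda>x. (f x + g x) / 2) (\<lambda>x. (f x + g x) / 2) \<le> (ip f f + ip g g) / 2"
proof -
  have "ip (\<lambda>x. (f x + g x) / 2) (\<lambda>x. (f x + g x) / 2) = (ip f f + 2 * ip f g + ip g g) / 4"
    using ip_lincomb[OF assms, of "1/2" "1/2"] by (simp add: power2_eq_square field_simps)
  moreover have "0 \<le> ip f f - 2 * ip f g + ip g g"
    using ip_nonneg[OF diff_mem[OF assms]] ip_diff[OF assms] by simp
  ultimately show ?thesis by simp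
qed

lemma Cauchy_Schwarz:
  assumes "f \<in> H" "g \<in> H"
  shows "(ip f g)\<^sup>2 \<le> ip f f * ip g g"
proof (cases "ip g g = 0")
  case True
  have "0 \<le> ip f f - 2 * s * ip f g" for s
    using ip_nonneg[OF diff_scale_mem[OF assms, of s]] ip_diff_scale[OF assms, of s] True by simp
  \<comment> \<open>If \<open>ip f g\<close> were nonzero, this value of \<open>s\<close> would give
    0 <= -1.\<close>
  from this[of "(ip f f + 1) / (2 * ip f g)"] have "ip f g = 0"
    by (cases "ip f g = 0") auto
  then show ?thesis using True by simp
next
  case False
  then have pos: "ip g g > 0" using ip_nonneg[OF assms(2)] by simp
  \<comment> \<open>The value of \<open>s\<close> at which the squared norm of f - s g is
    smallest.\<close>
  have "0 \<le> ip f f - 2 * (ip f g / ip g g) * ip f g + (ip f g / ip g g)\<^sup>2 * ip g g"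
    using ip_nonneg[OF diff_scale_mem[OF assms]] ip_diff_scale[OF assms] by metis
  also have "\<dots> = ip f f - (ip f g)\<^sup>2 / ip g g"
    using pos by (simp add: power2_eq_square field_simps)
  finally show ?thesis using pos by (simp add: field_simps)
qed

lemma eval_le: "f \<in> H \<Longrightarrow> (f z)\<^sup>2 \<le> ip f f * k z z"
  using Cauchy_Schwarz[of f "k z"] kernel_mem reproducing by metis

text \<open>Increments are pairings with k z - k w, whose squared norm is the last factor. For a
  translation-invariant kernel that factor is 2 (K 0 - K (z - w)), which later controls gradients by
  the \<open>H\<close> norm.\<close>

lemma eval_diff_le:
  assumes "f \<in> H"
  shows "(f z - f w)\<^sup>2 \<le> ip f f * (k z z - 2 * k z w + k w w)"
proof -
  have "ip f (\<lambda>x. k z x - k w x) = f z - f w"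
    using ip_add_right[OF kernel_mem scale_mem[OF kernel_mem] assms, of z "-1" w]
      ip_scale_right[OF kernel_mem assms, of "-1" w]
    by (simp add: reproducing assms)
  moreover have "ip (\<lambda>x. k z x - k w x) (\<lambda>x. k z x - k w x) = k z z - 2 * k z w + k w w"
    using ip_diff[of "k z" "k w"] by (simp add: kernel_mem reproducing)
  ultimately show ?thesis
    using Cauchy_Schwarz[OF assms diff_mem[OF kernel_mem kernel_mem]] by metis
qed

section \<open>Finite combinations of kernel sections and duality\<close>

definition comb :: "(real \<times> 'a) list \<Rightarrow> 'a \<Rightarrow> real" where
  "comb xs = (\<lambda>w. \<Sum>(c, z)\<leftarrow>xs. c * k z w)"

text \<open>The value that the inner product of \<open>f\<close> with \<open>comb xs\<close> would
  have if \<open>f\<close> were in \<open>H\<close>; it makes sense for every function. Coefficient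
  lists may repeat points, so appending and scaling need no merging of terms.\<close>

definition pairing :: "('a \<Rightarrow> real) \<Rightarrow> (real \<times> 'a) list \<Rightarrow> real" where
  "pairing f xs = (\<Sum>(c, z)\<leftarrow>xs. c * f z)"

abbreviation scale_list :: "real \<Rightarrow> (real \<times> 'a) list \<Rightarrow> (real \<times> 'a) list" where
  "scale_list s xs \<equiv> map (\<lambda>(c, z). (s * c, z)) xs"

lemma comb_simps [simp]:
  "comb [] = (\<lambda>w. 0)"
  "comb ((c, z) # xs) = (\<lambda>w. c * k z w + comb xs w)"
  "comb (xs @ ys) = (\<lambda>w. comb xs w + comb ys w)"
  by (auto simp: comb_def)

lemma pairing_simps [simp]:
  "pairing f [] = 0"
  "pairing f ((c, z) # xs) = c * f z + pairing f xs"
  "pairing f (xs @ ys) = pairing f xs + pairing f ys"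
  by (auto simp: pairing_def)

lemma comb_scale [simp]: "comb (scale_list s xs) = (\<lambda>w. s * comb xs w)"
  by (induction xs) (auto simp: algebra_simps)

lemma pairing_scale [simp]: "pairing f (scale_list s xs) = s * pairing f xs"
  by (induction xs) (auto simp: algebra_simps)

lemma comb_mem: "comb xs \<in> H"
  by (induction xs) (auto simp: zero_mem add_mem scale_mem kernel_mem)

lemma ip_comb: "f \<in> H \<Longrightarrow> ip f (comb xs) = pairing f xs"
proof (induction xs)
  case Nil
  then show ?case using ip_scale_right[of f f 0] by simp
next
  case (Cons a xs)
  then show ?case
    by (cases a) (simp add: ip_add_right ip_scale_right scale_mem kernel_mem comb_mem reproducing)
qed

text \<open>Expansion of the squared norm of f - comb xs. Together with
  \<open>mem_of_pairing_bound\<close> it makes \<open>ip f f\<close> the supremum of these left-hand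
  sides.\<close>

lemma two_pairing_le:
  assumes "f \<in> H"
  shows "2 * pairing f xs - ip (comb xs) (comb xs) \<le> ip f f"
  using ip_nonneg[OF diff_mem[OF assms comb_mem[of xs]]] ip_diff[OF assms comb_mem[of xs]]
  by (simp add: ip_comb assms)

text \<open>Riesz representation: a minimising sequence of \<open>\<parallel>g\<parallel>\<^sup>2 - 2 \<ell>(g)\<close> over finite combinations \<open>g\<close>
  of kernel sections is Cauchy, and the Euler equation identifies its limit with \<open>f\<close>.\<close>

lemma mem_of_pairing_bound:
  assumes bound: "\<And>xs. 2 * pairing f xs - ip (comb xs) (comb xs) \<le> C"
  shows "f \<in> H" and "ip f f \<le> C"
proof -
  define E where "E xs = ip (comb xs) (comb xs) - 2 * pairing f xs" for xs
  define m where "m = (INF xs. E xs)"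
  have bdd: "bdd_below (range E)"
  proof (rule bdd_belowI[of _ "- C"])
    fix x assume "x \<in> range E"
    then obtain xs where "x = E xs" by blast
    then show "- C \<le> x" using bound[of xs] by (simp add: E_def)
  qed
  have m_le: "m \<le> E xs" for xs
    unfolding m_def by (intro cINF_lower bdd) simp
  have "\<exists>xs. E xs < m + inverse (Suc n)" for n
    using cINF_less_iff[OF _ bdd, of "m + inverse (Suc n)"] unfolding m_def by auto
  then obtain X where X: "\<And>n. E (X n) < m + inverse (Suc n)" by metis
  define g where "g n = comb (X n)" for n
  have g_mem: "g n \<in> H" for n by (simp add: g_def comb_mem)
  have mid: "ip (\<lambda>x. g i x - g j x) (\<lambda>x. g i x - g j x) \<le> 2 * inverse (Suc i) + 2 * inverse (Suc j)" for i j
  proof -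
    \<comment> \<open>The averaged list represents the midpoint of \<open>g i\<close> and
      \<open>g j\<close>. Its value is at least \<open>m\<close>, so the parallelogram law bounds
      the distance of \<open>g i\<close> and \<open>g j\<close> by their excess over
      \<open>m\<close>.\<close>
    have "m \<le> E (scale_list (1/2) (X i @ X j))" by (rule m_le)
    also have "E (scale_list (1/2) (X i @ X j)) =
        ip (\<lambda>w. (1/2) * g i w + (1/2) * g j w) (\<lambda>w. (1/2) * g i w + (1/2) * g j w) - pairing f (X i) - pairing f (X j)"
      unfolding E_def comb_scale pairing_scale by (simp add: g_def field_simps)
    also have "\<dots> = (ip (g i) (g i) + 2 * ip (g i) (g j) + ip (g j) (g j)) / 4 - pairing f (X i) - pairing f (X j)"
      using ip_lincomb[OF g_mem g_mem, of "1/2" i "1/2" j] by (simp add: power2_eq_square field_simps)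
    also have "\<dots> = E (X i) / 2 + E (X j) / 2 - ip (\<lambda>x. g i x - g j x) (\<lambda>x. g i x - g j x) / 4"
      using ip_diff[OF g_mem g_mem, of i j] by (simp add: E_def g_def field_simps)
    finally show ?thesis using X[of i] X[of j] by simp
  qed
  have "\<exists>N. \<forall>i\<ge>N. \<forall>j\<ge>N. rkhs_norm ip (\<lambda>x. g i x - g j x) < e" if "e > 0" for e
  proof -
    have "\<forall>\<^sub>F n in sequentially. inverse (real (Suc n)) < e\<^sup>2 / 4"
      using LIMSEQ_inverse_real_of_nat that by (intro order_tendstoD) auto
    then obtain N where N: "\<And>n. n \<ge> N \<Longrightarrow> inverse (real (Suc n)) < e\<^sup>2 / 4"
      unfolding eventually_sequentially by auto
    have "rkhs_norm ip (\<lambda>x. g i x - g j x) < e" if "i \<ge> N" "j \<ge> N" for i j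
    proof -
      have "ip (\<lambda>x. g i x - g j x) (\<lambda>x. g i x - g j x) < e\<^sup>2"
        using mid[of i j] N[OF that(1)] N[OF that(2)] by simp
      then have "sqrt (ip (\<lambda>x. g i x - g j x) (\<lambda>x. g i x - g j x)) < sqrt (e\<^sup>2)"
        by (rule real_sqrt_less_mono)
      then show ?thesis using \<open>e > 0\<close> by (simp add: rkhs_norm_def)
    qed
    then show ?thesis by blast
  qed
  moreover have "complete_for H ip" using rkhs by (simp add: is_rkhs_def)
  ultimately obtain h where h: "h \<in> H" and lim: "(\<lambda>n. rkhs_norm ip (\<lambda>x. g n x - h x)) \<longlonglongrightarrow> 0"
    using g_mem \<open>complete_for H ip\<close>[unfolded complete_for_def, rule_format, of g] by fast
  have lim2: "(\<lambda>n. ip (\<lambda>x. g n x - h x) (\<lambda>x. g n x - h x)) \<longlonglongrightarrow> 0"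
    using tendsto_power[OF lim, of 2] ip_nonneg[OF diff_mem[OF g_mem h]] by (simp add: rkhs_norm_def)
  have pt: "(\<lambda>n. g n z) \<longlonglongrightarrow> h z" for z
  proof -
    have "(\<lambda>n. ip (\<lambda>x. g n x - h x) (\<lambda>x. g n x - h x) * k z z) \<longlonglongrightarrow> 0"
      using tendsto_mult_right[OF lim2, of "k z z"] by simp
    then have "(\<lambda>n. (g n z - h z)\<^sup>2) \<longlonglongrightarrow> 0"
      by (rule Lim_null_comparison[rotated]) (use eval_le[OF diff_mem[OF g_mem h]] in auto)
    then show ?thesis using LIM_zero_cancel by force
  qed
  have "h z = f z" for z
  proof -
    \<comment> \<open>First variation: adding \<open>s * k z\<close> to the nearly minimising
      \<open>g n\<close> cannot gain more than the excess of \<open>g n\<close> over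
      \<open>m\<close>, and this excess disappears in the limit.\<close>
    have var: "0 \<le> 2 * s * (h z - f z) + s\<^sup>2 * k z z" for s
    proof -
      have "0 \<le> inverse (real (Suc n)) + 2 * s * (g n z - f z) + s\<^sup>2 * k z z" for n
      proof -
        have "m \<le> E ((s, z) # X n)" by (rule m_le)
        also have "E ((s, z) # X n) = E (X n) + 2 * s * (g n z - f z) + s\<^sup>2 * k z z"
          using ip_lincomb[OF kernel_mem[of z] g_mem[of n], of s 1] ip_commute[OF kernel_mem[of z] g_mem[of n]]
          by (simp add: E_def g_def[symmetric] reproducing kernel_mem g_mem algebra_simps)
        finally show ?thesis using X[of n] by simp
      qed
      moreover have "(\<lambda>n. inverse (real (Suc n)) + 2 * s * (g n z - f z) + s\<^sup>2 * k z z)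
          \<longlonglongrightarrow> 0 + 2 * s * (h z - f z) + s\<^sup>2 * k z z"
        by (intro tendsto_intros pt LIMSEQ_inverse_real_of_nat)
      ultimately show ?thesis
        by (metis (no_types, lifting) LIMSEQ_le_const add_0)
    qed
    have kz: "k z z \<ge> 0" using ip_nonneg[OF kernel_mem[of z]] reproducing[OF kernel_mem[of z]] by simp
    show ?thesis
    proof (rule ccontr)
      assume ne: "h z \<noteq> f z"
      \<comment> \<open>Substituting \<open>s = - q\<close> in \<open>var\<close> gives - q^2 (k z z
        + 2). The added 1 keeps the denominator positive when \<open>k z z\<close> is 0.\<close>
      define q where "q = (h z - f z) / (k z z + 1)"
      have q: "h z - f z = q * (k z z + 1)" "q \<noteq> 0" using kz ne by (auto simp: q_def)
      have "0 \<le> 2 * (- q) * (h z - f z) + (- q)\<^sup>2 * k z z" by (rule var)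
      also have "\<dots> = - (q\<^sup>2 * (k z z + 2))"
        unfolding q by (simp add: power2_eq_square algebra_simps)
      also have "\<dots> < 0" using q(2) kz by (simp add: zero_less_mult_iff)
      finally show False by simp
    qed
  qed
  then have "h = f" by auto
  with h show f: "f \<in> H" by simp
  \<comment> \<open>The squared norm of f is that of g n - f, plus twice the inner product of f and
    g n, minus the squared norm of g n; \<open>bound\<close> controls the last two terms
    together.\<close>
  have "ip f f \<le> ip (\<lambda>x. g n x - f x) (\<lambda>x. g n x - f x) + C" for n
    using bound[of "X n"] ip_diff[OF g_mem f] ip_comb[OF f, of "X n"] ip_commute[OF f g_mem[of n]]
    by (simp add: g_def)
  then show "ip f f \<le> C"
    using lim2 unfolding \<open>h = f\<close> by (intro LIMSEQ_le_const[OF tendsto_add[OF lim2[unfolded \<open>h = f\<close>] tendsto_const], of _ C, simplified]) auto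
qed

text \<open>Completing the square: 2 B r - r^2 <= B^2, with r the norm of the combination. A
  functional bounded on combinations therefore meets the criterion above with constant B^2.\<close>

lemma mem_of_functional_bound:
  assumes "\<And>xs. \<bar>pairing f xs\<bar> \<le> B * sqrt (ip (comb xs) (comb xs))"
  shows "f \<in> H"
proof (rule mem_of_pairing_bound)
  fix xs
  let ?n = "sqrt (ip (comb xs) (comb xs))"
  have "0 \<le> (?n - B)\<^sup>2" by simp
  also have "\<dots> = ?n\<^sup>2 - 2 * B * ?n + B\<^sup>2" by (simp add: power2_eq_square algebra_simps)
  also have "?n\<^sup>2 = ip (comb xs) (comb xs)" using ip_nonneg[OF comb_mem] by simp
  finally show "2 * pairing f xs - ip (comb xs) (comb xs) \<le> B\<^sup>2"
    using assms[of xs] by (simp add: abs_le_iff)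
qed

text \<open>The supremum formula for \<open>ip f f\<close>, put in terms of superlevel sets for the
  measurability proof.\<close>

lemma ip_gt_iff:
  assumes "f \<in> H"
  shows "a < ip f f \<longleftrightarrow> (\<exists>xs. a < 2 * pairing f xs - ip (comb xs) (comb xs))"
  using mem_of_pairing_bound(2)[of f a] two_pairing_le[OF assms] by (meson not_less less_le_trans)

text \<open>\<open>ip (F t) (F t)\<close> is a supremum of continuous functions of \<open>t\<close>, hence lower semicontinuous.\<close>

lemma borel_measurable_ip:
  fixes F :: "real \<Rightarrow> 'a \<Rightarrow> real"
  assumes "\<And>t. t \<in> S \<Longrightarrow> F t \<in> H" "\<And>w. continuous_on S (\<lambda>t. F t w)" "S \<in> sets borel"
  shows "(\<lambda>t. ip (F t) (F t)) \<in> borel_measurable (restrict_space borel S)"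
proof (rule borel_measurableI_greater)
  fix a
  have cont: "continuous_on S (\<lambda>t. 2 * pairing (F t) xs - ip (comb xs) (comb xs))" for xs
  proof -
    have "continuous_on S (\<lambda>t. pairing (F t) xs)"
      by (induction xs) (auto intro!: continuous_on_add continuous_on_mult continuous_on_const assms(2))
    then show ?thesis by (intro continuous_intros)
  qed
  have "\<forall>xs. \<exists>A. open A \<and> A \<inter> S = (\<lambda>t. 2 * pairing (F t) xs - ip (comb xs) (comb xs)) -` {a<..} \<inter> S"
    by (intro allI cont[THEN continuous_on_open_invariant[THEN iffD1], rule_format] open_greaterThan)
  from choice[OF this] obtain A where A: "\<And>xs. open (A xs)"
    "\<And>xs. A xs \<inter> S = (\<lambda>t. 2 * pairing (F t) xs - ip (comb xs) (comb xs)) -` {a<..} \<inter> S"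
    by blast
  \<comment> \<open>The union runs over uncountably many lists, which is harmless because every
    \<open>A xs\<close> is open.\<close>
  have "{t \<in> space (restrict_space borel S). a < ip (F t) (F t)} = (\<Union>xs. A xs \<inter> S)"
    unfolding A(2) by (auto simp: space_restrict_space ip_gt_iff[OF assms(1)])
  also have "\<dots> \<in> sets (restrict_space borel S)"
    unfolding sets_restrict_space using A(1)
    by (intro image_eqI[of _ _ "\<Union>xs. A xs"] borel_open) auto
  finally show "{t \<in> space (restrict_space borel S). a < ip (F t) (F t)} \<in> sets (restrict_space borel S)" .
qed

end

section \<open>Gaussians and Fourier inversion\<close>

lemma iexp_add: "iexp (x + y) = iexp x * iexp y"
  by (simp add: distrib_left exp_add)

lemma iexp_diff: "iexp (x - y) = iexp x * iexp (- y)"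
  using iexp_add[of x "- y"] by simp

lemma norm_iexp_minus_1_le: "norm (iexp x - 1) \<le> \<bar>x\<bar>"
  using iexp_approx1[of x 0] by simp

lemma Fubini_dominated:
  fixes f :: "'a \<Rightarrow> 'b \<Rightarrow> 'c::{banach, second_countable_topology}"
    and \<alpha> :: "'a \<Rightarrow> real" and \<beta> :: "'b \<Rightarrow> real"
  assumes M: "sigma_finite_measure M" and N: "sigma_finite_measure N"
    and f: "case_prod f \<in> borel_measurable (M \<Otimes>\<^sub>M N)"
    and \<alpha>: "integrable M \<alpha>" and \<beta>: "integrable N \<beta>"
    and le: "\<And>x y. norm (f x y) \<le> \<alpha> x * \<beta> y"
  shows "(\<integral>x. (\<integral>y. f x y \<partial>N) \<partial>M) = (\<integral>y. (\<integral>x. f x y \<partial>M) \<partial>N)"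
    and "integrable M (\<lambda>x. \<integral>y. f x y \<partial>N)"
    and "integrable N (\<lambda>y. \<integral>x. f x y \<partial>M)"
proof -
  interpret pair_sigma_finite M N using M N by (simp add: pair_sigma_finite_def)
  have [measurable]: "\<alpha> \<in> borel_measurable M" "\<beta> \<in> borel_measurable N" using \<alpha> \<beta> by auto
  have "integrable (M \<Otimes>\<^sub>M N) (\<lambda>(x, y). \<alpha> x * \<beta> y)"
  proof (rule Fubini_integrable)
    show "(\<lambda>(x, y). \<alpha> x * \<beta> y) \<in> borel_measurable (M \<Otimes>\<^sub>M N)" by measurable
    show "integrable M (\<lambda>x. \<integral>y. norm (case (x, y) of (x, y) \<Rightarrow> \<alpha> x * \<beta> y) \<partial>N)"
      using \<alpha> by (simp add: abs_mult)
    show "AE x in M. integrable N (\<lambda>y. case (x, y) of (x, y) \<Rightarrow> \<alpha> x * \<beta> y)"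
      using \<beta> by simp
  qed
  then have *: "integrable (M \<Otimes>\<^sub>M N) (case_prod f)"
    by (rule Bochner_Integration.integrable_bound[OF _ f]) (use le in \<open>auto intro!: AE_I2 order_trans[OF _ abs_ge_self]\<close>)
  show "(\<integral>x. (\<integral>y. f x y \<partial>N) \<partial>M) = (\<integral>y. (\<integral>x. f x y \<partial>M) \<partial>N)"
    using Fubini_integral[OF *] by simp
  show "integrable M (\<lambda>x. \<integral>y. f x y \<partial>N)" "integrable N (\<lambda>y. \<integral>x. f x y \<partial>M)"
    using integrable_fst[OF *] integrable_snd[OF *] by auto
qed

lemma
  fixes f :: "'a::euclidean_space \<Rightarrow> 'b::{banach, second_countable_topology}"
  assumes c: "c \<noteq> 0"
  shows integrable_lborel_affine: "integrable lborel f \<Longrightarrow> integrable lborel (\<lambda>x. f (t + c *\<^sub>R x))"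
    and integral_lborel_affine:
      "integrable lborel f \<Longrightarrow> (\<integral>x. f x \<partial>lborel) = \<bar>c\<bar> ^ DIM('a) *\<^sub>R (\<integral>x. f (t + c *\<^sub>R x) \<partial>lborel)"
proof -
  assume f: "integrable lborel f"
  then have [measurable]: "f \<in> borel_measurable borel" by auto
  have "integrable (density (distr lborel borel (\<lambda>x. t + c *\<^sub>R x)) (\<lambda>_. ennreal (\<bar>c\<bar> ^ DIM('a)))) f"
    using f unfolding lborel_affine[OF c, of t, symmetric] .
  then have "integrable lborel (\<lambda>x. \<bar>c\<bar> ^ DIM('a) *\<^sub>R f (t + c *\<^sub>R x))"
    by (simp add: integrable_density integrable_distr_eq)
  then have "integrable lborel (\<lambda>x. (1 / \<bar>c\<bar> ^ DIM('a)) *\<^sub>R (\<bar>c\<bar> ^ DIM('a) *\<^sub>R f (t + c *\<^sub>R x)))"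
    by (rule integrable_scaleR_right)
  then show "integrable lborel (\<lambda>x. f (t + c *\<^sub>R x))" using c by simp
  show "(\<integral>x. f x \<partial>lborel) = \<bar>c\<bar> ^ DIM('a) *\<^sub>R (\<integral>x. f (t + c *\<^sub>R x) \<partial>lborel)"
    by (subst lborel_affine[OF c, of t]) (simp add: integral_density integral_distr)
qed

section \<open>Gaussian integrals, mollification and inversion\<close>

definition gauss :: "'a::euclidean_space \<Rightarrow> real" where
  "gauss x = exp (- (norm x)\<^sup>2 / 2)"

lemma gauss_nonneg: "gauss x \<ge> 0"
  and gauss_le_1: "gauss x \<le> 1"
  and gauss_minus: "gauss (- x) = gauss x"
  and gauss_zero: "gauss 0 = 1"
  by (auto simp: gauss_def)

lemma continuous_gauss: "continuous_on A gauss"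
  unfolding gauss_def by (intro continuous_intros) auto

lemma borel_measurable_gauss [measurable]: "gauss \<in> borel_measurable borel"
  by (intro borel_measurable_continuous_onI continuous_gauss)

text \<open>The Gaussian is sqrt (2 pi) times \<open>std_normal_density\<close>, so the integral is
  a multiple of the characteristic function of the standard normal distribution.\<close>

lemma
  fixes t :: real
  shows integrable_gauss_iexp_real: "integrable lborel (\<lambda>x. complex_of_real (exp (- x\<^sup>2 / 2)) * iexp (x * t))"
    and integral_gauss_iexp_real:
      "(\<integral>x. complex_of_real (exp (- x\<^sup>2 / 2)) * iexp (x * t) \<partial>lborel) = of_real (sqrt (2 * pi) * exp (- t\<^sup>2 / 2))"
proof -
  have eq: "exp (- x\<^sup>2 / 2) = sqrt (2 * pi) * std_normal_density x" for x :: real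
    by (simp add: std_normal_density_def)
  have "integrable lborel (\<lambda>x. sqrt (2 * pi) * std_normal_density x)" by auto
  then have "integrable lborel (\<lambda>x::real. exp (- x\<^sup>2 / 2))" unfolding eq .
  then show "integrable lborel (\<lambda>x. complex_of_real (exp (- x\<^sup>2 / 2)) * iexp (x * t))"
    by (rule Bochner_Integration.integrable_bound) (auto simp: norm_mult)
  have "(\<integral>x. complex_of_real (exp (- x\<^sup>2 / 2)) * iexp (x * t) \<partial>lborel)
      = (\<integral>x. sqrt (2 * pi) *\<^sub>R (std_normal_density x *\<^sub>R iexp (t * x)) \<partial>lborel)"
    by (intro Bochner_Integration.integral_cong refl) (simp only: eq scaleR_conv_of_real of_real_mult mult_ac)
  also have "\<dots> = sqrt (2 * pi) *\<^sub>R char std_normal_distribution t"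
    unfolding char_def by (subst integral_density) (auto simp only: integral_scaleR_right, auto)
  finally show "(\<integral>x. complex_of_real (exp (- x\<^sup>2 / 2)) * iexp (x * t) \<partial>lborel) = of_real (sqrt (2 * pi) * exp (- t\<^sup>2 / 2))"
    by (simp add: char_std_normal_distribution scaleR_conv_of_real)
qed

text \<open>Lebesgue measure is the image of a product of one-dimensional Lebesgue measures under
  the coordinate map, and the integrand splits into a product over \<open>Basis\<close>; the
  one-dimensional formula applies factor by factor.\<close>

lemma
  fixes v :: "'a::euclidean_space"
  shows integrable_gauss_iexp: "integrable lborel (\<lambda>x. complex_of_real (gauss x) * iexp (x \<bullet> v))"
    and integral_gauss_iexp:
      "(\<integral>x. complex_of_real (gauss x) * iexp (x \<bullet> v) \<partial>lborel) = of_real (sqrt (2 * pi) ^ DIM('a) * gauss v)"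
proof -
  interpret product_sigma_finite "\<lambda>_::'a. lborel :: real measure" by standard
  let ?P = "\<Pi>\<^sub>M b\<in>Basis. (lborel :: real measure)"
  let ?S = "\<lambda>f. \<Sum>b\<in>Basis. f b *\<^sub>R (b::'a)"
  let ?g = "\<lambda>x. complex_of_real (gauss x) * iexp (x \<bullet> v)"
  let ?h = "\<lambda>b x. complex_of_real (exp (- x\<^sup>2 / 2)) * iexp (x * (v \<bullet> b))"
  have S: "?S \<in> borel_measurable ?P" by measurable
  have norm_sq: "(norm x)\<^sup>2 = (\<Sum>b\<in>Basis. (x \<bullet> b)\<^sup>2)" for x :: 'a
    unfolding power2_norm_eq_inner by (subst euclidean_inner) (simp add: power2_eq_square)
  have inner_S: "?S f \<bullet> b = f b" if "b \<in> Basis" for f b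
    using that by (simp add: inner_sum_left inner_Basis if_distrib cong: if_cong)
  then have inner_S': "b \<bullet> ?S f = f b" if "b \<in> Basis" for f b
    using that by (simp only: inner_commute)
  have g: "?g (?S f) = (\<Prod>b\<in>Basis. ?h b (f b))" for f
    unfolding gauss_def norm_sq euclidean_inner[of "?S f" v] prod.distrib
    by (simp add: inner_S inner_S' sum_negf[symmetric] sum_divide_distrib exp_sum sum_distrib_left inner_commute[of _ v])
  have gm: "?g \<in> borel_measurable borel" by measurable
  have L: "(lborel :: 'a measure) = distr ?P borel ?S" by (rule lborel_eq)
  have "integrable ?P (\<lambda>f. \<Prod>b\<in>Basis. ?h b (f b))"
    by (intro product_integrable_prod finite_Basis integrable_gauss_iexp_real)
  then show "integrable lborel ?g"
    unfolding L integrable_distr_eq[OF S gm] g .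
  have "(\<integral>x. ?g x \<partial>lborel) = (\<integral>f. (\<Prod>b\<in>Basis. ?h b (f b)) \<partial>?P)"
    unfolding L integral_distr[OF S gm] g ..
  also have "\<dots> = (\<Prod>b\<in>Basis. (\<integral>x. ?h b x \<partial>lborel))"
    by (intro product_integral_prod finite_Basis integrable_gauss_iexp_real)
  also have "\<dots> = (\<Prod>b\<in>Basis. of_real (sqrt (2 * pi) * exp (- (v \<bullet> b)\<^sup>2 / 2)))"
    unfolding integral_gauss_iexp_real ..
  also have "\<dots> = of_real (sqrt (2 * pi) ^ DIM('a) * gauss v)"
    unfolding of_real_prod[symmetric] prod.distrib gauss_def norm_sq
    by (simp add: sum_negf[symmetric] sum_divide_distrib exp_sum)
  finally show "(\<integral>x. ?g x \<partial>lborel) = of_real (sqrt (2 * pi) ^ DIM('a) * gauss v)" .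
qed

lemma integrable_gauss: "integrable lborel (gauss :: 'a::euclidean_space \<Rightarrow> real)"
  using integrable_norm[OF integrable_gauss_iexp[of 0]]
  by (simp add: norm_mult abs_of_nonneg[OF gauss_nonneg])

lemma integral_gauss: "(\<integral>x. gauss (x::'a::euclidean_space) \<partial>lborel) = sqrt (2 * pi) ^ DIM('a)"
proof -
  have "complex_of_real (\<integral>x. gauss (x::'a) \<partial>lborel) = of_real (sqrt (2 * pi) ^ DIM('a))"
    using integral_gauss_iexp[of "0::'a"] by (simp add: gauss_zero)
  then show ?thesis unfolding of_real_eq_iff .
qed

lemma integrable_exp_neg_norm_sq:
  assumes "c > 0"
  shows "integrable lborel (\<lambda>x::'a::euclidean_space. exp (- c * (norm x)\<^sup>2))"
proof -
  have "gauss (0 + sqrt (2 * c) *\<^sub>R x) = exp (- c * (norm x)\<^sup>2)" for x :: 'a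
    using assms by (simp add: gauss_def power_mult_distrib)
  then show ?thesis
    using integrable_lborel_affine[OF _ integrable_gauss, of "sqrt (2 * c)" "0::'a"] assms by simp
qed

text \<open>Half of the exponent pays for the linear growth: 1 + s <= 2 (1 + s^2/4) <= 2 exp
  (s^2/4). The other half remains and is integrable.\<close>

lemma one_plus_gauss_le: "(1 + norm x) * gauss x \<le> 2 * exp (- (1/4) * (norm x)\<^sup>2)"
proof -
  let ?s = "norm x"
  have "1 + ?s \<le> 2 * (1 + ?s\<^sup>2 / 4)"
    using zero_le_power2[of "?s - 1"] by (simp add: power2_eq_square algebra_simps)
  also have "\<dots> \<le> 2 * exp (?s\<^sup>2 / 4)" by (intro mult_left_mono exp_ge_add_one_self) simp
  finally have "(1 + ?s) * gauss x \<le> 2 * exp (?s\<^sup>2 / 4) * gauss x"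
    by (rule mult_right_mono) (rule gauss_nonneg)
  also have "\<dots> = 2 * exp (- (1/4) * ?s\<^sup>2)"
    by (simp add: gauss_def exp_add[symmetric] mult.assoc)
  finally show ?thesis .
qed

lemma integrable_one_plus_gauss:
  "integrable lborel (\<lambda>x::'a::euclidean_space. (1 + norm x) * gauss x)"
proof (rule Bochner_Integration.integrable_bound)
  show "integrable lborel (\<lambda>x::'a. 2 * exp (- (1/4) * (norm x)\<^sup>2))"
    by (intro integrable_mult_right integrable_exp_neg_norm_sq) simp
  show "AE x in lborel. norm ((1 + norm x) * gauss x) \<le> norm (2 * exp (- (1/4) * (norm (x::'a))\<^sup>2))"
    using one_plus_gauss_le by (auto simp: abs_mult gauss_nonneg)
qed measurable

text \<open>Dominated convergence with majorant C (1 + |x|) (1 + |y|) \<open>gauss y\<close>. Linear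
  growth is allowed because the symbol of the continuity-equation functional grows linearly;
  continuity is asked only at \<open>x\<close> because gradients of extended test functions jump on
  null sets.\<close>

lemma gauss_mollify_tendsto:
  fixes f :: "'a::euclidean_space \<Rightarrow> 'b::{banach, second_countable_topology}" and e :: "nat \<Rightarrow> real"
  assumes f[measurable]: "f \<in> borel_measurable borel"
    and growth: "\<And>x. norm (f x) \<le> C * (1 + norm x)"
    and cont: "isCont f x"
    and e: "e \<longlonglongrightarrow> 0" "\<And>n. \<bar>e n\<bar> \<le> 1"
  shows "(\<lambda>n. \<integral>y. gauss y *\<^sub>R f (x + e n *\<^sub>R y) \<partial>lborel) \<longlonglongrightarrow> sqrt (2 * pi) ^ DIM('a) *\<^sub>R f x"
proof -
  have C: "C \<ge> 0" using order_trans[OF norm_ge_zero growth[of 0]] by simp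
  have "(\<lambda>n. \<integral>y. gauss y *\<^sub>R f (x + e n *\<^sub>R y) \<partial>lborel) \<longlonglongrightarrow> (\<integral>y. gauss (y::'a) *\<^sub>R f x \<partial>lborel)"
  proof (rule integral_dominated_convergence[where w="\<lambda>y::'a. C * (1 + norm x) * ((1 + norm y) * gauss y)"])
    show "integrable lborel (\<lambda>y::'a. C * (1 + norm x) * ((1 + norm y) * gauss y))"
      by (intro integrable_mult_right integrable_one_plus_gauss)
    show "AE y in lborel. (\<lambda>n. gauss y *\<^sub>R f (x + e n *\<^sub>R y)) \<longlonglongrightarrow> gauss y *\<^sub>R f x"
    proof (intro AE_I2 tendsto_scaleR tendsto_const isCont_tendsto_compose[OF cont])
      fix y show "(\<lambda>n. x + e n *\<^sub>R y) \<longlonglongrightarrow> x"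
        using tendsto_add[OF tendsto_const tendsto_scaleR[OF e(1) tendsto_const], of x y] by simp
    qed
    show "AE y in lborel. norm (gauss y *\<^sub>R f (x + e n *\<^sub>R y)) \<le> C * (1 + norm x) * ((1 + norm y) * gauss y)" for n
    proof (rule AE_I2)
      fix y :: 'a
      have "norm (x + e n *\<^sub>R y) \<le> norm x + 1 * norm y"
        using norm_triangle_ineq[of x "e n *\<^sub>R y"] mult_right_mono[OF e(2)[of n] norm_ge_zero[of y]] by simp
      then have "1 + norm (x + e n *\<^sub>R y) \<le> (1 + norm x) * (1 + norm y)"
        using mult_nonneg_nonneg[OF norm_ge_zero[of x] norm_ge_zero[of y]]
        unfolding distrib_left distrib_right mult_1_left mult_1_right by linarith
      then have "norm (f (x + e n *\<^sub>R y)) \<le> C * ((1 + norm x) * (1 + norm y))"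
        using order_trans[OF growth] mult_left_mono[OF _ C] by blast
      from mult_right_mono[OF this gauss_nonneg[of y]]
      show "norm (gauss y *\<^sub>R f (x + e n *\<^sub>R y)) \<le> C * (1 + norm x) * ((1 + norm y) * gauss y)"
        by (simp add: gauss_nonneg mult_ac)
    qed
  qed measurable
  then show ?thesis by (simp add: integral_gauss integrable_gauss)
qed

lemma
  fixes v :: "'a::euclidean_space"
  assumes e: "e > 0"
  shows integrable_gauss_scaled_iexp: "integrable lborel (\<lambda>z. complex_of_real (gauss (e *\<^sub>R z)) * iexp (z \<bullet> v))"
    and integral_gauss_scaled_iexp: "(\<integral>z. complex_of_real (gauss (e *\<^sub>R z)) * iexp (z \<bullet> v) \<partial>lborel) =
      of_real (sqrt (2 * pi) ^ DIM('a) / e ^ DIM('a) * gauss ((1 / e) *\<^sub>R v))"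
proof -
  let ?f = "\<lambda>x. complex_of_real (gauss x) * iexp (x \<bullet> ((1 / e) *\<^sub>R v))"
  have eq: "?f (0 + e *\<^sub>R z) = complex_of_real (gauss (e *\<^sub>R z)) * iexp (z \<bullet> v)" for z
    using e by simp
  show "integrable lborel (\<lambda>z. complex_of_real (gauss (e *\<^sub>R z)) * iexp (z \<bullet> v))"
    using integrable_lborel_affine[OF _ integrable_gauss_iexp, of e 0 "(1 / e) *\<^sub>R v"] e unfolding eq by simp
  show "(\<integral>z. complex_of_real (gauss (e *\<^sub>R z)) * iexp (z \<bullet> v) \<partial>lborel) =
      of_real (sqrt (2 * pi) ^ DIM('a) / e ^ DIM('a) * gauss ((1 / e) *\<^sub>R v))"
    using integral_lborel_affine[OF _ integrable_gauss_iexp, of e "(1 / e) *\<^sub>R v" 0] e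
    unfolding eq integral_gauss_iexp by (simp add: scaleR_conv_of_real field_simps)
qed

text \<open>Gaussian regularisation: \<open>F\<close> times a wide Gaussian is the transform of \<open>f\<close> convolved with a
  narrow one, and the latter approximates \<open>f\<close> pointwise.\<close>

lemma fourier_inversion:
  fixes f :: "'a::euclidean_space \<Rightarrow> complex"
  assumes cont: "continuous_on UNIV f" and int: "integrable lborel f"
    and growth: "\<And>x. norm (f x) \<le> C * (1 + norm x)"
    and F: "\<And>z. F z = (\<integral>\<xi>. iexp (- (z \<bullet> \<xi>)) * f \<xi> \<partial>lborel)"
    and int_F: "integrable lborel F"
  shows "(\<integral>z. iexp (z \<bullet> x) * F z \<partial>lborel) = of_real ((2 * pi) ^ DIM('a)) * f x"
proof -
  define e where "e n = inverse (real (Suc n))" for n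
  have e: "e \<longlonglongrightarrow> 0" "\<And>n. \<bar>e n\<bar> \<le> 1" "\<And>n. e n > 0"
    unfolding e_def using LIMSEQ_inverse_real_of_nat by (auto simp: field_simps)
  have [measurable]: "f \<in> borel_measurable borel" "F \<in> borel_measurable borel" using int int_F by auto
  let ?A = "\<lambda>n. \<integral>z. gauss (e n *\<^sub>R z) *\<^sub>R (iexp (z \<bullet> x) * F z) \<partial>lborel"
  have "?A \<longlonglongrightarrow> (\<integral>z. gauss (0::'a) *\<^sub>R (iexp (z \<bullet> x) * F z) \<partial>lborel)"
  proof (rule integral_dominated_convergence[where w="\<lambda>z. norm (F z)"])
    have "isCont gauss (0::'a)"
      using continuous_gauss[of "UNIV :: 'a set"] by (simp add: continuous_on_eq_continuous_at)
    then show "AE z in lborel. (\<lambda>n. gauss (e n *\<^sub>R z) *\<^sub>R (iexp (z \<bullet> x) * F z))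
        \<longlonglongrightarrow> gauss (0::'a) *\<^sub>R (iexp (z \<bullet> x) * F z)"
      using tendsto_scaleR[OF e(1) tendsto_const]
      by (intro AE_I2 tendsto_scaleR tendsto_const isCont_tendsto_compose[where g=gauss]) auto
    show "AE z in lborel. norm (gauss (e n *\<^sub>R z) *\<^sub>R (iexp (z \<bullet> x) * F z)) \<le> norm (F z)" for n
      by (auto intro!: AE_I2 mult_left_le_one_le simp: norm_mult gauss_nonneg gauss_le_1)
  qed (use int_F in auto)
  then have lim: "?A \<longlonglongrightarrow> (\<integral>z. iexp (z \<bullet> x) * F z \<partial>lborel)" by (simp add: gauss_zero)
  \<comment> \<open>Insert the integral for \<open>F\<close>, exchange the integrals, integrate the
    Gaussian in \<open>z\<close>, and substitute \<xi> = x + e y; the powers of \<open>e n\<close>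
    cancel.\<close>
  have A: "?A n = sqrt (2 * pi) ^ DIM('a) *\<^sub>R (\<integral>y. gauss y *\<^sub>R f (x + e n *\<^sub>R y) \<partial>lborel)" for n
  proof -
    let ?e = "e n"
    have "?A n = (\<integral>z. (\<integral>\<xi>. (of_real (gauss (?e *\<^sub>R z)) * iexp (z \<bullet> (x - \<xi>))) * f \<xi> \<partial>lborel) \<partial>lborel)"
    proof (rule Bochner_Integration.integral_cong[OF refl])
      fix z
      have "gauss (?e *\<^sub>R z) *\<^sub>R (iexp (z \<bullet> x) * F z)
          = (\<integral>\<xi>. of_real (gauss (?e *\<^sub>R z)) * iexp (z \<bullet> x) * (iexp (- (z \<bullet> \<xi>)) * f \<xi>) \<partial>lborel)"
        by (simp add: F scaleR_conv_of_real)
      then show "gauss (?e *\<^sub>R z) *\<^sub>R (iexp (z \<bullet> x) * F z)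
          = (\<integral>\<xi>. (of_real (gauss (?e *\<^sub>R z)) * iexp (z \<bullet> (x - \<xi>))) * f \<xi> \<partial>lborel)"
        unfolding inner_diff_right iexp_diff by (simp add: mult.assoc)
    qed
    also have "\<dots> = (\<integral>\<xi>. (\<integral>z. (of_real (gauss (?e *\<^sub>R z)) * iexp (z \<bullet> (x - \<xi>))) * f \<xi> \<partial>lborel) \<partial>lborel)"
    proof (rule Fubini_dominated(1)[where \<alpha>="\<lambda>z. gauss (?e *\<^sub>R z)" and \<beta>="\<lambda>\<xi>. norm (f \<xi>)"])
      show "integrable lborel (\<lambda>z::'a. gauss (?e *\<^sub>R z))"
        using integrable_lborel_affine[OF _ integrable_gauss, of ?e "0::'a"] e(3)[of n] by simp
    qed (use int in \<open>auto simp: norm_mult gauss_nonneg lborel.sigma_finite_measure_axioms\<close>)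
    also have "\<dots> = (\<integral>\<xi>. of_real (sqrt (2 * pi) ^ DIM('a) / ?e ^ DIM('a) * gauss ((1 / ?e) *\<^sub>R (x - \<xi>))) * f \<xi> \<partial>lborel)"
      by (simp add: integral_gauss_scaled_iexp[OF e(3)] integrable_gauss_scaled_iexp[OF e(3)])
    also have "\<dots> = \<bar>?e\<bar> ^ DIM('a) *\<^sub>R (\<integral>y. of_real (sqrt (2 * pi) ^ DIM('a) / ?e ^ DIM('a) *
        gauss ((1 / ?e) *\<^sub>R (x - (x + ?e *\<^sub>R y)))) * f (x + ?e *\<^sub>R y) \<partial>lborel)"
    proof (rule integral_lborel_affine)
      show "integrable lborel (\<lambda>\<xi>. of_real (sqrt (2 * pi) ^ DIM('a) / ?e ^ DIM('a) * gauss ((1 / ?e) *\<^sub>R (x - \<xi>))) * f \<xi>)"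
      proof (rule Bochner_Integration.integrable_bound[where f="\<lambda>\<xi>. (sqrt (2 * pi) ^ DIM('a) / ?e ^ DIM('a)) *\<^sub>R f \<xi>"])
        show "AE \<xi> in lborel. norm (of_real (sqrt (2 * pi) ^ DIM('a) / ?e ^ DIM('a) * gauss ((1 / ?e) *\<^sub>R (x - \<xi>))) * f \<xi>)
            \<le> norm ((sqrt (2 * pi) ^ DIM('a) / ?e ^ DIM('a)) *\<^sub>R f \<xi>)"
          unfolding norm_mult norm_of_real norm_scaleR abs_mult
          by (intro AE_I2 mult_right_mono mult_left_le) (auto simp: gauss_nonneg gauss_le_1)
      qed (use int in auto)
    qed (use e(3)[of n] in auto)
    also have "\<dots> = \<bar>?e\<bar> ^ DIM('a) *\<^sub>R (\<integral>y. (sqrt (2 * pi) ^ DIM('a) / ?e ^ DIM('a)) *\<^sub>R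
        (gauss y *\<^sub>R f (x + ?e *\<^sub>R y)) \<partial>lborel)"
    proof -
      have "(1 / ?e) *\<^sub>R (x - (x + ?e *\<^sub>R y)) = - y" for y using e(3)[of n] by simp
      then show ?thesis by (simp only: gauss_minus scaleR_conv_of_real of_real_mult mult.assoc)
    qed
    also have "\<dots> = sqrt (2 * pi) ^ DIM('a) *\<^sub>R (\<integral>y. gauss y *\<^sub>R f (x + ?e *\<^sub>R y) \<partial>lborel)"
      using e(3)[of n] by (simp only: integral_scaleR_right) simp
    finally show ?thesis .
  qed
  have "?A \<longlonglongrightarrow> sqrt (2 * pi) ^ DIM('a) *\<^sub>R (sqrt (2 * pi) ^ DIM('a) *\<^sub>R f x)"
    unfolding A using cont e growth
    by (intro tendsto_scaleR tendsto_const gauss_mollify_tendsto[where C=C])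
      (auto simp: continuous_on_eq_continuous_at)
  then have "(\<integral>z. iexp (z \<bullet> x) * F z \<partial>lborel) = (sqrt (2 * pi) ^ DIM('a) * sqrt (2 * pi) ^ DIM('a)) *\<^sub>R f x"
    using LIMSEQ_unique[OF lim] by simp
  also have "sqrt (2 * pi) ^ DIM('a) * sqrt (2 * pi) ^ DIM('a) = (2 * pi) ^ DIM('a)"
    unfolding power_mult_distrib[symmetric] by simp
  finally show ?thesis by (simp only: scaleR_conv_of_real)
qed

section \<open>Kernels given by a Fourier integral\<close>

lemma one_plus_sq_gauss_le: "(1 + (norm x)\<^sup>2) * gauss x \<le> 4 * exp (- (1/4) * (norm x)\<^sup>2)"
proof -
  let ?s = "norm x"
  have "1 + ?s\<^sup>2 \<le> 4 * (1 + ?s\<^sup>2 / 4)" by simp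
  also have "\<dots> \<le> 4 * exp (?s\<^sup>2 / 4)" by (intro mult_left_mono exp_ge_add_one_self) simp
  finally have "(1 + ?s\<^sup>2) * gauss x \<le> 4 * exp (?s\<^sup>2 / 4) * gauss x"
    by (rule mult_right_mono) (rule gauss_nonneg)
  also have "\<dots> = 4 * exp (- (1/4) * ?s\<^sup>2)"
    by (simp add: gauss_def exp_add[symmetric] mult.assoc)
  finally show ?thesis .
qed

lemma norm_le_one_plus_sq: "norm x \<le> 1 + (norm x)\<^sup>2"
proof -
  have "2 * norm x \<le> 1 + (norm x)\<^sup>2"
    using zero_le_power2[of "norm x - 1"] by (simp add: power2_eq_square algebra_simps)
  with norm_ge_zero[of x] show ?thesis by linarith
qed

text \<open>Used for two kinds of kernel: that of the problem, with \<kappa> =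
  \<open>fourier_density K\<close>, and the narrow Gaussians of the mollification. The second moment
  of \<kappa> makes \<open>K\<close> differentiable with Lipschitz gradient.\<close>

locale fourier_kernel =
  fixes \<kappa> :: "'a::euclidean_space \<Rightarrow> complex" and K :: "'a \<Rightarrow> real"
  assumes int: "integrable lborel (\<lambda>\<zeta>. (1 + (norm \<zeta>)\<^sup>2) *\<^sub>R \<kappa> \<zeta>)"
    and rep: "of_real (K z) = (\<integral>\<zeta>. iexp (z \<bullet> \<zeta>) * \<kappa> \<zeta> \<partial>lborel)"
begin

lemma measurable_\<kappa> [measurable]: "\<kappa> \<in> borel_measurable borel"
proof -
  have "(\<lambda>\<zeta>. (1 / (1 + (norm \<zeta>)\<^sup>2)) *\<^sub>R ((1 + (norm \<zeta>)\<^sup>2) *\<^sub>R \<kappa> \<zeta>)) \<in> borel_measurable lborel"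
    by (intro borel_measurable_scaleR borel_measurable_integrable[OF int]) measurable
  also have "(\<lambda>\<zeta>. (1 / (1 + (norm \<zeta>)\<^sup>2)) *\<^sub>R ((1 + (norm \<zeta>)\<^sup>2) *\<^sub>R \<kappa> \<zeta>)) = \<kappa>"
    by (auto simp: add_nonneg_eq_0_iff)
  finally show ?thesis by simp
qed

lemma int_norm: "integrable lborel (\<lambda>\<zeta>. (1 + (norm \<zeta>)\<^sup>2) * norm (\<kappa> \<zeta>))"
  using integrable_norm[OF int] by simp

lemma integrable_by_\<kappa>:
  fixes f :: "'a \<Rightarrow> 'b::{banach, second_countable_topology}"
  assumes f: "f \<in> borel_measurable borel" and le: "\<And>\<zeta>. norm (f \<zeta>) \<le> c * ((1 + (norm \<zeta>)\<^sup>2) * norm (\<kappa> \<zeta>))"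
  shows "integrable lborel f"
  using f by (intro Bochner_Integration.integrable_bound[OF integrable_mult_right[OF int_norm, of c]])
    (auto intro!: AE_I2 order_trans[OF le abs_ge_self])

text \<open>One constant for all estimates: 1, |\<zeta>| and |\<zeta>|^2 are each at most 1 +
  |\<zeta>|^2, so it bounds \<open>K\<close>, its gradient, and the Lipschitz constants of
  both.\<close>

definition C :: real where "C = (\<integral>\<zeta>. (1 + (norm \<zeta>)\<^sup>2) * norm (\<kappa> \<zeta>) \<partial>lborel)"

lemma C_nonneg: "C \<ge> 0"
  unfolding C_def by (intro Bochner_Integration.integral_nonneg) simp

lemma norm_integral_by_\<kappa>:
  fixes f :: "'a \<Rightarrow> 'b::{banach, second_countable_topology}"
  assumes f: "f \<in> borel_measurable borel" and le: "\<And>\<zeta>. norm (f \<zeta>) \<le> c * ((1 + (norm \<zeta>)\<^sup>2) * norm (\<kappa> \<zeta>))"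
  shows "norm (\<integral>\<zeta>. f \<zeta> \<partial>lborel) \<le> c * C"
proof -
  have "norm (\<integral>\<zeta>. f \<zeta> \<partial>lborel) \<le> (\<integral>\<zeta>. norm (f \<zeta>) \<partial>lborel)" by (rule integral_norm_bound)
  also have "\<dots> \<le> (\<integral>\<zeta>. c * ((1 + (norm \<zeta>)\<^sup>2) * norm (\<kappa> \<zeta>)) \<partial>lborel)"
    by (intro integral_mono integrable_norm integrable_by_\<kappa>[OF f le] integrable_mult_right int_norm le)
  finally show ?thesis by (simp add: C_def)
qed

lemma integrable_\<kappa>_iexp: "integrable lborel (\<lambda>\<zeta>. iexp (z \<bullet> \<zeta>) * \<kappa> \<zeta>)"
  by (rule integrable_by_\<kappa>[where c=1]) (auto simp: norm_mult mult_le_cancel_right1)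

text \<open>The derivative of \<open>K\<close> in direction \<open>h\<close>, by formal
  differentiation under the integral. It is complex by construction; that it is real follows only
  after the Taylor estimate.\<close>

definition dK :: "'a \<Rightarrow> 'a \<Rightarrow> complex" where
  "dK z h = (\<integral>\<zeta>. iexp (z \<bullet> \<zeta>) * (\<i> * of_real (h \<bullet> \<zeta>)) * \<kappa> \<zeta> \<partial>lborel)"

lemma inner_mult_\<kappa>_le: "\<bar>h \<bullet> \<zeta>\<bar> * norm (\<kappa> \<zeta>) \<le> norm h * ((1 + (norm \<zeta>)\<^sup>2) * norm (\<kappa> \<zeta>))"
proof -
  have "\<bar>h \<bullet> \<zeta>\<bar> \<le> norm h * (1 + (norm \<zeta>)\<^sup>2)"
    using Cauchy_Schwarz_ineq2 mult_left_mono[OF norm_le_one_plus_sq norm_ge_zero] by (rule order_trans)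
  from mult_right_mono[OF this norm_ge_zero] show ?thesis by (simp add: mult.assoc)
qed

lemma integrable_dK: "integrable lborel (\<lambda>\<zeta>. iexp (z \<bullet> \<zeta>) * (\<i> * of_real (h \<bullet> \<zeta>)) * \<kappa> \<zeta>)"
  by (rule integrable_by_\<kappa>[where c="norm h"]) (auto simp: norm_mult inner_mult_\<kappa>_le)

lemma norm_dK_le: "norm (dK z h) \<le> norm h * C"
  unfolding dK_def by (rule norm_integral_by_\<kappa>) (auto simp: norm_mult inner_mult_\<kappa>_le)

lemma dK_scale: "dK z (s *\<^sub>R h) = of_real s * dK z h"
  unfolding dK_def integral_mult_right_zero[symmetric]
  by (intro Bochner_Integration.integral_cong) auto

lemma dK_add: "dK z (h + h') = dK z h + dK z h'"
  unfolding dK_def Bochner_Integration.integral_add[OF integrable_dK integrable_dK, symmetric]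
  by (intro Bochner_Integration.integral_cong refl) (simp add: inner_add_left algebra_simps)

lemma dK_sum: "dK z (\<Sum>b\<in>S. f b) = (\<Sum>b\<in>S. dK z (f b))"
  using dK_scale[of z 0 0] by (induction S rule: infinite_finite_induct) (auto simp: dK_add)

text \<open>The remainder of exp (i s) after its linear term is at most s^2/2; with s the inner
  product of h and \<zeta> this is paid for by the second moment of \<kappa>.\<close>

lemma taylor_dK: "norm (of_real (K (z + h)) - of_real (K z) - dK z h) \<le> (norm h)\<^sup>2 * C"
proof -
  have "of_real (K (z + h)) - of_real (K z) - dK z h =
      (\<integral>\<zeta>. iexp ((z + h) \<bullet> \<zeta>) * \<kappa> \<zeta> - iexp (z \<bullet> \<zeta>) * \<kappa> \<zeta> - iexp (z \<bullet> \<zeta>) * (\<i> * of_real (h \<bullet> \<zeta>)) * \<kappa> \<zeta> \<partial>lborel)"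
    unfolding rep dK_def
    by (simp only: Bochner_Integration.integral_diff Bochner_Integration.integrable_diff integrable_\<kappa>_iexp integrable_dK)
  also have "norm \<dots> \<le> (norm h)\<^sup>2 * C"
  proof (rule norm_integral_by_\<kappa>)
    fix \<zeta>
    have "iexp ((z + h) \<bullet> \<zeta>) * \<kappa> \<zeta> - iexp (z \<bullet> \<zeta>) * \<kappa> \<zeta> - iexp (z \<bullet> \<zeta>) * (\<i> * of_real (h \<bullet> \<zeta>)) * \<kappa> \<zeta>
        = iexp (z \<bullet> \<zeta>) * (iexp (h \<bullet> \<zeta>) - (\<Sum>k \<le> 1. (\<i> * of_real (h \<bullet> \<zeta>)) ^ k / fact k)) * \<kappa> \<zeta>"
      unfolding inner_add_left iexp_add by (simp add: algebra_simps)
    also have "norm \<dots> = norm (iexp (h \<bullet> \<zeta>) - (\<Sum>k \<le> 1. (\<i> * of_real (h \<bullet> \<zeta>)) ^ k / fact k)) * norm (\<kappa> \<zeta>)"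
      by (simp add: norm_mult)
    also have "\<dots> \<le> (\<bar>h \<bullet> \<zeta>\<bar> ^ Suc 1 / fact (Suc 1)) * norm (\<kappa> \<zeta>)"
      by (intro mult_right_mono iexp_approx1) simp
    also have "\<dots> \<le> ((norm h)\<^sup>2 * (1 + (norm \<zeta>)\<^sup>2)) * norm (\<kappa> \<zeta>)"
    proof (rule mult_right_mono)
      have "\<bar>h \<bullet> \<zeta>\<bar>\<^sup>2 \<le> (norm h * norm \<zeta>)\<^sup>2" by (intro power_mono Cauchy_Schwarz_ineq2) simp
      also have "\<dots> \<le> (norm h)\<^sup>2 * (1 + (norm \<zeta>)\<^sup>2)" by (simp add: power_mult_distrib distrib_left)
      finally show "\<bar>h \<bullet> \<zeta>\<bar> ^ Suc 1 / fact (Suc 1) \<le> (norm h)\<^sup>2 * (1 + (norm \<zeta>)\<^sup>2)"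
        using zero_le_power2[of "\<bar>h \<bullet> \<zeta>\<bar>"] by (simp only: Suc_1 fact_2)
    qed simp
    finally show "norm (iexp ((z + h) \<bullet> \<zeta>) * \<kappa> \<zeta> - iexp (z \<bullet> \<zeta>) * \<kappa> \<zeta> - iexp (z \<bullet> \<zeta>) * (\<i> * of_real (h \<bullet> \<zeta>)) * \<kappa> \<zeta>)
       \<le> (norm h)\<^sup>2 * ((1 + (norm \<zeta>)\<^sup>2) * norm (\<kappa> \<zeta>))"
      by (simp only: mult.assoc)
  qed measurable
  finally show ?thesis .
qed

text \<open>\<open>K\<close> is real, so the imaginary part of \<open>dK\<close> along a step is
  pure Taylor error. It is linear in the step length while the error is quadratic, which forces it
  to be 0.\<close>

lemma Im_dK: "Im (dK z h) = 0"
proof (rule ccontr)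
  assume ne: "Im (dK z h) \<noteq> 0"
  define D where "D = (norm h)\<^sup>2 * C + 1"
  \<comment> \<open>The step for which \<open>s * D\<close> is half of the imaginary part; the extra
    1 in \<open>D\<close> makes \<open>D\<close> positive.\<close>
  define s where "s = \<bar>Im (dK z h)\<bar> / (2 * D)"
  have pos: "D > 0" using C_nonneg by (simp add: D_def add_nonneg_pos)
  have s: "s > 0" using ne pos by (simp add: s_def)
  have "s * \<bar>Im (dK z h)\<bar> = \<bar>Im (of_real (K (z + s *\<^sub>R h)) - of_real (K z) - dK z (s *\<^sub>R h))\<bar>"
    using s by (simp add: dK_scale abs_mult)
  also have "\<dots> \<le> s\<^sup>2 * ((norm h)\<^sup>2 * C)"
    using order_trans[OF abs_Im_le_cmod taylor_dK, of z "s *\<^sub>R h"] by (simp only: norm_scaleR power_mult_distrib power2_abs mult.assoc)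
  finally have "\<bar>Im (dK z h)\<bar> \<le> s * ((norm h)\<^sup>2 * C)"
    using s by (simp add: power2_eq_square)
  also have "\<dots> \<le> s * D" using s by (simp add: D_def)
  also have "\<dots> = \<bar>Im (dK z h)\<bar> / 2" using pos by (simp add: s_def)
  finally show False using ne by simp
qed

definition DK :: "'a \<Rightarrow> 'a" where
  "DK z = (\<Sum>b\<in>Basis. Re (dK z b) *\<^sub>R b)"

lemma dK_eq: "dK z h = of_real (DK z \<bullet> h)"
proof -
  have "dK z h = dK z (\<Sum>b\<in>Basis. (h \<bullet> b) *\<^sub>R b)" by (simp add: euclidean_representation)
  also have "\<dots> = (\<Sum>b\<in>Basis. of_real (h \<bullet> b) * dK z b)"
    by (simp add: dK_sum dK_scale)
  also have "\<dots> = (\<Sum>b\<in>Basis. of_real (h \<bullet> b * Re (dK z b)))"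
    by (intro sum.cong refl) (simp add: complex_eq_iff Im_dK)
  also have "\<dots> = of_real (DK z \<bullet> h)"
    unfolding DK_def inner_sum_left inner_scaleR_left of_real_sum
    by (intro sum.cong refl) (simp add: inner_commute mult.commute)
  finally show ?thesis .
qed

lemma taylor: "\<bar>K (z + h) - K z - DK z \<bullet> h\<bar> \<le> (norm h)\<^sup>2 * C"
  using taylor_dK[of z h] unfolding dK_eq of_real_diff[symmetric] norm_of_real .

lemma inner_DK_le: "\<bar>DK z \<bullet> h\<bar> \<le> norm h * C"
  using norm_dK_le[of z h] unfolding dK_eq norm_of_real .

lemma norm_iexp_diff_le: "norm (iexp (z \<bullet> \<zeta>) - iexp (w \<bullet> \<zeta>)) \<le> norm (z - w) * norm \<zeta>"
proof -
  have "iexp (z \<bullet> \<zeta>) - iexp (w \<bullet> \<zeta>) = iexp (w \<bullet> \<zeta>) * (iexp ((z - w) \<bullet> \<zeta>) - 1)"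
    unfolding right_diff_distrib iexp_add[symmetric] by (simp add: inner_diff_left)
  then have "norm (iexp (z \<bullet> \<zeta>) - iexp (w \<bullet> \<zeta>)) \<le> \<bar>(z - w) \<bullet> \<zeta>\<bar>"
    using norm_iexp_minus_1_le by (simp add: norm_mult)
  then show ?thesis using Cauchy_Schwarz_ineq2 by (rule order_trans)
qed

lemma inner_DK_diff_le: "\<bar>(DK z - DK w) \<bullet> h\<bar> \<le> norm (z - w) * norm h * C"
proof -
  have "of_real ((DK z - DK w) \<bullet> h) = dK z h - dK w h"
    unfolding dK_eq by (simp add: inner_diff_left)
  also have "\<dots> = (\<integral>\<zeta>. iexp (z \<bullet> \<zeta>) * (\<i> * of_real (h \<bullet> \<zeta>)) * \<kappa> \<zeta> -
      iexp (w \<bullet> \<zeta>) * (\<i> * of_real (h \<bullet> \<zeta>)) * \<kappa> \<zeta> \<partial>lborel)"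
    unfolding dK_def by (simp only: Bochner_Integration.integral_diff integrable_dK)
  also have "norm \<dots> \<le> (norm (z - w) * norm h) * C"
  proof (rule norm_integral_by_\<kappa>)
    fix \<zeta>
    have "norm (iexp (z \<bullet> \<zeta>) * (\<i> * of_real (h \<bullet> \<zeta>)) * \<kappa> \<zeta> - iexp (w \<bullet> \<zeta>) * (\<i> * of_real (h \<bullet> \<zeta>)) * \<kappa> \<zeta>)
      = norm (iexp (z \<bullet> \<zeta>) - iexp (w \<bullet> \<zeta>)) * \<bar>h \<bullet> \<zeta>\<bar> * norm (\<kappa> \<zeta>)"
      unfolding left_diff_distrib[symmetric] by (simp add: norm_mult)
    also have "\<dots> \<le> (norm (z - w) * norm \<zeta>) * (norm h * norm \<zeta>) * norm (\<kappa> \<zeta>)"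
      by (intro mult_right_mono mult_mono norm_iexp_diff_le Cauchy_Schwarz_ineq2) auto
    also have "\<dots> = (norm (z - w) * norm h) * ((norm \<zeta>)\<^sup>2 * norm (\<kappa> \<zeta>))"
      by (simp add: power2_eq_square)
    also have "\<dots> \<le> (norm (z - w) * norm h) * ((1 + (norm \<zeta>)\<^sup>2) * norm (\<kappa> \<zeta>))"
      by (intro mult_left_mono mult_right_mono) auto
    finally show "norm (iexp (z \<bullet> \<zeta>) * (\<i> * of_real (h \<bullet> \<zeta>)) * \<kappa> \<zeta> - iexp (w \<bullet> \<zeta>) * (\<i> * of_real (h \<bullet> \<zeta>)) * \<kappa> \<zeta>)
      \<le> (norm (z - w) * norm h) * ((1 + (norm \<zeta>)\<^sup>2) * norm (\<kappa> \<zeta>))" .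
  qed measurable
  finally show ?thesis by simp
qed

lemma norm_le_of_inner_le: "(\<And>h. \<bar>v \<bullet> h\<bar> \<le> B * norm h) \<Longrightarrow> norm v \<le> B" for v :: 'a
proof -
  assume "\<And>h. \<bar>v \<bullet> h\<bar> \<le> B * norm h"
  from this[of v] have "norm v * norm v \<le> B * norm v"
    by (simp add: dot_square_norm power2_eq_square)
  \<comment> \<open>For \<open>v = 0\<close>, testing with \<open>v\<close> says nothing about the
    sign of \<open>B\<close>; a basis vector supplies it.\<close>
  moreover from this \<open>\<And>h. \<bar>v \<bullet> h\<bar> \<le> B * norm h\<close>[of "SOME b. b \<in> Basis"] have "norm v = 0 \<Longrightarrow> 0 \<le> B"
    by (simp add: SOME_Basis)
  ultimately show ?thesis by (cases "norm v = 0") auto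
qed

lemma norm_DK_le: "norm (DK z) \<le> C"
  using inner_DK_le by (intro norm_le_of_inner_le) (simp add: mult.commute)

lemma norm_DK_diff_le: "norm (DK z - DK w) \<le> norm (z - w) * C"
  using inner_DK_diff_le by (intro norm_le_of_inner_le) (simp add: mult_ac)

lemma continuous_DK: "continuous_on A DK"
proof (rule continuous_on_subset)
  have "C-lipschitz_on UNIV DK"
    using norm_DK_diff_le C_nonneg by (intro lipschitz_onI) (auto simp: dist_norm mult.commute)
  then show "continuous_on UNIV DK" by (rule lipschitz_on_continuous_on)
qed simp

lemma borel_measurable_DK [measurable]: "DK \<in> borel_measurable borel"
  by (intro borel_measurable_continuous_onI continuous_DK)

lemma abs_K_le: "\<bar>K z\<bar> \<le> C"
proof -
  have "norm (complex_of_real (K z)) \<le> 1 * C"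
    unfolding rep by (rule norm_integral_by_\<kappa>) (auto simp: norm_mult mult_le_cancel_right1)
  then show ?thesis by simp
qed

lemma K_lipschitz: "\<bar>K z - K w\<bar> \<le> norm (z - w) * C"
proof -
  have "of_real (K z - K w) = (\<integral>\<zeta>. iexp (z \<bullet> \<zeta>) * \<kappa> \<zeta> - iexp (w \<bullet> \<zeta>) * \<kappa> \<zeta> \<partial>lborel)"
    by (simp only: of_real_diff rep Bochner_Integration.integral_diff integrable_\<kappa>_iexp)
  also have "norm \<dots> \<le> norm (z - w) * C"
  proof (rule norm_integral_by_\<kappa>)
    fix \<zeta>
    have "norm (iexp (z \<bullet> \<zeta>) * \<kappa> \<zeta> - iexp (w \<bullet> \<zeta>) * \<kappa> \<zeta>) \<le> (norm (z - w) * norm \<zeta>) * norm (\<kappa> \<zeta>)"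
      unfolding left_diff_distrib[symmetric] norm_mult by (intro mult_right_mono norm_iexp_diff_le) auto
    also have "\<dots> \<le> (norm (z - w) * (1 + (norm \<zeta>)\<^sup>2)) * norm (\<kappa> \<zeta>)"
      by (intro mult_left_mono mult_right_mono norm_le_one_plus_sq) auto
    finally show "norm (iexp (z \<bullet> \<zeta>) * \<kappa> \<zeta> - iexp (w \<bullet> \<zeta>) * \<kappa> \<zeta>) \<le> norm (z - w) * ((1 + (norm \<zeta>)\<^sup>2) * norm (\<kappa> \<zeta>))"
      by (simp only: mult.assoc)
  qed measurable
  finally show ?thesis unfolding norm_of_real .
qed

lemma continuous_K: "continuous_on A K"
proof (rule continuous_on_subset)
  have "C-lipschitz_on UNIV K"
    using K_lipschitz C_nonneg by (intro lipschitz_onI) (auto simp: dist_norm mult.commute)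
  then show "continuous_on UNIV K" by (rule lipschitz_on_continuous_on)
qed simp

lemma borel_measurable_K [measurable]: "K \<in> borel_measurable borel"
  by (intro borel_measurable_continuous_onI continuous_K)

lemma has_derivative_K: "(K has_derivative (\<lambda>h. DK z \<bullet> h)) (at z)"
  unfolding has_derivative_at
proof (intro conjI)
  show "bounded_linear (\<lambda>h. DK z \<bullet> h)" by (rule bounded_linear_inner_right)
  have "(\<lambda>h. norm h * C) \<midarrow>0\<rightarrow> 0"
    by (intro tendsto_mult_left_zero tendsto_norm_zero tendsto_ident_at)
  then show "(\<lambda>h. norm (K (z + h) - K z - DK z \<bullet> h) / norm h) \<midarrow>0\<rightarrow> 0"
  proof (rule Lim_null_comparison[rotated])
    show "\<forall>\<^sub>F h in at 0. norm (norm (K (z + h) - K z - DK z \<bullet> h) / norm h) \<le> norm h * C"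
      using taylor by (auto simp: eventually_at_filter divide_le_eq power2_eq_square mult_ac intro!: always_eventually)
  qed
qed

text \<open>Serves to identify \<open>DK\<close> for Gaussians, whose gradient is known in closed
  form.\<close>

lemma DK_unique: "(K has_derivative (\<lambda>h. v \<bullet> h)) (at z) \<Longrightarrow> DK z = v"
  using has_derivative_unique[OF has_derivative_K] by (metis inner_commute vector_eq_ldot)

end

section \<open>The continuity-equation functional and its symbol\<close>

lemma (in finite_measure) integrable_bounded:
  fixes f :: "'a \<Rightarrow> 'b::{banach, second_countable_topology}"
  shows "f \<in> borel_measurable M \<Longrightarrow> (\<And>x. norm (f x) \<le> B) \<Longrightarrow> integrable M f"
  by (rule integrable_const_bound[of _ B]) auto

lemma norm_integral_le:
  fixes f :: "'a \<Rightarrow> 'b::{banach, second_countable_topology}"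
  assumes "f \<in> borel_measurable M" "integrable M g" and le: "\<And>x. norm (f x) \<le> g x"
  shows "norm (\<integral>x. f x \<partial>M) \<le> (\<integral>x. g x \<partial>M)"
proof -
  have "integrable M f"
    by (rule Bochner_Integration.integrable_bound[OF assms(2,1)]) (auto intro!: AE_I2 order_trans[OF le abs_ge_self])
  then have "(\<integral>x. norm (f x) \<partial>M) \<le> (\<integral>x. g x \<partial>M)"
    by (intro integral_mono integrable_norm assms(2) le)
  then show ?thesis using integral_norm_bound by (rule order_trans[rotated])
qed

text \<open>A majorant is asked only on a ball around \<open>a\<close>: the integrand of the symbol
  grows with the frequency, so a single majorant cannot serve all frequencies.\<close>

lemma isCont_integral_dominated:
  fixes f :: "'a::metric_space \<Rightarrow> 'b \<Rightarrow> 'c::{banach, second_countable_topology}"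
  assumes meas: "\<And>x. f x \<in> borel_measurable M"
    and cont: "\<And>y. isCont (\<lambda>x. f x y) x"
    and le: "\<And>x y. dist x a \<le> r \<Longrightarrow> norm (f x y) \<le> w y" and w: "integrable M w"
    and x: "dist x a < r"
  shows "isCont (\<lambda>x. \<integral>y. f x y \<partial>M) x"
  unfolding continuous_at_sequentially comp_def
proof (intro allI impI)
  fix X assume X: "X \<longlonglongrightarrow> x"
  have "\<forall>\<^sub>F n in sequentially. dist (X n) x < r - dist x a"
    using X x by (intro tendstoD) auto
  then obtain N where N: "\<And>n. n \<ge> N \<Longrightarrow> dist (X n) x < r - dist x a"
    unfolding eventually_sequentially by auto
  \<comment> \<open>Shifting by \<open>N\<close> puts every term of the sequence into the ball where
    \<open>w\<close> dominates.\<close>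
  have "(\<lambda>n. \<integral>y. f (X (n + N)) y \<partial>M) \<longlonglongrightarrow> (\<integral>y. f x y \<partial>M)"
  proof (rule integral_dominated_convergence[where w=w])
    show "AE y in M. (\<lambda>n. f (X (n + N)) y) \<longlonglongrightarrow> f x y"
      using cont LIMSEQ_ignore_initial_segment[OF X, of N]
      by (intro AE_I2 isCont_tendsto_compose[of x "\<lambda>x. f x _"])
    show "AE y in M. norm (f (X (n + N)) y) \<le> w y" for n
    proof (intro AE_I2 le)
      show "dist (X (n + N)) a \<le> r"
        using N[of "n + N"] dist_triangle[of "X (n + N)" a x] by simp
    qed
  qed (use meas w in auto)
  then show "(\<lambda>n. \<integral>y. f (X n) y \<partial>M) \<longlonglongrightarrow> (\<integral>y. f x y \<partial>M)"
    by (rule LIMSEQ_offset)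
qed

text \<open>The majorant is of convolution type, not a product in z and w. Integrating in
  \<open>w\<close> first and translating gives the same integral of |\<beta>| for every
  \<open>z\<close>.\<close>

lemma Fubini_convolution:
  fixes f :: "'a::euclidean_space \<Rightarrow> 'a \<Rightarrow> 'c::{banach, second_countable_topology}" and \<alpha> \<beta> :: "'a \<Rightarrow> real"
  assumes M: "sigma_finite_measure M" "sets M = sets borel"
    and f: "case_prod f \<in> borel_measurable (borel \<Otimes>\<^sub>M borel)"
    and \<alpha>: "integrable M \<alpha>" and \<beta>: "integrable lborel \<beta>"
    and le: "\<And>z w. norm (f z w) \<le> \<alpha> z * \<beta> (w - z)"
  shows "(\<integral>z. (\<integral>w. f z w \<partial>lborel) \<partial>M) = (\<integral>w. (\<integral>z. f z w \<partial>M) \<partial>lborel)"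
    and "integrable lborel (\<lambda>w. \<integral>z. f z w \<partial>M)"
proof -
  interpret pair_sigma_finite M lborel
    using M lborel.sigma_finite_measure_axioms by (simp add: pair_sigma_finite_def)
  have sets_eq: "sets (M \<Otimes>\<^sub>M lborel) = sets (borel \<Otimes>\<^sub>M (borel :: 'a measure))"
    by (intro sets_pair_measure_cong) (auto simp: M)
  have \<alpha>m: "\<alpha> \<in> borel_measurable borel"
    using borel_measurable_integrable[OF \<alpha>] by (simp cong: measurable_cong_sets add: M)
  have [measurable]: "\<beta> \<in> borel_measurable borel" using \<beta> by auto
  note [measurable] = \<alpha>m
  have \<beta>': "integrable lborel (\<lambda>w. \<beta> (w - z))" "(\<integral>w. \<bar>\<beta> (w - z)\<bar> \<partial>lborel) = (\<integral>w. \<bar>\<beta> w\<bar> \<partial>lborel)" for z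
    using integrable_lborel_affine[OF _ \<beta>, of 1 "- z"] integral_lborel_affine[OF _ integrable_abs[OF \<beta>], of 1 "- z"]
    by auto
  have "integrable (M \<Otimes>\<^sub>M lborel) (\<lambda>(z, w). \<alpha> z * \<beta> (w - z))"
  proof (rule Fubini_integrable)
    have "(\<lambda>(z, w). \<alpha> z * \<beta> (w - z)) \<in> borel_measurable (borel \<Otimes>\<^sub>M borel)" by measurable
    then show "(\<lambda>(z, w). \<alpha> z * \<beta> (w - z)) \<in> borel_measurable (M \<Otimes>\<^sub>M lborel)"
      by (simp add: measurable_cong_sets[OF sets_eq refl])
    show "integrable M (\<lambda>z. \<integral>w. norm (case (z, w) of (z, w) \<Rightarrow> \<alpha> z * \<beta> (w - z)) \<partial>lborel)"
      using \<alpha> by (simp add: abs_mult \<beta>')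
    show "AE z in M. integrable lborel (\<lambda>w. case (z, w) of (z, w) \<Rightarrow> \<alpha> z * \<beta> (w - z))"
      using \<beta>' by simp
  qed
  then have *: "integrable (M \<Otimes>\<^sub>M lborel) (case_prod f)"
    by (rule Bochner_Integration.integrable_bound)
      (use f le in \<open>auto intro!: AE_I2 order_trans[OF _ abs_ge_self] simp: measurable_cong_sets[OF sets_eq refl]\<close>)
  show "(\<integral>z. (\<integral>w. f z w \<partial>lborel) \<partial>M) = (\<integral>w. (\<integral>z. f z w \<partial>M) \<partial>lborel)"
    using Fubini_integral[OF *] by simp
  show "integrable lborel (\<lambda>w. \<integral>z. f z w \<partial>M)"
    using integrable_snd[OF *] by auto
qed

text \<open>The functional \<open>\<phi> \<mapsto> \<integral> a \<sqdot> \<nabla>\<phi> + \<integral> \<phi> d\<sigma>\<^sub>0 - \<integral> \<phi> d\<sigma>\<^sub>1\<close>, whose vanishing on all \<open>\<phi>\<close> is the continuity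
  equation between the states \<open>\<sigma>\<^sub>0\<close> and \<open>\<sigma>\<^sub>1\<close>; the gradient \<open>D\<close> of \<open>\<phi>\<close> is passed separately.\<close>

locale flux =
  fixes a :: "'a::euclidean_space \<Rightarrow> 'a" and \<sigma>\<^sub>0 \<sigma>\<^sub>1 :: "'a measure"
  assumes int_a: "integrable lborel a"
    and fin\<^sub>0: "finite_measure \<sigma>\<^sub>0" and fin\<^sub>1: "finite_measure \<sigma>\<^sub>1"
    and sets\<^sub>0 [measurable_cong, simp]: "sets \<sigma>\<^sub>0 = sets borel"
    and sets\<^sub>1 [measurable_cong, simp]: "sets \<sigma>\<^sub>1 = sets borel"
begin

sublocale fin\<^sub>0: finite_measure \<sigma>\<^sub>0 by (rule fin\<^sub>0)
sublocale fin\<^sub>1: finite_measure \<sigma>\<^sub>1 by (rule fin\<^sub>1)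

lemma measurable_a [measurable]: "a \<in> borel_measurable borel"
  using int_a by auto

definition functional :: "('a \<Rightarrow> real) \<Rightarrow> ('a \<Rightarrow> 'a) \<Rightarrow> real" where
  "functional \<phi> D = (\<integral>z. a z \<bullet> D z \<partial>lborel) + (\<integral>z. \<phi> z \<partial>\<sigma>\<^sub>0) - (\<integral>z. \<phi> z \<partial>\<sigma>\<^sub>1)"

text \<open>The functional applied to the exponential \<open>z \<mapsto> exp (- i z \<sqdot> \<zeta>)\<close>.\<close>

definition symbol :: "'a \<Rightarrow> complex" where
  "symbol \<zeta> = (\<integral>z. - (\<i> * of_real (a z \<bullet> \<zeta>) * iexp (- (z \<bullet> \<zeta>))) \<partial>lborel)
      + (\<integral>z. iexp (- (z \<bullet> \<zeta>)) \<partial>\<sigma>\<^sub>0) - (\<integral>z. iexp (- (z \<bullet> \<zeta>)) \<partial>\<sigma>\<^sub>1)"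

text \<open>Total mass of the three ingredients. It is both the bound of the functional for the C^1
  norm and the growth constant of the symbol.\<close>

definition mass :: real where
  "mass = (\<integral>z. norm (a z) \<partial>lborel) + measure \<sigma>\<^sub>0 UNIV + measure \<sigma>\<^sub>1 UNIV"

lemma mass_nonneg: "mass \<ge> 0"
  unfolding mass_def by (intro add_nonneg_nonneg Bochner_Integration.integral_nonneg) auto

lemma space\<^sub>0 [simp]: "space \<sigma>\<^sub>0 = UNIV" and space\<^sub>1 [simp]: "space \<sigma>\<^sub>1 = UNIV"
  using sets_eq_imp_space_eq[OF sets\<^sub>0] sets_eq_imp_space_eq[OF sets\<^sub>1] by auto

lemma
  assumes [measurable]: "D \<in> borel_measurable borel" and D: "\<And>z. norm (D z) \<le> B"
  shows integrable_inner: "integrable lborel (\<lambda>z. a z \<bullet> D z)"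
    and integral_inner_le: "\<bar>\<integral>z. a z \<bullet> D z \<partial>lborel\<bar> \<le> (\<integral>z. norm (a z) \<partial>lborel) * B"
proof -
  have le: "\<bar>a z \<bullet> D z\<bar> \<le> norm (a z) * B" for z
    using Cauchy_Schwarz_ineq2 mult_left_mono[OF D norm_ge_zero] by (rule order_trans)
  have B: "integrable lborel (\<lambda>z. norm (a z) * B)" using int_a by simp
  then show i: "integrable lborel (\<lambda>z. a z \<bullet> D z)"
    by (rule Bochner_Integration.integrable_bound) (auto intro!: AE_I2 order_trans[OF le abs_ge_self])
  have "\<bar>\<integral>z. a z \<bullet> D z \<partial>lborel\<bar> \<le> (\<integral>z. \<bar>a z \<bullet> D z\<bar> \<partial>lborel)" by (rule integral_abs_bound)
  also have "\<dots> \<le> (\<integral>z. norm (a z) * B \<partial>lborel)" by (intro integral_mono integrable_abs i B le)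
  finally show "\<bar>\<integral>z. a z \<bullet> D z \<partial>lborel\<bar> \<le> (\<integral>z. norm (a z) \<partial>lborel) * B" by simp
qed

lemma abs_functional_le:
  assumes [measurable]: "\<phi> \<in> borel_measurable borel" "D \<in> borel_measurable borel"
    and \<phi>: "\<And>z. \<bar>\<phi> z\<bar> \<le> B" and D: "\<And>z. norm (D z) \<le> B"
  shows "\<bar>functional \<phi> D\<bar> \<le> mass * B"
proof -
  have B: "B \<ge> 0" using order_trans[OF abs_ge_zero \<phi>] .
  have "\<bar>\<integral>z. \<phi> z \<partial>\<sigma>\<^sub>0\<bar> \<le> (\<integral>z. \<bar>\<phi> z\<bar> \<partial>\<sigma>\<^sub>0)" by (rule integral_abs_bound)
  also have "\<dots> \<le> (\<integral>z. B \<partial>\<sigma>\<^sub>0)" using \<phi> B by (intro integral_mono fin\<^sub>0.integrable_bounded[of _ B]) auto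
  finally have 0: "\<bar>\<integral>z. \<phi> z \<partial>\<sigma>\<^sub>0\<bar> \<le> measure \<sigma>\<^sub>0 UNIV * B" by simp
  have "\<bar>\<integral>z. \<phi> z \<partial>\<sigma>\<^sub>1\<bar> \<le> (\<integral>z. \<bar>\<phi> z\<bar> \<partial>\<sigma>\<^sub>1)" by (rule integral_abs_bound)
  also have "\<dots> \<le> (\<integral>z. B \<partial>\<sigma>\<^sub>1)" using \<phi> B by (intro integral_mono fin\<^sub>1.integrable_bounded[of _ B]) auto
  finally have 1: "\<bar>\<integral>z. \<phi> z \<partial>\<sigma>\<^sub>1\<bar> \<le> measure \<sigma>\<^sub>1 UNIV * B" by simp
  show ?thesis
    using 0 1 integral_inner_le[OF assms(2) D] unfolding functional_def mass_def distrib_right by linarith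
qed

lemma symbol_integrand_le:
  "norm (- (\<i> * of_real (a z \<bullet> \<zeta>) * iexp (- (z \<bullet> \<zeta>)))) \<le> norm (a z) * norm \<zeta>"
  using Cauchy_Schwarz_ineq2[of "a z" \<zeta>] by (simp add: norm_mult)

lemma continuous_symbol: "continuous_on UNIV symbol"
  unfolding continuous_on_eq_continuous_at[OF open_UNIV] symbol_def[abs_def]
proof (intro ballI isCont_add isCont_diff)
  fix \<zeta> :: 'a
  show "isCont (\<lambda>\<zeta>. \<integral>z. - (\<i> * of_real (a z \<bullet> \<zeta>) * iexp (- (z \<bullet> \<zeta>))) \<partial>lborel) \<zeta>"
  proof (rule isCont_integral_dominated[where a=0 and r="norm \<zeta> + 1" and w="\<lambda>z. norm (a z) * (norm \<zeta> + 1)"])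
    fix \<zeta>' z :: 'a assume "dist \<zeta>' 0 \<le> norm \<zeta> + 1"
    then have "norm (a z) * norm \<zeta>' \<le> norm (a z) * (norm \<zeta> + 1)" by (intro mult_left_mono) auto
    then show "norm (- (\<i> * of_real (a z \<bullet> \<zeta>') * iexp (- (z \<bullet> \<zeta>')))) \<le> norm (a z) * (norm \<zeta> + 1)"
      using symbol_integrand_le by (rule order_trans[rotated])
  qed (use int_a in \<open>auto intro!: continuous_intros\<close>)
  show "isCont (\<lambda>\<zeta>. \<integral>z. iexp (- (z \<bullet> \<zeta>)) \<partial>\<sigma>\<^sub>0) \<zeta>"
    by (rule isCont_integral_dominated[where a=\<zeta> and r=1 and w="\<lambda>z. 1"]) (auto intro!: continuous_intros)
  show "isCont (\<lambda>\<zeta>. \<integral>z. iexp (- (z \<bullet> \<zeta>)) \<partial>\<sigma>\<^sub>1) \<zeta>"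
    by (rule isCont_integral_dominated[where a=\<zeta> and r=1 and w="\<lambda>z. 1"]) (auto intro!: continuous_intros)
qed

lemma borel_measurable_symbol [measurable]: "symbol \<in> borel_measurable borel"
  by (intro borel_measurable_continuous_onI continuous_symbol)

lemma norm_symbol_le: "norm (symbol \<zeta>) \<le> mass * (1 + norm \<zeta>)"
proof -
  have "norm (\<integral>z. - (\<i> * of_real (a z \<bullet> \<zeta>) * iexp (- (z \<bullet> \<zeta>))) \<partial>lborel) \<le> (\<integral>z. norm (a z) * norm \<zeta> \<partial>lborel)"
    using int_a by (intro norm_integral_le symbol_integrand_le) auto
  also have "\<dots> \<le> (\<integral>z. norm (a z) \<partial>lborel) * (1 + norm \<zeta>)"
    by (simp add: mult_left_mono)
  finally have 1: "norm (\<integral>z. - (\<i> * of_real (a z \<bullet> \<zeta>) * iexp (- (z \<bullet> \<zeta>))) \<partial>lborel) \<le> \<dots>" .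
  have "norm (\<integral>z. iexp (- (z \<bullet> \<zeta>)) \<partial>\<sigma>\<^sub>0) \<le> (\<integral>z. 1 \<partial>\<sigma>\<^sub>0)"
    by (rule norm_integral_le) auto
  also have "\<dots> \<le> measure \<sigma>\<^sub>0 UNIV * (1 + norm \<zeta>)" by (simp add: distrib_left)
  finally have 2: "norm (\<integral>z. iexp (- (z \<bullet> \<zeta>)) \<partial>\<sigma>\<^sub>0) \<le> measure \<sigma>\<^sub>0 UNIV * (1 + norm \<zeta>)" .
  have "norm (\<integral>z. iexp (- (z \<bullet> \<zeta>)) \<partial>\<sigma>\<^sub>1) \<le> (\<integral>z. 1 \<partial>\<sigma>\<^sub>1)"
    by (rule norm_integral_le) auto
  also have "\<dots> \<le> measure \<sigma>\<^sub>1 UNIV * (1 + norm \<zeta>)" by (simp add: distrib_left)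
  finally have 3: "norm (\<integral>z. iexp (- (z \<bullet> \<zeta>)) \<partial>\<sigma>\<^sub>1) \<le> measure \<sigma>\<^sub>1 UNIV * (1 + norm \<zeta>)" .
  show ?thesis unfolding symbol_def mass_def distrib_right[of _ _ "1 + norm \<zeta>"]
    using 1 2 3 norm_triangle_ineq4 norm_triangle_ineq
    by (smt (verit, best))
qed

end

locale flux_kernel = flux a \<sigma>\<^sub>0 \<sigma>\<^sub>1 + fourier_kernel \<kappa> K
  for a :: "'a::euclidean_space \<Rightarrow> 'a" and \<sigma>\<^sub>0 \<sigma>\<^sub>1 and \<kappa> :: "'a \<Rightarrow> complex" and K
begin

lemma integrable_\<kappa>_symbol: "integrable lborel (\<lambda>\<zeta>. \<kappa> \<zeta> * symbol \<zeta>)"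
proof (rule integrable_by_\<kappa>[where c="2 * mass"])
  fix \<zeta> :: 'a
  have "1 + norm \<zeta> \<le> 2 * (1 + (norm \<zeta>)\<^sup>2)"
    using add_left_mono[OF norm_le_one_plus_sq[of \<zeta>], of 1] by (rule order_trans) simp
  then have "norm (symbol \<zeta>) \<le> mass * (2 * (1 + (norm \<zeta>)\<^sup>2))"
    using norm_symbol_le[of \<zeta>] mult_left_mono[OF _ mass_nonneg] order_trans by blast
  from mult_right_mono[OF this norm_ge_zero[of "\<kappa> \<zeta>"]]
  show "norm (\<kappa> \<zeta> * symbol \<zeta>) \<le> 2 * mass * ((1 + (norm \<zeta>)\<^sup>2) * norm (\<kappa> \<zeta>))"
    by (simp only: norm_mult mult_ac)
qed measurable

text \<open>K (w - z) is a superposition of the products exp (i w . \<zeta>) exp (- i z . \<zeta>)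
  with weight \<kappa>. Exchanging the integrals lets the functional act on the second factor, which
  produces the symbol.\<close>

lemma functional_kernel_eq:
  "of_real (functional (\<lambda>z. K (w - z)) (\<lambda>z. - DK (w - z))) = (\<integral>\<zeta>. iexp (w \<bullet> \<zeta>) * (\<kappa> \<zeta> * symbol \<zeta>) \<partial>lborel)"
proof -
  have 1: "of_real (\<integral>z. a z \<bullet> - DK (w - z) \<partial>lborel) =
      (\<integral>\<zeta>. (\<integral>z. iexp (w \<bullet> \<zeta>) * \<kappa> \<zeta> * - (\<i> * of_real (a z \<bullet> \<zeta>) * iexp (- (z \<bullet> \<zeta>))) \<partial>lborel) \<partial>lborel)"
    (is "_ = (\<integral>\<zeta>. (\<integral>z. ?f z \<zeta> \<partial>lborel) \<partial>lborel)")
    and i1: "integrable lborel (\<lambda>\<zeta>. \<integral>z. iexp (w \<bullet> \<zeta>) * \<kappa> \<zeta> * - (\<i> * of_real (a z \<bullet> \<zeta>) * iexp (- (z \<bullet> \<zeta>))) \<partial>lborel)"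
  proof -
    note F = Fubini_dominated[where f="?f" and M=lborel and N=lborel and \<alpha>="\<lambda>z. norm (a z)" and \<beta>="\<lambda>\<zeta>. (1 + (norm \<zeta>)\<^sup>2) * norm (\<kappa> \<zeta>)",
        OF lborel.sigma_finite_measure_axioms lborel.sigma_finite_measure_axioms _ integrable_norm[OF int_a] int_norm]
    have le: "norm (?f z \<zeta>) \<le> norm (a z) * ((1 + (norm \<zeta>)\<^sup>2) * norm (\<kappa> \<zeta>))" for z \<zeta>
      using inner_mult_\<kappa>_le[of "a z" \<zeta>] by (simp add: norm_mult mult.commute)
    have *: "of_real (a z \<bullet> - DK (w - z)) = (\<integral>\<zeta>. ?f z \<zeta> \<partial>lborel)" for z
    proof -
      have "of_real (a z \<bullet> - DK (w - z)) = dK (w - z) (- a z)"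
        unfolding dK_eq by (simp add: inner_commute)
      also have "\<dots> = (\<integral>\<zeta>. ?f z \<zeta> \<partial>lborel)"
        unfolding dK_def inner_diff_left iexp_diff by (intro Bochner_Integration.integral_cong) auto
      finally show ?thesis .
    qed
    show "of_real (\<integral>z. a z \<bullet> - DK (w - z) \<partial>lborel) = (\<integral>\<zeta>. (\<integral>z. ?f z \<zeta> \<partial>lborel) \<partial>lborel)"
      unfolding integral_complex_of_real[symmetric] * by (rule F(1)[OF _ le]) measurable
    show "integrable lborel (\<lambda>\<zeta>. \<integral>z. ?f z \<zeta> \<partial>lborel)"
      by (rule F(3)[OF _ le]) measurable
  qed
  \<comment> \<open>Stated for a general finite measure, to be used for both end states.\<close>
  have 2: "of_real (\<integral>z. K (w - z) \<partial>\<sigma>) = (\<integral>\<zeta>. (\<integral>z. iexp (w \<bullet> \<zeta>) * \<kappa> \<zeta> * iexp (- (z \<bullet> \<zeta>)) \<partial>\<sigma>) \<partial>lborel)"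
    (is "_ = (\<integral>\<zeta>. (\<integral>z. ?g z \<zeta> \<partial>\<sigma>) \<partial>lborel)")
    and i2: "integrable lborel (\<lambda>\<zeta>. \<integral>z. iexp (w \<bullet> \<zeta>) * \<kappa> \<zeta> * iexp (- (z \<bullet> \<zeta>)) \<partial>\<sigma>)"
    if "finite_measure \<sigma>" and [measurable_cong]: "sets \<sigma> = sets borel" for \<sigma>
  proof -
    interpret finite_measure \<sigma> by fact
    note F = Fubini_dominated[where f="?g" and M=\<sigma> and N=lborel and \<alpha>="\<lambda>z. 1" and \<beta>="\<lambda>\<zeta>. (1 + (norm \<zeta>)\<^sup>2) * norm (\<kappa> \<zeta>)",
        OF sigma_finite_measure_axioms lborel.sigma_finite_measure_axioms _ _ int_norm]
    have le: "norm (?g z \<zeta>) \<le> 1 * ((1 + (norm \<zeta>)\<^sup>2) * norm (\<kappa> \<zeta>))" for z \<zeta>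
      by (simp add: norm_mult mult_le_cancel_right1)
    have *: "of_real (K (w - z)) = (\<integral>\<zeta>. ?g z \<zeta> \<partial>lborel)" for z
      unfolding rep inner_diff_left iexp_diff by (simp add: mult_ac)
    show "of_real (\<integral>z. K (w - z) \<partial>\<sigma>) = (\<integral>\<zeta>. (\<integral>z. ?g z \<zeta> \<partial>\<sigma>) \<partial>lborel)"
      unfolding integral_complex_of_real[symmetric] * by (rule F(1)[OF _ _ le]) auto
    show "integrable lborel (\<lambda>\<zeta>. \<integral>z. ?g z \<zeta> \<partial>\<sigma>)"
      by (rule F(3)[OF _ _ le]) auto
  qed
  show ?thesis
    unfolding functional_def of_real_add of_real_diff 1 2[OF fin\<^sub>0 sets\<^sub>0] 2[OF fin\<^sub>1 sets\<^sub>1]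
      Bochner_Integration.integral_add[OF i1 i2[OF fin\<^sub>0 sets\<^sub>0], symmetric]
      Bochner_Integration.integral_diff[OF Bochner_Integration.integrable_add[OF i1 i2[OF fin\<^sub>0 sets\<^sub>0]] i2[OF fin\<^sub>1 sets\<^sub>1], symmetric]
    unfolding integral_mult_right_zero symbol_def
    by (simp add: algebra_simps)
qed

text \<open>Inversion is applied with \<kappa> times the symbol as the function and 0 as its
  transform. This product is continuous, integrable and of linear growth, hence 0 everywhere; the
  zero set of the symbol is closed and contains the dense set where \<kappa> is nonzero.\<close>

lemma symbol_eq_zero:
  assumes zero: "\<And>w. functional (\<lambda>z. K (w - z)) (\<lambda>z. - DK (w - z)) = 0"
    and cont: "continuous_on UNIV \<kappa>" and bound: "\<And>\<zeta>. norm (\<kappa> \<zeta>) \<le> B" and supp: "support \<kappa> = UNIV"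
  shows "symbol \<zeta> = 0"
proof -
  have B: "0 \<le> B" using order_trans[OF norm_ge_zero bound] .
  have "of_real ((2 * pi) ^ DIM('a)) * (\<kappa> \<zeta> * symbol \<zeta>) = 0" for \<zeta>
  proof (subst fourier_inversion[symmetric, where F="\<lambda>_. 0" and f="\<lambda>\<zeta>. \<kappa> \<zeta> * symbol \<zeta>" and C="B * mass"])
    show "continuous_on UNIV (\<lambda>\<zeta>. \<kappa> \<zeta> * symbol \<zeta>)" by (intro continuous_on_mult cont continuous_symbol)
    show "norm (\<kappa> \<zeta> * symbol \<zeta>) \<le> B * mass * (1 + norm \<zeta>)" for \<zeta>
      unfolding norm_mult mult.assoc by (intro mult_mono bound norm_symbol_le B) simp
    \<comment> \<open>The point \<open>w = - z\<close> turns the synthesis integral into the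
      transform.\<close>
    show "0 = (\<integral>\<xi>. iexp (- (z \<bullet> \<xi>)) * (\<kappa> \<xi> * symbol \<xi>) \<partial>lborel)" for z
      using functional_kernel_eq[of "- z"] unfolding zero inner_minus_left by simp
  qed (simp_all add: integrable_\<kappa>_symbol)
  then have "{\<zeta>. \<kappa> \<zeta> \<noteq> 0} \<subseteq> {\<zeta>. symbol \<zeta> = 0}" by auto
  moreover have "closed {\<zeta>. symbol \<zeta> = 0}"
    using continuous_symbol by (intro closed_Collect_eq) auto
  ultimately have "closure {\<zeta>. \<kappa> \<zeta> \<noteq> 0} \<subseteq> {\<zeta>. symbol \<zeta> = 0}" by (rule closure_minimal)
  then show ?thesis using supp by (auto simp: support_def)
qed

end

section \<open>Mollification\<close>

text \<open>The sequential form is the one that dominated convergence accepts.\<close>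

lemma directional_derivative_LIMSEQ:
  fixes \<phi> :: "'a::euclidean_space \<Rightarrow> real"
  assumes "(\<phi> has_derivative (\<lambda>h. D \<bullet> h)) (at w)"
    and s: "s \<longlonglongrightarrow> 0" "\<And>n. s n \<noteq> 0"
  shows "(\<lambda>n. (\<phi> (w + s n *\<^sub>R v) - \<phi> w) / s n) \<longlonglongrightarrow> D \<bullet> v"
proof -
  have "((\<lambda>h. w + h *\<^sub>R v) has_derivative (\<lambda>h. h *\<^sub>R v)) (at (0::real))"
    by (auto intro!: derivative_eq_intros)
  then have "((\<lambda>h. \<phi> (w + h *\<^sub>R v)) has_derivative (\<lambda>h. D \<bullet> (h *\<^sub>R v))) (at 0)"
    by (rule has_derivative_compose[where g'="\<lambda>h. D \<bullet> h"]) (use assms(1) in simp)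
  then have "((\<lambda>h. \<phi> (w + h *\<^sub>R v)) has_field_derivative D \<bullet> v) (at 0)"
    by (simp add: has_field_derivative_def mult.commute[of _ "D \<bullet> v"])
  then have "(\<lambda>h. (\<phi> (w + h *\<^sub>R v) - \<phi> w) / h) \<midarrow>0\<rightarrow> D \<bullet> v"
    by (simp add: DERIV_def)
  then show ?thesis using s
    unfolding tendsto_at_iff_sequentially by (auto simp: comp_def)
qed

context fourier_kernel
begin

text \<open>Mean value inequality on the segment from \<open>y\<close> to \<open>y + h\<close>.
  Moving by at most |v| halves the decay rate and costs the factor exp (c |v|^2), because |y|^2 <= 2
  |x|^2 + 2 |v|^2.\<close>

lemma abs_K_diff_le:
  assumes decay: "\<And>z. norm (DK z) \<le> A * exp (- c * (norm z)\<^sup>2)" and c: "c > 0" and h: "norm h \<le> norm v"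
  shows "\<bar>K (y + h) - K y\<bar> \<le> A * exp (c * (norm v)\<^sup>2) * exp (- (c / 2) * (norm y)\<^sup>2) * norm h"
proof -
  let ?B = "A * exp (c * (norm v)\<^sup>2) * exp (- (c / 2) * (norm y)\<^sup>2)"
  have A: "0 \<le> A"
    using order_trans[OF norm_ge_zero decay[of 0]] by simp
  have "norm (K (y + h) - K y) \<le> ?B * norm ((y + h) - y)"
  proof (rule differentiable_bound[of "closed_segment y (y + h)"])
    show "(K has_derivative (\<lambda>h. DK x \<bullet> h)) (at x within closed_segment y (y + h))" for x
      using has_derivative_K by (rule has_derivative_at_withinI)
    fix x assume "x \<in> closed_segment y (y + h)"
    then obtain t where t: "0 \<le> t" "t \<le> 1" and x: "x = y + t *\<^sub>R h"
      by (auto simp: closed_segment_def algebra_simps)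
    have "norm (t *\<^sub>R h) \<le> 1 * norm v" unfolding norm_scaleR using t h by (intro mult_mono) auto
    then have "norm y \<le> norm x + norm v"
      using norm_triangle_ineq4[of x "t *\<^sub>R h"] by (simp add: x)
    then have "(norm y)\<^sup>2 \<le> (norm x + norm v)\<^sup>2" by (intro power_mono) auto
    also have "\<dots> \<le> 2 * (norm x)\<^sup>2 + 2 * (norm v)\<^sup>2"
      using zero_le_power2[of "norm x - norm v"] by (simp add: power2_eq_square algebra_simps)
    finally have "c * (norm y)\<^sup>2 \<le> c * (2 * (norm x)\<^sup>2 + 2 * (norm v)\<^sup>2)" using c by (intro mult_left_mono) auto
    then have "exp (- c * (norm x)\<^sup>2) \<le> exp (c * (norm v)\<^sup>2 + - (c / 2) * (norm y)\<^sup>2)"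
      by (simp add: algebra_simps)
    then have "A * exp (- c * (norm x)\<^sup>2) \<le> ?B"
      unfolding exp_add mult.assoc using A by (intro mult_left_mono) auto
    with decay[of x] have "norm (DK x) \<le> ?B" by simp
    then have "norm (DK x \<bullet> h) \<le> ?B * norm h" for h
      using order_trans[OF Cauchy_Schwarz_ineq2] mult_right_mono[OF _ norm_ge_zero] by simp blast
    then show "onorm (\<lambda>h. DK x \<bullet> h) \<le> ?B" by (rule onorm_le)
  qed auto
  then show ?thesis by simp
qed

text \<open>Translation invariance of Lebesgue measure shifts a difference quotient from
  \<open>K\<close> to \<phi>, and dominated convergence handles both limits. In this way \<phi> may
  be merely Lipschitz and differentiable almost everywhere.\<close>

lemma integration_by_parts:
  assumes decay: "\<And>z. norm (DK z) \<le> A * exp (- c * (norm z)\<^sup>2)" "\<And>z. \<bar>K z\<bar> \<le> A * exp (- c * (norm z)\<^sup>2)" and c: "c > 0"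
    and [measurable]: "\<phi> \<in> borel_measurable borel" "D \<in> borel_measurable borel"
    and \<phi>: "\<And>w. \<bar>\<phi> w\<bar> \<le> B" and lip: "\<And>w w'. \<bar>\<phi> w - \<phi> w'\<bar> \<le> B * norm (w - w')"
    and der: "AE w in lborel. (\<phi> has_derivative (\<lambda>h. D w \<bullet> h)) (at w)"
  shows "(\<integral>w. \<phi> w * (DK (w - z) \<bullet> v) \<partial>lborel) = - (\<integral>w. K (w - z) * (D w \<bullet> v) \<partial>lborel)"
proof -
  define s where "s n = inverse (real (Suc n))" for n
  have s: "s \<longlonglongrightarrow> 0" "\<And>n. s n \<noteq> 0" "\<And>n. s n > 0" "\<And>n. \<bar>s n\<bar> \<le> 1"
    unfolding s_def using LIMSEQ_inverse_real_of_nat by (auto simp: field_simps)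
  have B: "B \<ge> 0" using order_trans[OF abs_ge_zero \<phi>] .
  have A: "A \<ge> 0" using order_trans[OF norm_ge_zero decay(1)[of 0]] by simp
  have int_exp: "integrable lborel (\<lambda>w. exp (- c' * (norm (w - z'))\<^sup>2))" if "c' > 0" for c' z'
    using integrable_lborel_affine[OF _ integrable_exp_neg_norm_sq[OF that], of 1 "- z'"] by simp
  have int: "integrable lborel (\<lambda>w. \<phi> (w + x) * K (w - z'))" for x z'
  proof (rule Bochner_Integration.integrable_bound)
    show "integrable lborel (\<lambda>w. B * (A * exp (- c * (norm (w - z'))\<^sup>2)))"
      by (intro integrable_mult_right int_exp c)
    show "AE w in lborel. norm (\<phi> (w + x) * K (w - z')) \<le> norm (B * (A * exp (- c * (norm (w - z'))\<^sup>2)))"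
      using A B by (auto simp: abs_mult intro!: AE_I2 mult_mono \<phi> decay(2)[unfolded mult_minus_left])
  qed measurable
  \<comment> \<open>A shift of \<open>K\<close> by \<open>- s n\<close> times \<open>v\<close>
    becomes a shift of \<phi> by \<open>s n\<close> times \<open>v\<close>; this is where the minus
    sign of the conclusion comes from.\<close>
  define Q where "Q n = (\<integral>w. \<phi> w * ((K ((w - z) + - s n *\<^sub>R v) - K (w - z)) / s n) \<partial>lborel)" for n
  have "Q \<longlonglongrightarrow> (\<integral>w. \<phi> w * (DK (w - z) \<bullet> - v) \<partial>lborel)"
    unfolding Q_def
  proof (rule integral_dominated_convergence[where w="\<lambda>w. B * (A * exp (c * (norm v)\<^sup>2) * norm v) * exp (- (c / 2) * (norm (w - z))\<^sup>2)"])
    show "integrable lborel (\<lambda>w. B * (A * exp (c * (norm v)\<^sup>2) * norm v) * exp (- (c / 2) * (norm (w - z))\<^sup>2))"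
      using c by (intro integrable_mult_right int_exp) simp
    show "AE w in lborel. (\<lambda>n. \<phi> w * ((K ((w - z) + - s n *\<^sub>R v) - K (w - z)) / s n)) \<longlonglongrightarrow> \<phi> w * (DK (w - z) \<bullet> - v)"
      using directional_derivative_LIMSEQ[OF has_derivative_K s(1,2), of _ "- v"]
      by (intro AE_I2 tendsto_mult tendsto_const) simp
    show "AE w in lborel. norm (\<phi> w * ((K ((w - z) + - s n *\<^sub>R v) - K (w - z)) / s n))
        \<le> B * (A * exp (c * (norm v)\<^sup>2) * norm v) * exp (- (c / 2) * (norm (w - z))\<^sup>2)" for n
    proof (rule AE_I2)
      fix w
      have "norm (- s n *\<^sub>R v) \<le> norm v" using s(4)[of n] by (simp add: mult_left_le_one_le)
      from abs_K_diff_le[OF decay(1) c this, of "w - z"]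
      have "\<bar>(K ((w - z) + - s n *\<^sub>R v) - K (w - z)) / s n\<bar> \<le> A * exp (c * (norm v)\<^sup>2) * exp (- (c / 2) * (norm (w - z))\<^sup>2) * norm v"
        using s(3)[of n] by (simp add: divide_le_eq mult_ac)
      then have "\<bar>\<phi> w\<bar> * \<bar>(K ((w - z) + - s n *\<^sub>R v) - K (w - z)) / s n\<bar> \<le> B * (A * exp (c * (norm v)\<^sup>2) * exp (- (c / 2) * (norm (w - z))\<^sup>2) * norm v)"
        by (intro mult_mono \<phi> B) auto
      then show "norm (\<phi> w * ((K ((w - z) + - s n *\<^sub>R v) - K (w - z)) / s n))
        \<le> B * (A * exp (c * (norm v)\<^sup>2) * norm v) * exp (- (c / 2) * (norm (w - z))\<^sup>2)"
        unfolding real_norm_def abs_mult by (simp only: mult_ac)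
    qed
  qed measurable
  moreover have "Q \<longlonglongrightarrow> (\<integral>w. K (w - z) * (D w \<bullet> v) \<partial>lborel)"
  proof -
    have Q: "Q n = (\<integral>w. K (w - z) * ((\<phi> (w + s n *\<^sub>R v) - \<phi> w) / s n) \<partial>lborel)" for n
    proof -
      have "Q n = ((\<integral>w. \<phi> (w + 0) * K (w - (z + s n *\<^sub>R v)) \<partial>lborel) - (\<integral>w. \<phi> (w + 0) * K (w - z) \<partial>lborel)) / s n"
        unfolding Q_def Bochner_Integration.integral_diff[OF int int, symmetric] integral_divide_zero[symmetric]
        by (intro Bochner_Integration.integral_cong refl) (simp add: algebra_simps diff_divide_distrib)
      also have "(\<integral>w. \<phi> (w + 0) * K (w - (z + s n *\<^sub>R v)) \<partial>lborel) = (\<integral>w. \<phi> (w + s n *\<^sub>R v) * K (w - z) \<partial>lborel)"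
        using integral_lborel_affine[OF _ int[of 0 "z + s n *\<^sub>R v"], of 1 "s n *\<^sub>R v"] by (simp add: add.commute)
      also have "((\<integral>w. \<phi> (w + s n *\<^sub>R v) * K (w - z) \<partial>lborel) - (\<integral>w. \<phi> (w + 0) * K (w - z) \<partial>lborel)) / s n
          = (\<integral>w. K (w - z) * ((\<phi> (w + s n *\<^sub>R v) - \<phi> w) / s n) \<partial>lborel)"
        unfolding Bochner_Integration.integral_diff[OF int int, symmetric] integral_divide_zero[symmetric]
        by (intro Bochner_Integration.integral_cong refl) (simp add: algebra_simps diff_divide_distrib)
      finally show ?thesis .
    qed
    show ?thesis unfolding Q
    proof (rule integral_dominated_convergence[where w="\<lambda>w. A * exp (- c * (norm (w - z))\<^sup>2) * (B * norm v)"])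
      show "integrable lborel (\<lambda>w. A * exp (- c * (norm (w - z))\<^sup>2) * (B * norm v))"
        by (intro integrable_mult_left integrable_mult_right int_exp c)
      show "AE w in lborel. (\<lambda>n. K (w - z) * ((\<phi> (w + s n *\<^sub>R v) - \<phi> w) / s n)) \<longlonglongrightarrow> K (w - z) * (D w \<bullet> v)"
        using der
      proof eventually_elim
        case (elim w)
        show ?case by (intro tendsto_mult tendsto_const directional_derivative_LIMSEQ[OF elim s(1,2)])
      qed
      show "AE w in lborel. norm (K (w - z) * ((\<phi> (w + s n *\<^sub>R v) - \<phi> w) / s n)) \<le> A * exp (- c * (norm (w - z))\<^sup>2) * (B * norm v)" for n
      proof (rule AE_I2)
        fix w
        have "\<bar>(\<phi> (w + s n *\<^sub>R v) - \<phi> w) / s n\<bar> \<le> B * norm v"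
          using lip[of "w + s n *\<^sub>R v" w] s(3)[of n] by (simp add: divide_le_eq mult_ac)
        then show "norm (K (w - z) * ((\<phi> (w + s n *\<^sub>R v) - \<phi> w) / s n)) \<le> A * exp (- c * (norm (w - z))\<^sup>2) * (B * norm v)"
          unfolding real_norm_def abs_mult[of "K (w - z)"] using A by (intro mult_mono decay(2)) auto
      qed
    qed measurable
  qed
  ultimately show ?thesis using LIMSEQ_unique by fastforce
qed

end

context flux_kernel
begin

text \<open>By Fubini, the functional of the mollified pair is the integral over \<open>w\<close> of
  \<phi> w times the functional of the kernel section at \<open>w\<close>, which vanishes with the
  symbol. Integration by parts moves the derivative from \<phi> to the kernel, so that both
  arguments fit this formula.\<close>

lemma functional_convolution_eq_zero:
  assumes decay: "\<And>z. norm (DK z) \<le> A * exp (- c * (norm z)\<^sup>2)" "\<And>z. \<bar>K z\<bar> \<le> A * exp (- c * (norm z)\<^sup>2)" and c: "c > 0"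
    and [measurable]: "\<phi> \<in> borel_measurable borel" "D \<in> borel_measurable borel"
    and \<phi>: "\<And>w. \<bar>\<phi> w\<bar> \<le> B" and lip: "\<And>w w'. \<bar>\<phi> w - \<phi> w'\<bar> \<le> B * norm (w - w')"
    and der: "AE w in lborel. (\<phi> has_derivative (\<lambda>h. D w \<bullet> h)) (at w)"
    and D: "\<And>w. norm (D w) \<le> B"
    and symbol: "\<And>\<zeta>. symbol \<zeta> = 0"
  shows "functional (\<lambda>z. \<integral>w. K (w - z) * \<phi> w \<partial>lborel) (\<lambda>z. \<integral>w. K (w - z) *\<^sub>R D w \<partial>lborel) = 0"
proof -
  have B: "B \<ge> 0" using order_trans[OF abs_ge_zero \<phi>] .
  have A: "A \<ge> 0" using order_trans[OF norm_ge_zero decay(1)[of 0]] by simp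
  have int_exp: "integrable lborel (\<lambda>w::'a. A * exp (- c * (norm w)\<^sup>2))"
    by (intro integrable_mult_right integrable_exp_neg_norm_sq c)
  have int_exp': "integrable lborel (\<lambda>w. A * exp (- c * (norm (w - z))\<^sup>2))" for z :: 'a
    using integrable_lborel_affine[OF _ int_exp, of 1 "- z"] by simp
  have int_D: "integrable lborel (\<lambda>w. K (w - z) *\<^sub>R D w)" for z
    by (rule Bochner_Integration.integrable_bound[OF integrable_mult_left[OF int_exp'[of z], of B]])
      (use A B in \<open>auto simp: abs_mult intro!: AE_I2 mult_mono decay(2)[unfolded mult_minus_left] D\<close>)
  have 1: "(\<integral>z. a z \<bullet> (\<integral>w. K (w - z) *\<^sub>R D w \<partial>lborel) \<partial>lborel) =
      (\<integral>w. (\<integral>z. \<phi> w * (a z \<bullet> - DK (w - z)) \<partial>lborel) \<partial>lborel)"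
    and i1: "integrable lborel (\<lambda>w. \<integral>z. \<phi> w * (a z \<bullet> - DK (w - z)) \<partial>lborel)"
  proof -
    note F = Fubini_convolution[where f="\<lambda>z w. \<phi> w * (a z \<bullet> - DK (w - z))" and M=lborel
        and \<alpha>="\<lambda>z. B * norm (a z)" and \<beta>="\<lambda>w. A * exp (- c * (norm w)\<^sup>2)",
        OF lborel.sigma_finite_measure_axioms sets_lborel _ integrable_mult_right[OF integrable_norm[OF int_a]] int_exp]
    have le: "norm (\<phi> w * (a z \<bullet> - DK (w - z))) \<le> (B * norm (a z)) * (A * exp (- c * (norm (w - z))\<^sup>2))" for z w
    proof -
      have "\<bar>a z \<bullet> - DK (w - z)\<bar> \<le> norm (a z) * (A * exp (- c * (norm (w - z))\<^sup>2))"
        using order_trans[OF Cauchy_Schwarz_ineq2 mult_left_mono[OF decay(1) norm_ge_zero], of "a z" "w - z"]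
        by simp
      from mult_mono[OF \<phi> this B abs_ge_zero] show ?thesis by (simp only: real_norm_def abs_mult mult.assoc)
    qed
    have "a z \<bullet> (\<integral>w. K (w - z) *\<^sub>R D w \<partial>lborel) = (\<integral>w. \<phi> w * (a z \<bullet> - DK (w - z)) \<partial>lborel)" for z
    proof -
      have "a z \<bullet> (\<integral>w. K (w - z) *\<^sub>R D w \<partial>lborel) = (\<integral>w. a z \<bullet> (K (w - z) *\<^sub>R D w) \<partial>lborel)"
        by (intro integral_inner_right[symmetric] int_D)
      also have "\<dots> = (\<integral>w. K (w - z) * (D w \<bullet> a z) \<partial>lborel)"
        by (intro Bochner_Integration.integral_cong refl) (simp add: inner_commute)
      also have "\<dots> = - (\<integral>w. \<phi> w * (DK (w - z) \<bullet> a z) \<partial>lborel)"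
        using integration_by_parts[OF decay c assms(4,5) \<phi> lip der] by simp
      finally show ?thesis by (simp add: inner_commute)
    qed
    then show "(\<integral>z. a z \<bullet> (\<integral>w. K (w - z) *\<^sub>R D w \<partial>lborel) \<partial>lborel) =
      (\<integral>w. (\<integral>z. \<phi> w * (a z \<bullet> - DK (w - z)) \<partial>lborel) \<partial>lborel)"
      using F(1)[OF _ le] by simp
    show "integrable lborel (\<lambda>w. \<integral>z. \<phi> w * (a z \<bullet> - DK (w - z)) \<partial>lborel)"
      by (rule F(2)[OF _ le]) measurable
  qed
  have 2: "(\<integral>z. (\<integral>w. K (w - z) * \<phi> w \<partial>lborel) \<partial>\<sigma>) = (\<integral>w. (\<integral>z. \<phi> w * K (w - z) \<partial>\<sigma>) \<partial>lborel)"
    and i2: "integrable lborel (\<lambda>w. \<integral>z. \<phi> w * K (w - z) \<partial>\<sigma>)"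
    if "finite_measure \<sigma>" and s: "sets \<sigma> = sets borel" for \<sigma>
  proof -
    interpret finite_measure \<sigma> by fact
    note F = Fubini_convolution[where f="\<lambda>z w. \<phi> w * K (w - z)" and M=\<sigma>
        and \<alpha>="\<lambda>z. B" and \<beta>="\<lambda>w. A * exp (- c * (norm w)\<^sup>2)",
        OF sigma_finite_measure_axioms s _ _ int_exp]
    have le: "norm (\<phi> w * K (w - z)) \<le> B * (A * exp (- c * (norm (w - z))\<^sup>2))" for z w
      unfolding real_norm_def abs_mult by (intro mult_mono \<phi> decay(2) B) auto
    show "(\<integral>z. (\<integral>w. K (w - z) * \<phi> w \<partial>lborel) \<partial>\<sigma>) = (\<integral>w. (\<integral>z. \<phi> w * K (w - z) \<partial>\<sigma>) \<partial>lborel)"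
      using F(1)[OF _ _ le] by (simp add: mult.commute)
    show "integrable lborel (\<lambda>w. \<integral>z. \<phi> w * K (w - z) \<partial>\<sigma>)"
      by (rule F(2)[OF _ _ le]) auto
  qed
  have "functional (\<lambda>z. K (w - z)) (\<lambda>z. - DK (w - z)) = 0" for w
    using functional_kernel_eq[of w] by (simp add: symbol)
  then have "(\<integral>w. \<phi> w * functional (\<lambda>z. K (w - z)) (\<lambda>z. - DK (w - z)) \<partial>lborel) = 0" by simp
  then show ?thesis
    unfolding functional_def distrib_left right_diff_distrib integral_mult_right_zero[symmetric]
      1 2[OF fin\<^sub>0 sets\<^sub>0] 2[OF fin\<^sub>1 sets\<^sub>1]
      Bochner_Integration.integral_add[OF i1 i2[OF fin\<^sub>0 sets\<^sub>0], symmetric]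
      Bochner_Integration.integral_diff[OF Bochner_Integration.integrable_add[OF i1 i2[OF fin\<^sub>0 sets\<^sub>0]] i2[OF fin\<^sub>1 sets\<^sub>1], symmetric]
    by simp
qed

end

section \<open>Gaussians of width e as kernels with a Fourier representation\<close>

context
  fixes e :: real
  assumes e: "0 < e" "e \<le> 1"
begin

text \<open>The factor in front of the Gaussian in frequency is the reciprocal of the one produced
  by \<open>integral_gauss_scaled_iexp\<close>, so the synthesised kernel is exactly the
  unnormalised Gaussian of width \<open>e\<close>.\<close>

lemma fourier_kernel_gauss:
  "fourier_kernel (\<lambda>\<zeta>::'a::euclidean_space. of_real (e ^ DIM('a) / sqrt (2 * pi) ^ DIM('a) * gauss (e *\<^sub>R \<zeta>))) (\<lambda>z. gauss ((1 / e) *\<^sub>R z))"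
proof
  let ?c = "e ^ DIM('a) / sqrt (2 * pi) ^ DIM('a)"
  have c: "?c \<ge> 0" using e by simp
  show "integrable lborel (\<lambda>\<zeta>::'a. (1 + (norm \<zeta>)\<^sup>2) *\<^sub>R complex_of_real (?c * gauss (e *\<^sub>R \<zeta>)))"
  proof (rule Bochner_Integration.integrable_bound)
    show "integrable lborel (\<lambda>\<zeta>::'a. ?c / e\<^sup>2 * (4 * exp (- (e\<^sup>2 / 4) * (norm \<zeta>)\<^sup>2)))"
      using e by (intro integrable_mult_right integrable_exp_neg_norm_sq) simp
    show "AE \<zeta> in lborel. norm ((1 + (norm \<zeta>)\<^sup>2) *\<^sub>R complex_of_real (?c * gauss (e *\<^sub>R (\<zeta>::'a))))
      \<le> norm (?c / e\<^sup>2 * (4 * exp (- (e\<^sup>2 / 4) * (norm \<zeta>)\<^sup>2)))"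
    proof (rule AE_I2)
      fix \<zeta> :: 'a
      have "e\<^sup>2 \<le> 1" using e by (simp add: power_le_one)
      \<comment> \<open>Here \<open>e <= 1\<close> enters: the right-hand side equals 1/e^2 +
        |\<zeta>|^2.\<close>
      then have "1 + (norm \<zeta>)\<^sup>2 \<le> (1 + (norm (e *\<^sub>R \<zeta>))\<^sup>2) / e\<^sup>2"
        using e by (simp add: power_mult_distrib field_simps)
      from mult_right_mono[OF this gauss_nonneg[of "e *\<^sub>R \<zeta>"]]
      have "(1 + (norm \<zeta>)\<^sup>2) * gauss (e *\<^sub>R \<zeta>) \<le> (1 + (norm (e *\<^sub>R \<zeta>))\<^sup>2) * gauss (e *\<^sub>R \<zeta>) / e\<^sup>2" by simp
      also have "\<dots> \<le> 4 * exp (- (1/4) * (norm (e *\<^sub>R \<zeta>))\<^sup>2) / e\<^sup>2"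
        by (intro divide_right_mono one_plus_sq_gauss_le) simp
      also have "- (1/4) * (norm (e *\<^sub>R \<zeta>))\<^sup>2 = - (e\<^sup>2 / 4) * (norm \<zeta>)\<^sup>2" by (simp add: power_mult_distrib)
      finally have "?c * ((1 + (norm \<zeta>)\<^sup>2) * gauss (e *\<^sub>R \<zeta>)) \<le> ?c * (4 * exp (- (e\<^sup>2 / 4) * (norm \<zeta>)\<^sup>2) / e\<^sup>2)"
        using c by (rule mult_left_mono)
      moreover have "norm ((1 + (norm \<zeta>)\<^sup>2) *\<^sub>R complex_of_real (?c * gauss (e *\<^sub>R \<zeta>))) = ?c * ((1 + (norm \<zeta>)\<^sup>2) * gauss (e *\<^sub>R \<zeta>))"
        using c unfolding norm_scaleR norm_of_real abs_mult[of ?c] abs_of_nonneg[OF c] by (simp add: abs_of_nonneg[OF gauss_nonneg] abs_of_nonneg[OF add_nonneg_nonneg])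
      moreover have "norm (?c / e\<^sup>2 * (4 * exp (- (e\<^sup>2 / 4) * (norm \<zeta>)\<^sup>2))) = ?c * (4 * exp (- (e\<^sup>2 / 4) * (norm \<zeta>)\<^sup>2) / e\<^sup>2)"
        using e by (simp add: abs_mult power_abs)
      ultimately show "norm ((1 + (norm \<zeta>)\<^sup>2) *\<^sub>R complex_of_real (?c * gauss (e *\<^sub>R \<zeta>)))
        \<le> norm (?c / e\<^sup>2 * (4 * exp (- (e\<^sup>2 / 4) * (norm \<zeta>)\<^sup>2)))" by (simp only:)
    qed
  qed measurable
  fix z :: 'a
  have "(\<integral>\<zeta>. iexp (z \<bullet> \<zeta>) * of_real (?c * gauss (e *\<^sub>R \<zeta>)) \<partial>lborel)
     = (\<integral>\<zeta>. of_real ?c * (of_real (gauss (e *\<^sub>R \<zeta>)) * iexp (\<zeta> \<bullet> z)) \<partial>lborel)"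
    by (intro Bochner_Integration.integral_cong refl) (simp add: inner_commute)
  also have "\<dots> = of_real ?c * (\<integral>\<zeta>. of_real (gauss (e *\<^sub>R \<zeta>)) * iexp (\<zeta> \<bullet> z) \<partial>lborel)"
    by (rule integral_mult_right_zero)
  also have "\<dots> = of_real (gauss ((1 / e) *\<^sub>R z))"
    unfolding integral_gauss_scaled_iexp[OF e(1)] of_real_mult[symmetric] using e(1) by simp
  finally show "of_real (gauss ((1 / e) *\<^sub>R z)) = (\<integral>\<zeta>. iexp (z \<bullet> \<zeta>) * of_real (?c * gauss (e *\<^sub>R \<zeta>)) \<partial>lborel)" ..
qed

lemma has_derivative_gauss_scaled:
  "((\<lambda>z. gauss ((1 / e) *\<^sub>R z)) has_derivative (\<lambda>h. (- (gauss ((1 / e) *\<^sub>R z) / e\<^sup>2) *\<^sub>R z) \<bullet> h)) (at (z::'a::euclidean_space))"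
proof -
  have eq: "gauss ((1 / e) *\<^sub>R z) = exp (- (z \<bullet> z) / (2 * e\<^sup>2))" for z :: 'a
    using e by (simp add: gauss_def dot_square_norm power_divide)
  show ?thesis unfolding eq
    using e by (auto intro!: derivative_eq_intros simp: inner_commute field_simps power2_eq_square power4_eq_xxxx)
qed

text \<open>A single pair of constants, 2/e and 1/(4 e^2), serves for gradient and value, as
  \<open>integration_by_parts\<close> requires; the bound on the value uses
  \<open>e <= 1\<close>.\<close>

lemma gauss_scaled_decay:
  fixes z :: "'a::euclidean_space"
  shows "norm (- (gauss ((1 / e) *\<^sub>R z) / e\<^sup>2) *\<^sub>R z) \<le> 2 / e * exp (- (1 / (4 * e\<^sup>2)) * (norm z)\<^sup>2)"
    and "\<bar>gauss ((1 / e) *\<^sub>R z)\<bar> \<le> 2 / e * exp (- (1 / (4 * e\<^sup>2)) * (norm z)\<^sup>2)"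
proof -
  let ?x = "(1 / e) *\<^sub>R z"
  have *: "(1 + norm ?x) * gauss ?x \<le> 2 * exp (- (1 / (4 * e\<^sup>2)) * (norm z)\<^sup>2)"
    using one_plus_gauss_le[of ?x] e by (simp add: power_divide power_mult_distrib)
  have "norm ?x * gauss ?x \<le> (1 + norm ?x) * gauss ?x"
    by (intro mult_right_mono gauss_nonneg) simp
  with * have "norm ?x * gauss ?x / e \<le> 2 * exp (- (1 / (4 * e\<^sup>2)) * (norm z)\<^sup>2) / e"
    using e by (intro divide_right_mono) auto
  moreover have "norm (- (gauss ?x / e\<^sup>2) *\<^sub>R z) = norm ?x * gauss ?x / e"
    using e by (simp add: abs_of_nonneg[OF gauss_nonneg] power2_eq_square)
  ultimately show "norm (- (gauss ?x / e\<^sup>2) *\<^sub>R z) \<le> 2 / e * exp (- (1 / (4 * e\<^sup>2)) * (norm z)\<^sup>2)" by simp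
  have "1 * gauss ?x \<le> (1 + norm ?x) * gauss ?x"
    by (intro mult_right_mono gauss_nonneg) simp
  also have "\<dots> \<le> 2 * exp (- (1 / (4 * e\<^sup>2)) * (norm z)\<^sup>2)" by (rule *)
  also have "\<dots> \<le> 2 / e * exp (- (1 / (4 * e\<^sup>2)) * (norm z)\<^sup>2)"
    using e by (intro mult_right_mono) (auto simp: field_simps)
  finally show "\<bar>gauss ?x\<bar> \<le> 2 / e * exp (- (1 / (4 * e\<^sup>2)) * (norm z)\<^sup>2)"
    by (simp add: abs_of_nonneg[OF gauss_nonneg])
qed

end

text \<open>A functional annihilating all exponentials annihilates Gaussians, by Fourier synthesis, hence
  all Gaussian mollifications of \<open>\<phi>\<close>, hence \<open>\<phi>\<close> itself.\<close>

lemma (in flux) functional_eq_zero: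
  assumes symbol: "\<And>\<zeta>. symbol \<zeta> = 0"
    and cont: "continuous_on UNIV \<phi>" and D[measurable]: "D \<in> borel_measurable borel"
    and \<phi>: "\<And>w. \<bar>\<phi> w\<bar> \<le> B" and lip: "\<And>w w'. \<bar>\<phi> w - \<phi> w'\<bar> \<le> B * norm (w - w')"
    and D_le: "\<And>w. norm (D w) \<le> B"
    and der: "AE w in lborel. (\<phi> has_derivative (\<lambda>h. D w \<bullet> h)) (at w)"
    and cont_D: "AE w in lborel. a w \<noteq> 0 \<longrightarrow> isCont D w"
  shows "functional \<phi> D = 0"
proof -
  have [measurable]: "\<phi> \<in> borel_measurable borel" by (intro borel_measurable_continuous_onI cont)
  have B: "B \<ge> 0" using order_trans[OF abs_ge_zero \<phi>] .
  define e where "e n = inverse (real (Suc n))" for n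
  have e: "e \<longlonglongrightarrow> 0" "\<And>n. \<bar>e n\<bar> \<le> 1" "\<And>n. e n > 0" "\<And>n. e n \<le> 1"
    unfolding e_def using LIMSEQ_inverse_real_of_nat by (auto simp: field_simps)
  \<comment> \<open>Mollification at scale \<open>e n\<close>, up to the factor \<open>?S\<close>,
    the total mass of the unnormalised Gaussian.\<close>
  let ?m = "\<lambda>f n z. \<integral>y. gauss y *\<^sub>R f (z + e n *\<^sub>R y) \<partial>lborel"
  let ?S = "sqrt (2 * pi) ^ DIM('a)"
  have m_le: "norm (?m f n z) \<le> ?S * B"
    if [measurable]: "f \<in> borel_measurable borel" and f: "\<And>z. norm (f z) \<le> B"
    for f :: "'a \<Rightarrow> 'b::{banach, second_countable_topology}" and n z
  proof -
    have "norm (?m f n z) \<le> (\<integral>y. gauss (y::'a) * B \<partial>lborel)"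
      by (rule norm_integral_le) (auto simp: integrable_gauss gauss_nonneg intro!: mult_left_mono f)
    then show ?thesis by (simp add: integral_gauss)
  qed
  have zero: "functional (?m \<phi> n) (?m D n) = 0" for n
  proof -
    interpret fourier_kernel "\<lambda>\<zeta>::'a. of_real (e n ^ DIM('a) / sqrt (2 * pi) ^ DIM('a) * gauss (e n *\<^sub>R \<zeta>))" "\<lambda>z. gauss ((1 / e n) *\<^sub>R z)"
      by (rule fourier_kernel_gauss[OF e(3,4)])
    interpret flux_kernel a \<sigma>\<^sub>0 \<sigma>\<^sub>1 "\<lambda>\<zeta>::'a. of_real (e n ^ DIM('a) / sqrt (2 * pi) ^ DIM('a) * gauss (e n *\<^sub>R \<zeta>))" "\<lambda>z. gauss ((1 / e n) *\<^sub>R z)" ..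
    have DK: "DK z = - (gauss ((1 / e n) *\<^sub>R z) / (e n)\<^sup>2) *\<^sub>R z" for z
      by (rule DK_unique[OF has_derivative_gauss_scaled[OF e(3,4)]])
    \<comment> \<open>Substituting w = z + e y turns integration against the narrow Gaussian into
      the mollification \<open>?m\<close>, with the Jacobian as factor.\<close>
    have sub: "(\<integral>w. gauss ((1 / e n) *\<^sub>R (w - z)) *\<^sub>R f w \<partial>lborel) = e n ^ DIM('a) *\<^sub>R ?m f n z"
      if [measurable]: "f \<in> borel_measurable borel" and f: "\<And>z. norm (f z) \<le> B"
      for f :: "'a \<Rightarrow> 'b::{banach, second_countable_topology}" and z
    proof -
      have eq: "gauss ((1 / e n) *\<^sub>R ((z + e n *\<^sub>R y) - z)) *\<^sub>R f (z + e n *\<^sub>R y) = gauss y *\<^sub>R f (z + e n *\<^sub>R y)" for y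
        using e(3)[of n] by simp
      have "integrable lborel (\<lambda>w. gauss ((1 / e n) *\<^sub>R (w - z)) *\<^sub>R f w)"
      proof (rule Bochner_Integration.integrable_bound)
        show "integrable lborel (\<lambda>w. gauss ((1 / e n) *\<^sub>R (w - z)) * B)"
          using integrable_lborel_affine[OF _ integrable_gauss, of "1 / e n" "- (1 / e n) *\<^sub>R z"] e(3)[of n]
          by (simp add: algebra_simps)
        show "AE w in lborel. norm (gauss ((1 / e n) *\<^sub>R (w - z)) *\<^sub>R f w) \<le> norm (gauss ((1 / e n) *\<^sub>R (w - z)) * B)"
          by (auto simp: B gauss_nonneg abs_mult intro!: AE_I2 mult_left_mono f)
      qed measurable
      from integral_lborel_affine[OF _ this, of "e n" z] show ?thesis using e(3)[of n] unfolding eq by simp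
    qed
    have "functional (\<lambda>z. \<integral>w. gauss ((1 / e n) *\<^sub>R (w - z)) * \<phi> w \<partial>lborel) (\<lambda>z. \<integral>w. gauss ((1 / e n) *\<^sub>R (w - z)) *\<^sub>R D w \<partial>lborel) = 0"
      using e(3)[of n]
      by (intro functional_convolution_eq_zero[where A="2 / e n" and c="1 / (4 * (e n)\<^sup>2)"])
        (auto simp only: DK intro!: gauss_scaled_decay[OF e(3,4)] \<phi> lip D_le der symbol D \<open>\<phi> \<in> borel_measurable borel\<close>, auto)
    also have "(\<lambda>z. \<integral>w. gauss ((1 / e n) *\<^sub>R (w - z)) * \<phi> w \<partial>lborel) = (\<lambda>z. e n ^ DIM('a) *\<^sub>R ?m \<phi> n z)"
      using sub[of \<phi>] \<phi> by simp
    also have "(\<lambda>z. \<integral>w. gauss ((1 / e n) *\<^sub>R (w - z)) *\<^sub>R D w \<partial>lborel) = (\<lambda>z. e n ^ DIM('a) *\<^sub>R ?m D n z)"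
      using sub[of D] D_le by simp
    also have "functional (\<lambda>z. e n ^ DIM('a) *\<^sub>R ?m \<phi> n z) (\<lambda>z. e n ^ DIM('a) *\<^sub>R ?m D n z) = e n ^ DIM('a) * functional (?m \<phi> n) (?m D n)"
      unfolding functional_def by (simp add: algebra_simps)
    finally show ?thesis using e(3)[of n] by simp
  qed
  have \<sigma>: "(\<lambda>n. \<integral>z. ?m \<phi> n z \<partial>\<sigma>) \<longlonglongrightarrow> (\<integral>z. ?S *\<^sub>R \<phi> z \<partial>\<sigma>)"
    if "finite_measure \<sigma>" and [measurable_cong]: "sets \<sigma> = sets borel" for \<sigma>
  proof -
    interpret finite_measure \<sigma> by fact
    show ?thesis
    proof (rule integral_dominated_convergence[where w="\<lambda>_. ?S * B"])
      show "AE z in \<sigma>. (\<lambda>n. ?m \<phi> n z) \<longlonglongrightarrow> ?S *\<^sub>R \<phi> z"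
      proof (intro AE_I2 gauss_mollify_tendsto[where C=B] e)
        show "isCont \<phi> z" for z using cont by (simp add: continuous_on_eq_continuous_at)
        show "norm (\<phi> z) \<le> B * (1 + norm z)" for z
          unfolding real_norm_def by (rule order_trans[OF \<phi>]) (use B in \<open>simp add: distrib_left\<close>)
      qed measurable
      show "AE z in \<sigma>. norm (?m \<phi> n z) \<le> ?S * B" for n
        by (intro AE_I2 m_le) (auto simp: \<phi>)
    qed measurable
  qed
  \<comment> \<open>Continuity of \<open>D\<close> matters only where \<open>a\<close> is nonzero;
    elsewhere the integrand is 0 for every \<open>n\<close>.\<close>
  have "(\<lambda>n. \<integral>z. a z \<bullet> ?m D n z \<partial>lborel) \<longlonglongrightarrow> (\<integral>z. a z \<bullet> ?S *\<^sub>R D z \<partial>lborel)"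
  proof (rule integral_dominated_convergence[where w="\<lambda>z. norm (a z) * (?S * B)"])
    show "AE z in lborel. (\<lambda>n. a z \<bullet> ?m D n z) \<longlonglongrightarrow> a z \<bullet> ?S *\<^sub>R D z"
      using cont_D
    proof eventually_elim
      case (elim z)
      show ?case
      proof (cases "a z = 0")
        case False
        have "norm (D z) \<le> B * (1 + norm z)" for z
          by (rule order_trans[OF D_le]) (use B in \<open>simp add: distrib_left\<close>)
        then show ?thesis
          using False elim by (intro tendsto_inner tendsto_const gauss_mollify_tendsto[where C=B] e D) auto
      qed simp
    qed
    show "AE z in lborel. norm (a z \<bullet> ?m D n z) \<le> norm (a z) * (?S * B)" for n
      using order_trans[OF Cauchy_Schwarz_ineq2 mult_left_mono[OF m_le[OF D D_le] norm_ge_zero]] by auto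
  qed (use int_a in auto)
  then have "(\<lambda>n. functional (?m \<phi> n) (?m D n)) \<longlonglongrightarrow> functional (\<lambda>z. ?S *\<^sub>R \<phi> z) (\<lambda>z. ?S *\<^sub>R D z)"
    unfolding functional_def by (intro tendsto_add tendsto_diff \<sigma>[OF fin\<^sub>0 sets\<^sub>0] \<sigma>[OF fin\<^sub>1 sets\<^sub>1])
  then have "functional (\<lambda>z. ?S *\<^sub>R \<phi> z) (\<lambda>z. ?S *\<^sub>R D z) = 0"
    unfolding zero using LIMSEQ_unique[OF tendsto_const] by metis
  moreover have "functional (\<lambda>z. ?S *\<^sub>R \<phi> z) (\<lambda>z. ?S *\<^sub>R D z) = ?S * functional \<phi> D"
    unfolding functional_def by (simp add: algebra_simps)
  ultimately show ?thesis by simp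
qed

section \<open>The transport problem\<close>

text \<open>All powers of 2 pi are put on this side, so that \<open>K\<close> is recovered from it
  without prefactor. It is a positive multiple of \<open>fourier K\<close>, hence has the same
  support and the same finite moments.\<close>

definition fourier_density :: "('a::euclidean_space \<Rightarrow> real) \<Rightarrow> 'a \<Rightarrow> complex" where
  "fourier_density K \<zeta> = of_real (1 / (2 * pi) ^ DIM('a)) * (\<integral>\<xi>. iexp (- (\<zeta> \<bullet> \<xi>)) * of_real (K \<xi>) \<partial>lborel)"

lemma fourier_eq_density:
  "fourier K \<zeta> = of_real ((2 * pi) powr (- real DIM('a) / 2) * (2 * pi) ^ DIM('a)) * fourier_density K (\<zeta>::'a::euclidean_space)"
  by (simp add: fourier_def fourier_density_def)

lemma continuous_fourier_density:
  assumes K: "integrable lborel K"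
  shows "continuous_on UNIV (fourier_density K)"
  unfolding fourier_density_def[abs_def] continuous_on_eq_continuous_at[OF open_UNIV]
proof (intro ballI isCont_mult continuous_const)
  fix \<zeta> :: 'a
  have [measurable]: "K \<in> borel_measurable borel" using K by auto
  show "isCont (\<lambda>\<zeta>. \<integral>\<xi>. iexp (- (\<zeta> \<bullet> \<xi>)) * of_real (K \<xi>) \<partial>lborel) \<zeta>"
    by (rule isCont_integral_dominated[where a=\<zeta> and r=1 and w="\<lambda>\<xi>. \<bar>K \<xi>\<bar>"])
      (use K in \<open>auto intro!: continuous_intros simp: norm_mult\<close>)
qed

lemma norm_fourier_density_le:
  assumes K: "integrable lborel K"
  shows "norm (fourier_density K (\<zeta>::'a::euclidean_space)) \<le> 1 / (2 * pi) ^ DIM('a) * (\<integral>\<xi>. \<bar>K \<xi>\<bar> \<partial>lborel)"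
proof -
  have [measurable]: "K \<in> borel_measurable borel" using K by auto
  have "norm (\<integral>\<xi>. iexp (- (\<zeta> \<bullet> \<xi>)) * of_real (K \<xi>) \<partial>lborel) \<le> (\<integral>\<xi>. \<bar>K \<xi>\<bar> \<partial>lborel)"
    by (rule norm_integral_le) (use K in \<open>auto simp: norm_mult\<close>)
  then show ?thesis
    unfolding fourier_density_def norm_mult norm_of_real by (intro mult_mono) auto
qed

lemma support_fourier_density: "support (fourier_density K) = support (fourier (K :: 'a::euclidean_space \<Rightarrow> real))"
  by (simp add: support_def fourier_eq_density)

text \<open>The moment condition makes the transform of \<open>K\<close> integrable, and boundedness
  of \<open>K\<close> supplies the growth hypothesis, so \<open>fourier_inversion\<close> recovers
  \<open>K\<close> at every point.\<close>

lemma fourier_kernel_fourier_density: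
  fixes K :: "'a::euclidean_space \<Rightarrow> real"
  assumes cont: "continuous_on UNIV K" and int: "integrable lborel K" and bound: "\<And>z. \<bar>K z\<bar> \<le> B"
    and A2: "integrable lborel (\<lambda>z. (1 + (norm z)\<^sup>2) *\<^sub>R fourier K z)"
  shows "fourier_kernel (fourier_density K) K"
proof
  let ?c = "(2 * pi) powr (- real DIM('a) / 2) * (2 * pi) ^ DIM('a)"
  have c: "?c > 0" by simp
  have "fourier_density K \<zeta> = (1 / ?c) *\<^sub>R fourier K \<zeta>" for \<zeta>
    unfolding fourier_eq_density scaleR_conv_of_real using c by (simp flip: of_real_mult)
  then have "integrable lborel (\<lambda>\<zeta>. (1 + (norm \<zeta>)\<^sup>2) *\<^sub>R fourier_density K \<zeta>)
      = integrable lborel (\<lambda>\<zeta>. (1 / ?c) *\<^sub>R ((1 + (norm \<zeta>)\<^sup>2) *\<^sub>R fourier K \<zeta>))"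
    by (simp add: mult.commute)
  then show i: "integrable lborel (\<lambda>\<zeta>. (1 + (norm \<zeta>)\<^sup>2) *\<^sub>R fourier_density K \<zeta>)"
    by (simp only:) (intro integrable_scaleR_right A2)
  fix z
  let ?F = "\<lambda>z. \<integral>\<xi>. iexp (- (z \<bullet> \<xi>)) * of_real (K \<xi>) \<partial>lborel"
  have [measurable]: "fourier_density K \<in> borel_measurable borel"
    by (intro borel_measurable_continuous_onI continuous_fourier_density int)
  have "integrable lborel (fourier_density K)"
    by (rule Bochner_Integration.integrable_bound[OF i]) (auto simp: mult_le_cancel_right1)
  then have "integrable lborel (\<lambda>\<zeta>. of_real ((2 * pi) ^ DIM('a)) * fourier_density K \<zeta>)" by (rule integrable_mult_right)
  then have "integrable lborel ?F" by (simp add: fourier_density_def)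
  then have "(\<integral>\<zeta>. iexp (\<zeta> \<bullet> z) * ?F \<zeta> \<partial>lborel) = of_real ((2 * pi) ^ DIM('a)) * of_real (K z)"
  proof (intro fourier_inversion[where C=B])
    show "norm (complex_of_real (K x)) \<le> B * (1 + norm x)" for x
      using order_trans[OF abs_ge_zero bound] unfolding norm_of_real by (intro order_trans[OF bound]) (simp add: distrib_left)
  qed (use cont int in \<open>auto intro!: continuous_intros\<close>)
  moreover have "(\<integral>\<zeta>. iexp (z \<bullet> \<zeta>) * fourier_density K \<zeta> \<partial>lborel)
      = of_real (1 / (2 * pi) ^ DIM('a)) * (\<integral>\<zeta>. iexp (\<zeta> \<bullet> z) * ?F \<zeta> \<partial>lborel)"
    unfolding fourier_density_def integral_mult_right_zero[symmetric]
    by (intro Bochner_Integration.integral_cong refl) (simp only: inner_commute mult_ac)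
  ultimately show "of_real (K z) = (\<integral>\<zeta>. iexp (z \<bullet> \<zeta>) * fourier_density K \<zeta> \<partial>lborel)" by simp
qed

text \<open>Averaging the Taylor inequalities at \<open>h\<close> and \<open>- h\<close> cancels the
  linear term, since \<open>K\<close> is even.\<close>

lemma (in fourier_kernel) K_zero_minus_le:
  assumes even: "\<And>z. K (- z) = K z"
  shows "K 0 - K h \<le> (norm h)\<^sup>2 * C"
  using taylor[of 0 h] taylor[of 0 "- h"] even[of h] by (simp add: abs_le_iff)

locale transport_problem =
  fixes T :: real and p :: "real \<times> (real^'d) \<Rightarrow> real" and K :: "real \<times> (real^'d) \<Rightarrow> real"
    and H :: "(real \<times> (real^'d) \<Rightarrow> real) set"
    and ip :: "(real \<times> (real^'d) \<Rightarrow> real) \<Rightarrow> (real \<times> (real^'d) \<Rightarrow> real) \<Rightarrow> real"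
  assumes T_pos: "T > 0"
    and rkhs: "is_rkhs (\<lambda>\<xi> \<eta>. K (\<xi> - \<eta>)) H ip"
    and A1_cont: "continuous_on UNIV K"
    and A1_int: "integrable lborel K"
    and A1_univ: "support (fourier K) = UNIV"
    and A2: "integrable lborel (\<lambda>z. (1 + (norm z)\<^sup>2) *\<^sub>R fourier K z)"
    and A3_meas: "p \<in> borel_measurable (restrict_space lborel ({0..T} \<times> UNIV))"
    and A3_cont: "\<forall>t\<in>{0..T}. integrable lborel (\<lambda>x. p (t, x)) \<and>
          ((\<lambda>s. LINT x|lborel. \<bar>p (s, x) - p (t, x)\<bar>) \<longlongrightarrow> 0) (at t within {0..T})"
    and A3_dens: "\<forall>t\<in>{0..T}. (AE x in lborel. 0 \<le> p (t, x)) \<and> (LINT x|lborel. p (t, x)) = 1"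
    and A3_weak: "weak_time_deriv_L1 T p"
begin

sublocale rkhs "\<lambda>\<xi> \<eta>. K (\<xi> - \<eta>)" H ip
  by (rule rkhs.intro) (rule rkhs)

lemma K_even: "K (- z) = K z"
  using ip_commute[OF kernel_mem[of z] kernel_mem[of 0]] unfolding reproducing[OF kernel_mem] by simp

lemma K_zero_nonneg: "K 0 \<ge> 0"
  using ip_nonneg[OF kernel_mem[of 0]] unfolding reproducing[OF kernel_mem] by simp

lemma abs_K_le_K_zero: "\<bar>K z\<bar> \<le> K 0"
proof -
  have "(K (0 - (- z)))\<^sup>2 \<le> (K 0)\<^sup>2"
    using eval_le[OF kernel_mem[of 0], of "- z"] unfolding reproducing[OF kernel_mem] by (simp add: power2_eq_square)
  then show ?thesis using K_zero_nonneg by (simp add: abs_le_square_iff[symmetric])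
qed

sublocale fourier_kernel "fourier_density K" K
  by (rule fourier_kernel_fourier_density[OF A1_cont A1_int abs_K_le_K_zero A2])

section \<open>The space-time measure, its time slices and the momentum\<close>

abbreviation S :: "(real \<times> (real^'d)) set" where "S \<equiv> {0..T} \<times> UNIV"

text \<open>Nothing is known of \<open>p\<close> outside the strip; multiplying by the indicator
  gives a Borel density on the whole space, where the Fourier integrals live.\<close>

definition P :: "real \<times> (real^'d) \<Rightarrow> real" where
  "P z = indicator S z * p z"

abbreviation M :: "(real \<times> (real^'d)) measure" where "M \<equiv> spacetime_measure T p"

text \<open>The state at time \<open>t\<close>, placed on the hyperplane of time \<open>t\<close>:
  the end terms of the continuity equation become integrals over space-time, as the locale
  \<open>flux\<close> expects.\<close>

definition slice :: "real \<Rightarrow> (real \<times> (real^'d)) measure" where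
  "slice t = distr (density lborel (\<lambda>x. ennreal (p (t, x)))) borel (Pair t)"

text \<open>Density and flux up to time \<open>t\<close> as one space-time vector field. Its inner
  product with the space-time gradient of a function is \<open>p\<close> times the transport
  operator.\<close>

definition momentum :: "(real \<times> (real^'d) \<Rightarrow> real^'d) \<Rightarrow> real \<Rightarrow> real \<times> (real^'d) \<Rightarrow> real \<times> (real^'d)" where
  "momentum u t z = indicator ({0..t} \<times> UNIV) z *\<^sub>R (P z, P z *\<^sub>R u z)"

lemma measurable_strip [measurable]: "{a..b::real} \<times> (UNIV :: (real^'d) set) \<in> sets borel"
  by (intro borel_closed closed_Times) auto

lemma S_measurable: "S \<inter> space lborel \<in> sets lborel" by simp

lemma measurable_P [measurable]: "P \<in> borel_measurable borel"
  using A3_meas unfolding borel_measurable_restrict_space_iff[OF S_measurable] P_def[abs_def] by simp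

lemma integrable_p: "t \<in> {0..T} \<Longrightarrow> integrable lborel (\<lambda>x. p (t, x))"
  and p_nonneg: "t \<in> {0..T} \<Longrightarrow> AE x in lborel. 0 \<le> p (t, x)"
  and integral_p: "t \<in> {0..T} \<Longrightarrow> (\<integral>x. p (t, x) \<partial>lborel) = 1"
  using A3_cont A3_dens by auto

lemma measurable_p [measurable]: "t \<in> {0..T} \<Longrightarrow> (\<lambda>x. p (t, x)) \<in> borel_measurable borel"
  using integrable_p by auto

lemma AE_lborel_prod:
  fixes Q :: "real \<times> (real^'d) \<Rightarrow> bool"
  assumes [measurable]: "Measurable.pred borel Q" and "AE t in lborel. AE x in lborel. Q (t, x)"
  shows "AE z in lborel. Q z"
proof -
  have "{z \<in> space (lborel \<Otimes>\<^sub>M lborel). Q z} \<in> sets (lborel \<Otimes>\<^sub>M lborel)"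
    unfolding lborel_prod by measurable
  from lborel_pair.AE_pair_measure[OF this assms(2)] show ?thesis by (simp only: lborel_prod)
qed

lemma P_nonneg: "AE z in lborel. 0 \<le> P z"
proof (rule AE_lborel_prod)
  show "AE t in lborel. AE x in lborel. 0 \<le> P (t, x)"
  proof (rule AE_I2)
    fix t
    show "AE x in lborel. 0 \<le> P (t, x)"
      using p_nonneg[of t] by (cases "t \<in> {0..T}") (auto simp: P_def)
  qed
qed measurable

lemma measurable_fst_borel [measurable]: "fst \<in> borel_measurable (borel :: (real \<times> (real^'d)) measure)"
  by (intro borel_measurable_continuous_onI continuous_intros)

text \<open>Null time hyperplanes are what makes the kinks at times 0 and \<open>T\<close>, and the
  choice between open and closed time intervals, harmless.\<close>

lemma AE_fst_neq: "AE z::real \<times> (real^'d) in lborel. fst z \<noteq> c"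
proof (rule AE_lborel_prod)
  show "AE t in lborel. AE x::real^'d in lborel. fst (t, x) \<noteq> c"
    using AE_lborel_singleton[of c] by eventually_elim simp
qed measurable

lemma integrable_P: "integrable lborel P"
proof (rule integrableI_nn_integral_finite)
  have "(\<integral>\<^sup>+z. ennreal (P z) \<partial>lborel) = (\<integral>\<^sup>+t. (\<integral>\<^sup>+x. ennreal (P (t, x)) \<partial>lborel) \<partial>lborel)"
    unfolding lborel_prod[symmetric] by (subst lborel.nn_integral_fst[symmetric]) (simp_all add: lborel_prod)
  also have "\<dots> = (\<integral>\<^sup>+t. indicator {0..T} t \<partial>lborel)"
  proof (rule nn_integral_cong)
    fix t
    show "(\<integral>\<^sup>+x. ennreal (P (t, x)) \<partial>lborel) = indicator {0..T} t"
    proof (cases "t \<in> {0..T}")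
      case True
      then have "(\<integral>\<^sup>+x. ennreal (P (t, x)) \<partial>lborel) = (\<integral>\<^sup>+x. ennreal (p (t, x)) \<partial>lborel)"
        by (simp add: P_def)
      also have "\<dots> = ennreal 1"
        unfolding integral_p[OF True, symmetric] by (intro nn_integral_eq_integral integrable_p p_nonneg True)
      finally show ?thesis using True by simp
    qed (simp add: P_def)
  qed
  also have "\<dots> = ennreal T" using T_pos by simp
  finally show "(\<integral>\<^sup>+z. ennreal (P z) \<partial>lborel) = ennreal T" .
qed (use P_nonneg in auto)

lemma sets_M [simp]: "sets M = sets (restrict_space lborel S)"
  and space_M [simp]: "space M = S"
  by (simp_all add: spacetime_measure_def space_restrict_space)

lemma measurable_M_iff:
  fixes f :: "real \<times> (real^'d) \<Rightarrow> 'b::{second_countable_topology, real_normed_vector}"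
  shows "f \<in> borel_measurable M \<longleftrightarrow> (\<lambda>z. indicator S z *\<^sub>R f z) \<in> borel_measurable borel"
proof -
  have "f \<in> borel_measurable M \<longleftrightarrow> f \<in> borel_measurable (restrict_space lborel S)"
    by (subst measurable_cong_sets[of M "restrict_space lborel S" borel borel]) auto
  then show ?thesis unfolding borel_measurable_restrict_space_iff[OF S_measurable] by simp
qed

lemma AE_restrict_nonneg: "AE z in restrict_space lborel S. 0 \<le> p z"
  using P_nonneg by (subst AE_restrict_space_iff) (auto simp: P_def elim!: eventually_mono)

text \<open>Moves integration from the strip to Lebesgue measure on the whole space; nonnegativity
  of \<open>p\<close> is available almost everywhere.\<close>

lemma
  fixes f :: "real \<times> (real^'d) \<Rightarrow> 'b::{banach, second_countable_topology}"
  assumes f: "f \<in> borel_measurable M"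
  shows integrable_M_iff: "integrable M f \<longleftrightarrow> integrable lborel (\<lambda>z. P z *\<^sub>R f z)"
    and integral_M_eq: "(\<integral>z. f z \<partial>M) = (\<integral>z. P z *\<^sub>R f z \<partial>lborel)"
proof -
  have f': "f \<in> borel_measurable (restrict_space lborel S)"
    using f by (subst (asm) measurable_cong_sets[of M "restrict_space lborel S"]) auto
  show "integrable M f \<longleftrightarrow> integrable lborel (\<lambda>z. P z *\<^sub>R f z)"
    unfolding spacetime_measure_def integrable_density[OF f' A3_meas AE_restrict_nonneg]
      integrable_restrict_space[OF S_measurable] by (simp add: P_def)
  show "(\<integral>z. f z \<partial>M) = (\<integral>z. P z *\<^sub>R f z \<partial>lborel)"
    unfolding spacetime_measure_def integral_density[OF f' A3_meas AE_restrict_nonneg]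
      integral_restrict_space[OF S_measurable] by (simp add: P_def)
qed

sublocale M: finite_measure M
proof
  have "integrable M (\<lambda>_. 1::real)"
    using integrable_P by (subst integrable_M_iff) auto
  then have "(\<integral>\<^sup>+z. ennreal (norm (1::real)) \<partial>M) < \<infinity>" unfolding integrable_iff_bounded by blast
  then show "emeasure M (space M) \<noteq> \<infinity>" by simp
qed

lemma integrable_momentum:
  assumes u: "integrable M u"
  shows "integrable lborel (momentum u t)"
proof -
  have um: "u \<in> borel_measurable M" using u by simp
  have i: "integrable lborel (\<lambda>z. P z *\<^sub>R u z)" using u unfolding integrable_M_iff[OF um] .
  have [measurable]: "(\<lambda>z. P z *\<^sub>R u z) \<in> borel_measurable borel" using i by auto
  show ?thesis
  proof (rule Bochner_Integration.integrable_bound)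
    show "integrable lborel (\<lambda>z. \<bar>P z\<bar> + norm (P z *\<^sub>R u z))"
      by (intro Bochner_Integration.integrable_add integrable_abs integrable_norm i integrable_P)
    have [measurable]: "(\<lambda>z. (P z, P z *\<^sub>R u z)) \<in> borel_measurable borel"
      by (rule borel_measurable_Pair[OF measurable_P]) fact
    show "momentum u t \<in> borel_measurable lborel" unfolding momentum_def[abs_def] by measurable
    show "AE z in lborel. norm (momentum u t z) \<le> norm (\<bar>P z\<bar> + norm (P z *\<^sub>R u z))"
    proof (rule AE_I2)
      fix z
      have "norm (P z, P z *\<^sub>R u z) \<le> norm (P z) + norm (P z *\<^sub>R u z)" by (rule norm_Pair_le)
      then show "norm (momentum u t z) \<le> norm (\<bar>P z\<bar> + norm (P z *\<^sub>R u z))"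
        by (simp add: momentum_def indicator_def)
    qed
  qed
qed

lemma sets_slice [simp]: "sets (slice t) = sets borel"
  by (simp add: slice_def)

lemma finite_slice: "t \<in> {0..T} \<Longrightarrow> finite_measure (slice t)"
proof -
  assume t: "t \<in> {0..T}"
  have "(\<integral>\<^sup>+x. ennreal (p (t, x)) \<partial>lborel) = ennreal 1"
    unfolding integral_p[OF t, symmetric] by (intro nn_integral_eq_integral integrable_p p_nonneg t)
  then have "finite_measure (density lborel (\<lambda>x. ennreal (p (t, x))))"
    using measurable_p[OF t] by (intro finite_measureI) (simp add: emeasure_density)
  then show ?thesis unfolding slice_def by (rule finite_measure.finite_measure_distr) simp
qed

lemma integral_slice:
  fixes f :: "real \<times> (real^'d) \<Rightarrow> real"
  assumes t: "t \<in> {0..T}" and [measurable]: "f \<in> borel_measurable borel"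
  shows "(\<integral>z. f z \<partial>slice t) = (\<integral>x. p (t, x) * f (t, x) \<partial>lborel)"
  unfolding slice_def using measurable_p[OF t] p_nonneg[OF t]
  by (subst integral_distr) (auto simp: integral_density)

lemma flux_momentum: "integrable M u \<Longrightarrow> t \<in> {0..T} \<Longrightarrow> flux (momentum u t) (slice 0) (slice t)"
  using T_pos by (intro flux.intro integrable_momentum finite_slice) auto

text \<open>A derivative within the strip restricts to lines. In time it is one-sided at the end
  points, but still unique because \<open>T > 0\<close>.\<close>

lemma transport_op_eq:
  assumes der: "(\<phi> has_derivative (\<lambda>h. D \<bullet> h)) (at z within S)" and z: "z \<in> S"
  shows "transport_op T u \<phi> z = fst D + u z \<bullet> snd D"
    and "time_deriv T \<phi> z = fst D" and "space_grad \<phi> z = snd D"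
proof -
  obtain t x where [simp]: "z = (t, x)" by (cases z)
  have t: "t \<in> {0..T}" using z by simp
  have "((\<lambda>s. \<phi> (s, x)) has_derivative (\<lambda>h. D \<bullet> (h, 0))) (at t within {0..T})"
    by (rule has_derivative_in_compose[of "\<lambda>s. (s, x)" "\<lambda>h. (h, 0)" t "{0..T}" \<phi> "\<lambda>h. D \<bullet> h"])
      (use der t in \<open>auto intro!: derivative_eq_intros elim!: has_derivative_subset\<close>)
  then have "((\<lambda>s. \<phi> (s, x)) has_vector_derivative fst D) (at t within {0..T})"
    by (simp add: has_vector_derivative_def inner_prod_def mult.commute)
  then show 1: "time_deriv T \<phi> z = fst D"
    using vector_derivative_within_cbox[of 0 T t] T_pos t by (simp add: time_deriv_def)
  have "deriv (\<lambda>h. \<phi> (t, x + h *\<^sub>R axis i 1)) 0 = snd D $ i" for i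
  proof (rule DERIV_imp_deriv)
    have "((\<lambda>h. \<phi> (t, x + h *\<^sub>R axis i 1)) has_derivative (\<lambda>h. D \<bullet> (0, h *\<^sub>R axis i 1))) (at 0)"
      by (rule has_derivative_in_compose[of "\<lambda>h. (t, x + h *\<^sub>R axis i 1)" "\<lambda>h. (0, h *\<^sub>R axis i 1)" 0 UNIV \<phi> "\<lambda>h. D \<bullet> h"])
        (use der t in \<open>auto intro!: derivative_eq_intros elim!: has_derivative_subset\<close>)
    then show "((\<lambda>h. \<phi> (t, x + h *\<^sub>R axis i 1)) has_field_derivative snd D $ i) (at 0)"
      by (simp add: has_field_derivative_def inner_prod_def inner_axis mult.commute[of _ "snd D $ i"])
  qed
  then show 2: "space_grad \<phi> z = snd D"
    by (simp add: space_grad_def vec_eq_iff)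
  show "transport_op T u \<phi> z = fst D + u z \<bullet> snd D" by (simp only: transport_op_def 1 2)
qed

lemma transport_integral_eq:
  assumes der: "\<And>z. z \<in> S \<Longrightarrow> (\<phi> has_derivative (\<lambda>h. D z \<bullet> h)) (at z within S)" and t: "t \<in> {0..T}"
  shows "(LINT z:{0..t} \<times> UNIV|lborel. transport_op T u \<phi> z * p z) = (\<integral>z. momentum u t z \<bullet> D z \<partial>lborel)"
  unfolding set_lebesgue_integral_def
proof (intro Bochner_Integration.integral_cong refl)
  fix z :: "real \<times> (real^'d)"
  show "indicator ({0..t} \<times> UNIV) z *\<^sub>R (transport_op T u \<phi> z * p z) = momentum u t z \<bullet> D z"
  proof (cases "z \<in> {0..t} \<times> UNIV")
    case True
    then have z: "z \<in> S" using t by (cases z) auto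
    show ?thesis using True z unfolding transport_op_eq(1)[OF der[OF z] z] momentum_def P_def
      by (simp add: inner_prod_def algebra_simps)
  qed (simp add: momentum_def inner_prod_def)
qed

lemma has_derivative_K_section: "((\<lambda>z. K (w - z)) has_derivative (\<lambda>h. - DK (w - z) \<bullet> h)) (at z within A)"
proof -
  have "((\<lambda>z. w - z) has_derivative (\<lambda>h. - h)) (at z within A)" by (auto intro!: derivative_eq_intros)
  from has_derivative_compose[OF this has_derivative_K] show ?thesis by simp
qed

text \<open>The bridge to the abstract part: from here on residuals are handled through
  \<open>flux\<close>, with kernel sections as test functions.\<close>

lemma residual_eq_functional:
  assumes u: "integrable M u" and t: "t \<in> {0..T}"
  shows "residual T p K u t w = flux.functional (momentum u t) (slice 0) (slice t) (\<lambda>z. K (w - z)) (\<lambda>z. - DK (w - z))"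
proof -
  interpret flux "momentum u t" "slice 0" "slice t" using u t by (rule flux_momentum)
  have "0 \<in> {0..T}" using T_pos by simp
  moreover have m: "(\<lambda>z. K (w - z)) \<in> borel_measurable borel" by measurable
  ultimately show ?thesis
    using transport_integral_eq[OF has_derivative_K_section[of w] t, of u]
    unfolding residual_def functional_def integral_slice[OF _ m] integral_slice[OF t m]
    by (simp add: integral_slice[OF _ m] mult.commute)
qed

end

section \<open>Residuals and the continuity equation\<close>

lemma (in flux) functional_lincomb:
  assumes [measurable]: "\<phi> \<in> borel_measurable borel" "D \<in> borel_measurable borel"
    "\<psi> \<in> borel_measurable borel" "E \<in> borel_measurable borel"
    and \<phi>: "\<And>z. \<bar>\<phi> z\<bar> \<le> B" "\<And>z. norm (D z) \<le> B" and \<psi>: "\<And>z. \<bar>\<psi> z\<bar> \<le> B'" "\<And>z. norm (E z) \<le> B'"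
  shows "functional (\<lambda>z. c * \<phi> z + \<psi> z) (\<lambda>z. c *\<^sub>R D z + E z) = c * functional \<phi> D + functional \<psi> E"
proof -
  have i: "integrable lborel (\<lambda>z. a z \<bullet> D z)" "integrable lborel (\<lambda>z. a z \<bullet> E z)"
    using integrable_inner[OF assms(2) \<phi>(2)] integrable_inner[OF assms(4) \<psi>(2)] by auto
  have 0: "integrable \<sigma>\<^sub>0 \<phi>" "integrable \<sigma>\<^sub>0 \<psi>"
    using \<phi> \<psi> by (auto intro!: fin\<^sub>0.integrable_bounded)
  have 1: "integrable \<sigma>\<^sub>1 \<phi>" "integrable \<sigma>\<^sub>1 \<psi>"
    using \<phi> \<psi> by (auto intro!: fin\<^sub>1.integrable_bounded)
  show ?thesis
    unfolding functional_def using i 0 1 by (simp add: inner_add_right algebra_simps)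
qed

text \<open>For T >= 0 this is the nearest-point map onto the strip, hence 1-Lipschitz; composing
  with it extends a test function constantly in time.\<close>

definition clamp_time :: "real \<Rightarrow> real \<times> 'a \<Rightarrow> real \<times> 'a" where
  "clamp_time T z = (max 0 (min T (fst z)), snd z)"

lemma continuous_clamp_time: "continuous_on A (clamp_time T :: real \<times> 'a::topological_space \<Rightarrow> _)"
  unfolding clamp_time_def by (intro continuous_intros)

lemma norm_clamp_time_diff_le:
  "norm (clamp_time T z - clamp_time T w) \<le> norm (z - w)" for z :: "real \<times> 'a::real_normed_vector"
proof -
  have "\<bar>max 0 (min T (fst z)) - max 0 (min T (fst w))\<bar> \<le> \<bar>fst z - fst w\<bar>"
    by (simp add: max_def min_def)
  then have "\<bar>max 0 (min T (fst z)) - max 0 (min T (fst w))\<bar>\<^sup>2 \<le> \<bar>fst z - fst w\<bar>\<^sup>2" by (intro power_mono) auto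
  then show ?thesis by (simp add: clamp_time_def norm_prod_def)
qed

context transport_problem
begin

lemma momentum_eq_zero: "fst z \<notin> {0..t} \<Longrightarrow> momentum u t z = 0"
  by (cases z) (auto simp: momentum_def zero_prod_def)

lemma clamp_time_in_S: "clamp_time T z \<in> S"
  using T_pos by (cases z) (auto simp: clamp_time_def)

lemma clamp_time_image: "clamp_time T ` A \<subseteq> S"
  by (intro image_subsetI clamp_time_in_S)

lemma clamp_time_id: "z \<in> S \<Longrightarrow> clamp_time T z = z"
  by (cases z) (auto simp: clamp_time_def)

section \<open>Residuals are elements of the RKHS and depend continuously on time\<close>

definition comb_grad :: "(real \<times> real \<times> (real^'d)) list \<Rightarrow> real \<times> (real^'d) \<Rightarrow> real \<times> (real^'d)" where
  "comb_grad xs z = (\<Sum>(c, w)\<leftarrow>xs. c *\<^sub>R - DK (w - z))"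

lemma comb_grad_simps [simp]:
  "comb_grad [] = (\<lambda>z. 0)"
  "comb_grad ((c, w) # xs) = (\<lambda>z. c *\<^sub>R - DK (w - z) + comb_grad xs z)"
  by (auto simp: comb_grad_def)

lemma measurable_comb [measurable]: "comb xs \<in> borel_measurable borel"
proof (induction xs)
  case (Cons a xs)
  then show ?case by (cases a) simp
qed simp

lemma measurable_comb_grad [measurable]: "comb_grad xs \<in> borel_measurable borel"
proof (induction xs)
  case (Cons a xs)
  note [measurable] = Cons
  show ?case by (cases a) (simp del: scaleR_minus_right)
qed simp

lemma has_derivative_comb: "(comb xs has_derivative (\<lambda>h. comb_grad xs z \<bullet> h)) (at z)"
proof (induction xs)
  case (Cons a xs)
  show ?case
    by (cases a) (auto intro!: derivative_eq_intros Cons has_derivative_K_section simp: inner_add_left inner_diff_left fun_eq_iff)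
qed simp

lemma abs_comb_le: "\<bar>comb xs z\<bar> \<le> sqrt (ip (comb xs) (comb xs)) * sqrt (K 0)"
proof -
  have "(comb xs z)\<^sup>2 \<le> ip (comb xs) (comb xs) * K 0"
    using eval_le[OF comb_mem, of xs z] by simp
  from real_sqrt_le_mono[OF this] show ?thesis by (simp add: real_sqrt_mult)
qed

text \<open>\<open>eval_diff_le\<close> bounds the difference quotients by the \<open>H\<close>
  norm: since K 0 - K h <= C |h|^2, two kernel sections at distance |h| have squared
  \<open>H\<close> distance at most 2 C |h|^2.\<close>

lemma norm_comb_grad_le: "norm (comb_grad xs z) \<le> sqrt (ip (comb xs) (comb xs)) * sqrt (2 * C)"
proof (rule norm_le_of_inner_le)
  fix v
  let ?B = "sqrt (ip (comb xs) (comb xs)) * sqrt (2 * C)"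
  define s where "s n = inverse (real (Suc n))" for n
  have s: "s \<longlonglongrightarrow> 0" "\<And>n. s n \<noteq> 0" "\<And>n. s n > 0"
    unfolding s_def using LIMSEQ_inverse_real_of_nat by auto
  have b: "\<bar>(comb xs (z + s n *\<^sub>R v) - comb xs z) / s n\<bar> \<le> ?B * norm v" for n
  proof -
    have "(comb xs (z + s n *\<^sub>R v) - comb xs z)\<^sup>2 \<le> ip (comb xs) (comb xs) * (K 0 - 2 * K (s n *\<^sub>R v) + K 0)"
      using eval_diff_le[OF comb_mem, of xs "z + s n *\<^sub>R v" z] by simp
    also have "\<dots> \<le> ip (comb xs) (comb xs) * (2 * C * (norm (s n *\<^sub>R v))\<^sup>2)"
      using K_zero_minus_le[OF K_even, of "s n *\<^sub>R v"]
      by (intro mult_left_mono ip_nonneg comb_mem) (simp add: algebra_simps)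
    finally have "sqrt ((comb xs (z + s n *\<^sub>R v) - comb xs z)\<^sup>2) \<le> sqrt (ip (comb xs) (comb xs) * (2 * C * (norm (s n *\<^sub>R v))\<^sup>2))"
      by (rule real_sqrt_le_mono)
    then have "\<bar>comb xs (z + s n *\<^sub>R v) - comb xs z\<bar> \<le> ?B * (s n * norm v)"
      using s(3)[of n] by (simp add: real_sqrt_mult mult.assoc)
    then show ?thesis using s(3)[of n] by (simp add: divide_le_eq mult_ac)
  qed
  show "\<bar>comb_grad xs z \<bullet> v\<bar> \<le> ?B * norm v"
    by (rule LIMSEQ_le_const2[OF tendsto_rabs[OF directional_derivative_LIMSEQ[OF has_derivative_comb s(1,2)]]])
      (use b in blast)
qed

text \<open>Pairing the residual with a combination gives the functional of that combination, which
  is bounded by the sup norms of the combination and its gradient, and these by its \<open>H\<close>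
  norm. Membership matters because \<open>ip\<close> carries information only on
  \<open>H\<close>.\<close>

lemma residual_mem:
  assumes u: "integrable M u" and t: "t \<in> {0..T}"
  shows "residual T p K u t \<in> H"
proof -
  interpret flux "momentum u t" "slice 0" "slice t" using u t by (rule flux_momentum)
  let ?N = "\<lambda>xs. sqrt (ip (comb xs) (comb xs))"
  let ?b = "sqrt (K 0) + sqrt (2 * C)"
  have b: "\<bar>comb xs z\<bar> \<le> ?N xs * ?b" "norm (comb_grad xs z) \<le> ?N xs * ?b" for xs z
    using abs_comb_le[of xs z] norm_comb_grad_le[of xs z] K_zero_nonneg C_nonneg ip_nonneg[OF comb_mem[of xs]]
    by (auto simp: distrib_left intro: order_trans)
  have eq: "pairing (residual T p K u t) xs = functional (comb xs) (comb_grad xs)" for xs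
  proof (induction xs)
    case Nil
    show ?case by (simp add: functional_def)
  next
    case (Cons a xs)
    obtain c w where [simp]: "a = (c, w)" by (cases a)
    have "functional (\<lambda>z. c * K (w - z) + comb xs z) (\<lambda>z. c *\<^sub>R - DK (w - z) + comb_grad xs z)
        = c * functional (\<lambda>z. K (w - z)) (\<lambda>z. - DK (w - z)) + functional (comb xs) (comb_grad xs)"
      by (rule functional_lincomb[where B=C and B'="?N xs * ?b"])
        (auto intro: abs_K_le norm_DK_le simp: b measurable_comb measurable_comb_grad)
    then show ?case using Cons residual_eq_functional[OF u t, of w] by simp
  qed
  show ?thesis
  proof (rule mem_of_functional_bound)
    fix xs
    show "\<bar>pairing (residual T p K u t) xs\<bar> \<le> (mass * ?b) * ?N xs"
      unfolding eq using abs_functional_le[OF measurable_comb measurable_comb_grad b] by (simp add: mult_ac)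
  qed
qed

text \<open>The time cut-off in the momentum is handled by dominated convergence, the terminal state
  by continuity of \<open>p\<close> in L^1 together with the Lipschitz bound for
  \<open>K\<close>.\<close>

lemma residual_continuous:
  assumes u: "integrable M u"
  shows "continuous_on {0..T} (\<lambda>t. residual T p K u t w)"
proof -
  have 0: "0 \<in> {0..T}" using T_pos by simp
  have m: "(\<lambda>z. K (w - z)) \<in> borel_measurable borel" by measurable
  have eq: "residual T p K u t w = (\<integral>z. momentum u t z \<bullet> - DK (w - z) \<partial>lborel)
      + (\<integral>y. p (0, y) * K (w - (0, y)) \<partial>lborel) - (\<integral>y. p (t, y) * K (w - (t, y)) \<partial>lborel)" if t: "t \<in> {0..T}" for t
    unfolding residual_eq_functional[OF u t] flux.functional_def[OF flux_momentum[OF u t]] integral_slice[OF 0 m] integral_slice[OF t m] ..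
  have i: "integrable lborel (\<lambda>z. P z *\<^sub>R u z)" using u integrable_M_iff[of u] by auto
  have "continuous_on {0..T} (\<lambda>t. \<integral>z. momentum u t z \<bullet> - DK (w - z) \<partial>lborel)"
    unfolding continuous_on_sequentially comp_def
  proof (intro allI ballI impI)
    fix X t assume t: "t \<in> {0..T}" and X: "(\<forall>n. X n \<in> {0..T}) \<and> X \<longlonglongrightarrow> t"
    show "(\<lambda>n. \<integral>z. momentum u (X n) z \<bullet> - DK (w - z) \<partial>lborel) \<longlonglongrightarrow> (\<integral>z. momentum u t z \<bullet> - DK (w - z) \<partial>lborel)"
    proof (rule integral_dominated_convergence[where w="\<lambda>z. (\<bar>P z\<bar> + norm (P z *\<^sub>R u z)) * C"])
      show "integrable lborel (\<lambda>z. (\<bar>P z\<bar> + norm (P z *\<^sub>R u z)) * C)"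
        by (intro integrable_mult_left Bochner_Integration.integrable_add integrable_abs integrable_norm i integrable_P)
      have [measurable]: "momentum u t \<in> borel_measurable borel" for t using integrable_momentum[OF u] by auto
      show "(\<lambda>z. momentum u t z \<bullet> - DK (w - z)) \<in> borel_measurable lborel"
        "(\<lambda>z. momentum u (X n) z \<bullet> - DK (w - z)) \<in> borel_measurable lborel" for n by measurable
      show "AE z in lborel. (\<lambda>n. momentum u (X n) z \<bullet> - DK (w - z)) \<longlonglongrightarrow> momentum u t z \<bullet> - DK (w - z)"
        using AE_fst_neq[of t]
      proof eventually_elim
        case (elim z)
        \<comment> \<open>Off the hyperplane of time \<open>t\<close> the cut-off indicators are
          eventually constant.\<close>
        have "\<forall>\<^sub>F n in sequentially. momentum u (X n) z = momentum u t z"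
        proof (cases "fst z < t")
          case True
          then have "\<forall>\<^sub>F n in sequentially. fst z < X n" using X by (intro order_tendstoD) auto
          then show ?thesis by eventually_elim (use True in \<open>cases z, auto simp: momentum_def indicator_def\<close>)
        next
          case False
          then have "\<forall>\<^sub>F n in sequentially. X n < fst z" using X elim by (intro order_tendstoD) auto
          then show ?thesis by eventually_elim (use False elim in \<open>cases z, auto simp: momentum_def indicator_def\<close>)
        qed
        then have "(\<lambda>n. momentum u (X n) z) \<longlonglongrightarrow> momentum u t z" by (rule tendsto_eventually)
        then show ?case by (intro tendsto_intros)
      qed
      show "AE z in lborel. norm (momentum u (X n) z \<bullet> - DK (w - z)) \<le> (\<bar>P z\<bar> + norm (P z *\<^sub>R u z)) * C" for n
      proof (rule AE_I2)
        fix z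
        have "norm (P z, P z *\<^sub>R u z) \<le> norm (P z) + norm (P z *\<^sub>R u z)" by (rule norm_Pair_le)
        then have "norm (momentum u (X n) z) \<le> \<bar>P z\<bar> + norm (P z *\<^sub>R u z)"
          by (simp add: momentum_def indicator_def)
        then have "norm (momentum u (X n) z) * norm (- DK (w - z)) \<le> (\<bar>P z\<bar> + norm (P z *\<^sub>R u z)) * C"
          using norm_DK_le by (intro mult_mono) auto
        then show "norm (momentum u (X n) z \<bullet> - DK (w - z)) \<le> (\<bar>P z\<bar> + norm (P z *\<^sub>R u z)) * C"
          using Cauchy_Schwarz_ineq2[of "momentum u (X n) z" "- DK (w - z)"] by simp
      qed
    qed
  qed
  moreover have "continuous_on {0..T} (\<lambda>t. \<integral>y. p (t, y) * K (w - (t, y)) \<partial>lborel)"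
    unfolding continuous_on_def
  proof
    fix t assume t: "t \<in> {0..T}"
    have K1: "integrable lborel (\<lambda>y. p (s, y) * K (w - (r, y)))" if s: "s \<in> {0..T}" for s r
    proof (rule Bochner_Integration.integrable_bound)
      show "integrable lborel (\<lambda>y. K 0 * p (s, y))" using integrable_p[OF s] by simp
      have [measurable]: "(\<lambda>y. p (s, y)) \<in> borel_measurable borel" using s by (rule measurable_p)
      have [measurable]: "(\<lambda>y. K (w - (r, y))) \<in> borel_measurable borel"
        by (intro borel_measurable_continuous_onI continuous_intros continuous_on_compose2[OF continuous_K[of UNIV]]) auto
      show "(\<lambda>y. p (s, y) * K (w - (r, y))) \<in> borel_measurable lborel" by measurable
      show "AE y in lborel. norm (p (s, y) * K (w - (r, y))) \<le> norm (K 0 * p (s, y))"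
        by (auto simp: abs_mult abs_of_nonneg[OF K_zero_nonneg] mult.commute[of "K 0"]
            intro!: AE_I2 mult_left_mono abs_K_le_K_zero)
    qed
    have "((\<lambda>s. (\<integral>y. p (s, y) * K (w - (s, y)) \<partial>lborel) - (\<integral>y. p (t, y) * K (w - (t, y)) \<partial>lborel)) \<longlongrightarrow> 0) (at t within {0..T})"
    proof (rule Lim_null_comparison)
      have "((\<lambda>s. K 0 * (\<integral>y. \<bar>p (s, y) - p (t, y)\<bar> \<partial>lborel) + C * \<bar>s - t\<bar>) \<longlongrightarrow> K 0 * 0 + C * \<bar>t - t\<bar>) (at t within {0..T})"
        using A3_cont t by (intro tendsto_intros) auto
      then show "((\<lambda>s. K 0 * (\<integral>y. \<bar>p (s, y) - p (t, y)\<bar> \<partial>lborel) + C * \<bar>s - t\<bar>) \<longlongrightarrow> 0) (at t within {0..T})" by simp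
      show "\<forall>\<^sub>F s in at t within {0..T}. norm ((\<integral>y. p (s, y) * K (w - (s, y)) \<partial>lborel) - (\<integral>y. p (t, y) * K (w - (t, y)) \<partial>lborel))
          \<le> K 0 * (\<integral>y. \<bar>p (s, y) - p (t, y)\<bar> \<partial>lborel) + C * \<bar>s - t\<bar>"
        unfolding eventually_at_filter
      proof (intro always_eventually allI impI)
        fix s assume s: "s \<in> {0..T}"
        have "norm ((\<integral>y. p (s, y) * K (w - (s, y)) \<partial>lborel) - (\<integral>y. p (t, y) * K (w - (t, y)) \<partial>lborel))
            = norm (\<integral>y. p (s, y) * K (w - (s, y)) - p (t, y) * K (w - (t, y)) \<partial>lborel)"
          by (simp only: Bochner_Integration.integral_diff[OF K1[OF s] K1[OF t]])
        also have "\<dots> \<le> (\<integral>y. norm (p (s, y) * K (w - (s, y)) - p (t, y) * K (w - (t, y))) \<partial>lborel)"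
          by (rule integral_norm_bound)
        also have "\<dots> \<le> (\<integral>y. K 0 * \<bar>p (s, y) - p (t, y)\<bar> + (C * \<bar>s - t\<bar>) * p (t, y) \<partial>lborel)"
        proof (rule integral_mono_AE)
          show "AE y in lborel. norm (p (s, y) * K (w - (s, y)) - p (t, y) * K (w - (t, y))) \<le> K 0 * \<bar>p (s, y) - p (t, y)\<bar> + (C * \<bar>s - t\<bar>) * p (t, y)"
            using p_nonneg[OF t]
          proof eventually_elim
            case (elim y)
            \<comment> \<open>The change of density is weighted by \<open>K 0\<close>; the change of
              time slice is weighted by the Lipschitz constant \<open>C\<close> and by the total
              mass 1 of the density at time \<open>t\<close>.\<close>
            have "p (s, y) * K (w - (s, y)) - p (t, y) * K (w - (t, y)) =
                (p (s, y) - p (t, y)) * K (w - (s, y)) + p (t, y) * (K (w - (s, y)) - K (w - (t, y)))"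
              by (simp add: algebra_simps)
            also have "\<bar>\<dots>\<bar> \<le> \<bar>p (s, y) - p (t, y)\<bar> * \<bar>K (w - (s, y))\<bar> + \<bar>p (t, y)\<bar> * \<bar>K (w - (s, y)) - K (w - (t, y))\<bar>"
              unfolding abs_mult[symmetric] by (rule abs_triangle_ineq)
            also have "\<dots> \<le> \<bar>p (s, y) - p (t, y)\<bar> * K 0 + \<bar>p (t, y)\<bar> * (\<bar>s - t\<bar> * C)"
            proof (intro add_mono mult_left_mono abs_K_le_K_zero)
              have "norm ((w - (s, y)) - (w - (t, y))) = \<bar>s - t\<bar>" by (simp add: norm_prod_def)
              then show "\<bar>K (w - (s, y)) - K (w - (t, y))\<bar> \<le> \<bar>s - t\<bar> * C"
                using K_lipschitz[of "w - (s, y)" "w - (t, y)"] by simp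
            qed auto
            finally show ?case using elim by (simp add: mult_ac)
          qed
        qed (intro integrable_norm integrable_abs Bochner_Integration.integrable_diff Bochner_Integration.integrable_add
            integrable_mult_right K1 integrable_p s t)+
        also have "\<dots> = K 0 * (\<integral>y. \<bar>p (s, y) - p (t, y)\<bar> \<partial>lborel) + C * \<bar>s - t\<bar>"
          using s t by (simp add: integrable_p integral_p)
        finally show "norm ((\<integral>y. p (s, y) * K (w - (s, y)) \<partial>lborel) - (\<integral>y. p (t, y) * K (w - (t, y)) \<partial>lborel))
          \<le> K 0 * (\<integral>y. \<bar>p (s, y) - p (t, y)\<bar> \<partial>lborel) + C * \<bar>s - t\<bar>" .
      qed
    qed
    then show "((\<lambda>s. \<integral>y. p (s, y) * K (w - (s, y)) \<partial>lborel) \<longlongrightarrow> (\<integral>y. p (t, y) * K (w - (t, y)) \<partial>lborel)) (at t within {0..T})"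
      by (rule LIM_zero_cancel)
  qed
  ultimately have "continuous_on {0..T} (\<lambda>t. (\<integral>z. momentum u t z \<bullet> - DK (w - z) \<partial>lborel)
      + (\<integral>y. p (0, y) * K (w - (0, y)) \<partial>lborel) - (\<integral>y. p (t, y) * K (w - (t, y)) \<partial>lborel))"
    by (intro continuous_intros)
  then show ?thesis by (rule continuous_on_cong[THEN iffD1, rotated 2]) (auto simp: eq)
qed

text \<open>Both end states cancel in the difference, which leaves \<open>p\<close> times u - v,
  paired with a gradient bounded by \<open>C\<close>.\<close>

lemma residual_diff_le:
  assumes u: "integrable M u" and v: "integrable M v" and t: "t \<in> {0..T}"
  shows "\<bar>residual T p K u t w - residual T p K v t w\<bar> \<le> (\<integral>z. norm (u z - v z) \<partial>M) * C"
proof -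
  have [measurable]: "momentum u t \<in> borel_measurable borel" "momentum v t \<in> borel_measurable borel"
    using integrable_momentum[OF u] integrable_momentum[OF v] by auto
  have i: "integrable lborel (\<lambda>z. momentum u t z \<bullet> - DK (w - z))" "integrable lborel (\<lambda>z. momentum v t z \<bullet> - DK (w - z))"
    by (auto intro!: flux.integrable_inner[OF flux_momentum[OF u t], where B=C]
        flux.integrable_inner[OF flux_momentum[OF v t], where B=C] norm_DK_le simp del: inner_minus_right)
  have i': "integrable M (\<lambda>z. norm (u z - v z))" using u v by simp
  then have i'': "integrable lborel (\<lambda>z. P z *\<^sub>R norm (u z - v z))"
    using integrable_M_iff[OF borel_measurable_integrable[OF i']] by simp
  have "\<bar>residual T p K u t w - residual T p K v t w\<bar> = \<bar>\<integral>z. (momentum u t z - momentum v t z) \<bullet> - DK (w - z) \<partial>lborel\<bar>"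
    unfolding residual_eq_functional[OF u t] residual_eq_functional[OF v t]
      flux.functional_def[OF flux_momentum[OF u t]] flux.functional_def[OF flux_momentum[OF v t]]
    using i by (simp add: inner_diff_left)
  also have "\<dots> \<le> (\<integral>z. \<bar>(momentum u t z - momentum v t z) \<bullet> - DK (w - z)\<bar> \<partial>lborel)"
    by (rule integral_abs_bound)
  also have "\<dots> \<le> (\<integral>z. (P z *\<^sub>R norm (u z - v z)) * C \<partial>lborel)"
  proof (rule integral_mono_AE)
    show "integrable lborel (\<lambda>z. \<bar>(momentum u t z - momentum v t z) \<bullet> - DK (w - z)\<bar>)"
      unfolding inner_diff_left using i by (intro integrable_abs Bochner_Integration.integrable_diff)
    show "integrable lborel (\<lambda>z. (P z *\<^sub>R norm (u z - v z)) * C)" using i'' by (rule integrable_mult_left)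
    show "AE z in lborel. \<bar>(momentum u t z - momentum v t z) \<bullet> - DK (w - z)\<bar> \<le> (P z *\<^sub>R norm (u z - v z)) * C"
      using P_nonneg
    proof eventually_elim
      case (elim z)
      have "norm (momentum u t z - momentum v t z) \<le> P z *\<^sub>R norm (u z - v z)"
        using elim by (simp add: momentum_def indicator_def norm_Pair flip: scaleR_diff_right)
      then have "norm (momentum u t z - momentum v t z) * norm (- DK (w - z)) \<le> (P z *\<^sub>R norm (u z - v z)) * C"
        using norm_DK_le elim by (intro mult_mono) auto
      then show ?case using Cauchy_Schwarz_ineq2 by (rule order_trans[rotated])
    qed
  qed
  also have "\<dots> = (\<integral>z. norm (u z - v z) \<partial>M) * C"
    unfolding integral_M_eq[OF borel_measurable_integrable[OF i']] by simp
  finally show ?thesis .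
qed

section \<open>Vanishing residuals and the continuity equation\<close>

lemma K_section_C1_bounded: "(\<lambda>z. K (w - z)) \<in> C1_bounded T"
  unfolding C1_bounded_def
proof (intro CollectI conjI exI[of _ "\<lambda>z. - DK (w - z)"] ballI has_derivative_K_section)
  show "bounded ((\<lambda>z. K (w - z)) ` S)"
    by (intro boundedI[where B=C]) (auto simp: abs_K_le)
  show "bounded ((\<lambda>z. - DK (w - z)) ` S)"
    by (intro boundedI[where B=C]) (auto simp: norm_DK_le)
  show "continuous_on S (\<lambda>z. - DK (w - z))"
    by (intro continuous_intros continuous_on_compose2[OF continuous_DK[of UNIV]]) auto
qed

text \<open>Kernel sections are themselves admissible test functions in the continuity
  equation.\<close>

lemma residual_U0:
  assumes u: "u \<in> class_U0 T p" and t: "t \<in> {0..T}"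
  shows "residual T p K u t = (\<lambda>w. 0)"
proof
  fix w
  have *: "\<forall>\<phi>\<in>C1_bounded T. \<forall>t\<in>{0..T}.
      (LINT x|lborel. \<phi> (t, x) * p (t, x)) - (LINT x|lborel. \<phi> (0, x) * p (0, x)) =
      (LINT z:{0..t} \<times> UNIV|lborel. transport_op T u \<phi> z * p z)"
    using u by (simp add: class_U0_def)
  from bspec[OF bspec[OF * K_section_C1_bounded[of w]] t] show "residual T p K u t w = 0"
    by (simp add: residual_def mult.commute)
qed

text \<open>Converse of \<open>residual_U0\<close> at a single time. The symbol vanishes, so
  \<open>functional_eq_zero\<close> applies once \<phi>, controlled only on the strip, is extended
  by clamping time; the extension is Lipschitz, and its gradient can jump only at times 0 and
  \<open>T\<close>.\<close>

lemma continuity_equation: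
  assumes u: "integrable M u" and t: "t \<in> {0..T}" and zero: "residual T p K u t = (\<lambda>w. 0)"
    and \<phi>: "\<phi> \<in> C1_bounded T"
  shows "(LINT x|lborel. \<phi> (t, x) * p (t, x)) - (LINT x|lborel. \<phi> (0, x) * p (0, x)) =
        (LINT z:{0..t} \<times> UNIV|lborel. transport_op T u \<phi> z * p z)"
proof -
  interpret flux_kernel "momentum u t" "slice 0" "slice t" "fourier_density K" K
    by (intro flux_kernel.intro flux_momentum u t fourier_kernel_axioms)
  have symbol: "symbol \<zeta> = 0" for \<zeta>
  proof (rule symbol_eq_zero)
    show "functional (\<lambda>z. K (w - z)) (\<lambda>z. - DK (w - z)) = 0" for w
      using residual_eq_functional[OF u t, of w] zero by simp
  qed (use A1_int A1_univ in \<open>auto intro: continuous_fourier_density norm_fourier_density_le simp: support_fourier_density\<close>)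
  obtain D where D: "\<And>z. z \<in> S \<Longrightarrow> (\<phi> has_derivative (\<lambda>h. D z \<bullet> h)) (at z within S)"
    and cont_D: "continuous_on S D" and "bounded (D ` S)" and "bounded (\<phi> ` S)"
    using \<phi> unfolding C1_bounded_def by blast
  obtain B1 where B1: "\<forall>x\<in>D ` S. norm x \<le> B1" using \<open>bounded (D ` S)\<close> unfolding bounded_iff by blast
  obtain B2 where B2: "\<forall>x\<in>\<phi> ` S. norm x \<le> B2" using \<open>bounded (\<phi> ` S)\<close> unfolding bounded_iff by blast
  define B where "B = max B1 B2"
  have B: "norm (D z) \<le> B" "\<bar>\<phi> z\<bar> \<le> B" if "z \<in> S" for z
    using bspec[OF B1 imageI[OF that]] bspec[OF B2 imageI[OF that]] by (auto simp: B_def)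
  have B0: "B \<ge> 0" using order_trans[OF norm_ge_zero B(1)[OF clamp_time_in_S]] .
  let ?c = "clamp_time T :: real \<times> (real^'d) \<Rightarrow> _"
  define \<psi> where "\<psi> z = \<phi> (?c z)" for z
  \<comment> \<open>Before time 0 and after time \<open>T\<close> the extension is constant in time,
    so the time component of its gradient is switched off; the spatial component is that of the
    nearest end slice.\<close>
  define E where "E z = (indicator {0<..<T} (fst z) * fst (D (?c z)), snd (D (?c z)))" for z
  have cont_Dc: "continuous_on UNIV (\<lambda>z. D (?c z))"
    by (rule continuous_on_compose2[OF cont_D continuous_clamp_time clamp_time_image])
  have cont_\<phi>: "continuous_on S \<phi>"
    unfolding continuous_on_eq_continuous_within by (intro ballI has_derivative_continuous[OF D])
  have cont_\<psi>: "continuous_on UNIV \<psi>" unfolding \<psi>_def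
    by (rule continuous_on_compose2[OF cont_\<phi> continuous_clamp_time clamp_time_image])
  then have m_\<psi>: "\<psi> \<in> borel_measurable borel" by (rule borel_measurable_continuous_onI)
  have [measurable]: "(\<lambda>z. D (?c z)) \<in> borel_measurable borel" using cont_Dc by (rule borel_measurable_continuous_onI)
  have m_E[measurable]: "E \<in> borel_measurable borel"
  proof -
    have "(\<lambda>z. fst (D (?c z))) \<in> borel_measurable borel" "(\<lambda>z. snd (D (?c z))) \<in> borel_measurable borel"
      using cont_Dc by (auto intro!: borel_measurable_continuous_onI continuous_intros)
    note [measurable] = this
    have "(\<lambda>z. indicator {0<..<T} (fst z) * fst (D (?c z))) \<in> borel_measurable borel" by measurable
    then show ?thesis unfolding E_def[abs_def]
      by (rule borel_measurable_Pair) measurable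
  qed
  have "functional \<psi> E = 0"
  proof (rule functional_eq_zero[OF symbol cont_\<psi> m_E])
    show "\<bar>\<psi> w\<bar> \<le> B" for w unfolding \<psi>_def by (rule B(2)[OF clamp_time_in_S])
    show "norm (E w) \<le> B" for w
    proof -
      have "norm (E w) \<le> norm (D (?c w))"
        unfolding E_def norm_prod_def by (intro real_sqrt_le_mono add_mono power_mono) (auto simp: indicator_def)
      then show ?thesis using B(1)[OF clamp_time_in_S[of w]] by simp
    qed
    show "\<bar>\<psi> w - \<psi> w'\<bar> \<le> B * norm (w - w')" for w w'
    proof -
      have "norm (\<phi> (?c w) - \<phi> (?c w')) \<le> B * norm (?c w - ?c w')"
      proof (rule differentiable_bound[OF _ D])
        show "convex S" by (intro convex_Times) auto
        show "onorm (\<lambda>h. D x \<bullet> h) \<le> B" if "x \<in> S" for x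
        proof (rule onorm_le)
          fix h show "norm (D x \<bullet> h) \<le> B * norm h"
            using Cauchy_Schwarz_ineq2[of "D x" h] mult_right_mono[OF B(1)[OF that] norm_ge_zero[of h]] by simp
        qed
      qed (assumption | rule clamp_time_in_S)+
      also have "\<dots> \<le> B * norm (w - w')" by (intro mult_left_mono norm_clamp_time_diff_le B0)
      finally show ?thesis by (simp add: \<psi>_def)
    qed
    show "AE w in lborel. (\<psi> has_derivative (\<lambda>h. E w \<bullet> h)) (at w)"
      using AE_fst_neq[of 0] AE_fst_neq[of T]
    proof eventually_elim
      case (elim w)
      have comp: "(\<psi> has_derivative (\<lambda>h. D (?c w) \<bullet> g h)) (at w)"
        if "(?c has_derivative g) (at w)" for g
        unfolding \<psi>_def by (rule has_derivative_in_compose2[OF D clamp_time_image UNIV_I that])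
      \<comment> \<open>Covers an open set on which clamping replaces the time by a constant
        \<open>r\<close>; used before time 0 and after time \<open>T\<close>.\<close>
      have out: "(\<psi> has_derivative (\<lambda>h. E w \<bullet> h)) (at w)" if "w \<in> V" "open V" "fst w \<notin> {0<..<T}" "\<And>z. z \<in> V \<Longrightarrow> ?c z = (r, snd z)" for V r
      proof -
        have "((\<lambda>z. (r, snd z)) has_derivative (\<lambda>h. (0, snd h))) (at w)" by (auto intro!: derivative_eq_intros)
        then have "(?c has_derivative (\<lambda>h. (0, snd h))) (at w)"
          by (rule has_derivative_transform_within_open[of _ _ _ _ V]) (use that in auto)
        from comp[OF this] show ?thesis using that(3) by (simp add: E_def inner_prod_def)
      qed
      consider "fst w < 0" | "fst w > T" | "0 < fst w" "fst w < T"
        using elim by (meson linorder_neqE_linordered_idom)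
      then show ?case
      proof cases
        case 1
        show ?thesis by (rule out[of "{..<0} \<times> UNIV" 0]) (use 1 T_pos in \<open>cases w, auto simp: clamp_time_def open_Times\<close>)
      next
        case 2
        show ?thesis by (rule out[of "{T<..} \<times> UNIV" T]) (use 2 T_pos in \<open>cases w, auto simp: clamp_time_def open_Times\<close>)
      next
        case 3
        have "((\<lambda>z. z) has_derivative (\<lambda>h. h)) (at w)" by (auto intro!: derivative_eq_intros)
        then have "(?c has_derivative (\<lambda>h. h)) (at w)"
          by (rule has_derivative_transform_within_open[of _ _ _ _ "{0<..<T} \<times> UNIV"])
            (use 3 in \<open>auto simp: clamp_time_def open_Times mem_Times_iff\<close>)
        from comp[OF this] show ?thesis using 3 by (cases w) (simp add: E_def inner_prod_def)
      qed
    qed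
    \<comment> \<open>The momentum lives on times in [0,t], so off the two hyperplanes only points
      of the open strip remain, and near such a point \<open>E\<close> agrees with a continuous
      function.\<close>
    show "AE w in lborel. momentum u t w \<noteq> 0 \<longrightarrow> isCont E w"
      using AE_fst_neq[of 0] AE_fst_neq[of T]
    proof eventually_elim
      case (elim w)
      show ?case
      proof
        assume "momentum u t w \<noteq> 0"
        then have "fst w \<in> {0..t}" using momentum_eq_zero by blast
        then have w: "w \<in> {0<..<T} \<times> UNIV" using elim t by (auto simp: mem_Times_iff)
        have "isCont (\<lambda>z. D (?c z)) w" using cont_Dc by (simp add: continuous_on_eq_continuous_at del: split_paired_All)
        moreover have "\<forall>\<^sub>F z in nhds w. E z = D (?c z)"
        proof -
          have "open ({0<..<T} \<times> (UNIV :: (real^'d) set))" by (intro open_Times) auto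
          from eventually_nhds_in_open[OF this w] show ?thesis by eventually_elim (auto simp: E_def)
        qed
        ultimately show "isCont E w" by (subst isCont_cong)
      qed
    qed
  qed
  moreover have "(\<integral>z. momentum u t z \<bullet> E z \<partial>lborel) = (\<integral>z. momentum u t z \<bullet> D (?c z) \<partial>lborel)"
  proof (rule integral_cong_AE)
    show "AE z in lborel. momentum u t z \<bullet> E z = momentum u t z \<bullet> D (?c z)"
      using AE_fst_neq[of 0] AE_fst_neq[of T]
    proof eventually_elim
      case (elim z)
      show ?case
      proof (cases "momentum u t z = 0")
        case False
        then have "fst z \<in> {0..t}" using momentum_eq_zero by blast
        then have "fst z \<in> {0<..<T}" using elim t by auto
        then show ?thesis by (simp add: E_def)
      qed simp
    qed
  qed measurable
  moreover have "(\<integral>z. momentum u t z \<bullet> D (?c z) \<partial>lborel) = (\<integral>z. momentum u t z \<bullet> D z \<partial>lborel)"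
  proof (rule Bochner_Integration.integral_cong[OF refl])
    fix z
    show "momentum u t z \<bullet> D (?c z) = momentum u t z \<bullet> D z"
    proof (cases "z \<in> S")
      case False
      then have "momentum u t z = 0" by (simp add: momentum_def P_def zero_prod_def)
      then show ?thesis by simp
    qed (simp add: clamp_time_id)
  qed
  moreover have "(\<integral>z. \<psi> z \<partial>slice s) = (\<integral>x. \<phi> (s, x) * p (s, x) \<partial>lborel)" if s: "s \<in> {0..T}" for s
    unfolding integral_slice[OF s m_\<psi>] using s by (simp add: \<psi>_def clamp_time_id mult.commute)
  ultimately show ?thesis
    using T_pos t transport_integral_eq[of \<phi> D t u, OF D t] unfolding functional_def by simp
qed

section \<open>Test functions and the weak divergence of admissible fields\<close>

lemma test_functions_gradient:
  fixes \<phi> :: "'a::euclidean_space \<Rightarrow> real"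
  assumes "\<phi> \<in> test_functions \<Omega>"
  obtains D B where "\<And>z. (\<phi> has_derivative (\<lambda>h. D z \<bullet> h)) (at z)" "continuous_on UNIV D"
    "\<And>z. \<bar>\<phi> z\<bar> \<le> B" "\<And>z. norm (D z) \<le> B" "\<And>z. z \<notin> \<Omega> \<Longrightarrow> \<phi> z = 0"
proof -
  have "C_k (Suc 0) \<phi>" and comp: "compact (support \<phi>)" and sub: "support \<phi> \<subseteq> \<Omega>"
    using assms unfolding test_functions_def by blast+
  then have diff: "\<And>x. \<phi> differentiable (at x)"
    and cont: "\<And>b. b \<in> Basis \<Longrightarrow> continuous_on UNIV (\<lambda>x. frechet_derivative \<phi> (at x) b)" by auto
  define D where "D z = (\<Sum>b\<in>Basis. frechet_derivative \<phi> (at z) b *\<^sub>R b)" for z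
  have der: "(\<phi> has_derivative (\<lambda>h. D z \<bullet> h)) (at z)" for z
  proof -
    have f: "(\<phi> has_derivative frechet_derivative \<phi> (at z)) (at z)"
      using diff frechet_derivative_works by blast
    interpret linear "frechet_derivative \<phi> (at z)" using f by (rule has_derivative_linear)
    have "frechet_derivative \<phi> (at z) h = D z \<bullet> h" for h
    proof -
      have "frechet_derivative \<phi> (at z) h = frechet_derivative \<phi> (at z) (\<Sum>b\<in>Basis. (h \<bullet> b) *\<^sub>R b)"
        by (simp add: euclidean_representation)
      also have "\<dots> = D z \<bullet> h" unfolding sum scale D_def inner_sum_left inner_scaleR_left
        by (intro sum.cong refl) (simp add: inner_commute)
      finally show ?thesis .
    qed
    then show ?thesis using f by presburger
  qed
  have cont_D: "continuous_on UNIV D" unfolding D_def[abs_def] by (intro continuous_intros cont)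
  have cont_\<phi>: "continuous_on UNIV \<phi>"
    unfolding continuous_on_eq_continuous_within by (intro ballI has_derivative_continuous[OF der])
  have supp: "\<phi> z = 0" if "z \<notin> support \<phi>" for z
    using that closure_subset[of "{z. \<phi> z \<noteq> 0}"] unfolding support_def by auto
  have supp_D: "D z = 0" if "z \<notin> support \<phi>" for z
  proof -
    have "((\<lambda>z. 0) has_derivative (\<lambda>h. 0)) (at z)" by simp
    moreover have "open (- support \<phi>)" by (simp add: support_def open_Compl)
    ultimately have "(\<phi> has_derivative (\<lambda>h. 0)) (at z)"
      by (rule has_derivative_transform_within_open) (use that in \<open>simp_all add: supp\<close>)
    from has_derivative_unique[OF der this] have "D z \<bullet> D z = 0" by metis
    then show ?thesis by simp
  qed
  have "bounded (\<phi> ` support \<phi>)" "bounded (D ` support \<phi>)"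
    using comp cont_\<phi> cont_D by (auto intro!: compact_imp_bounded compact_continuous_image continuous_on_subset[of UNIV])
  note bdd = this[unfolded bounded_iff]
  from bdd(1) obtain B1 where B1: "\<forall>x\<in>\<phi> ` support \<phi>. norm x \<le> B1" by (rule exE)
  from bdd(2) obtain B2 where B2: "\<forall>x\<in>D ` support \<phi>. norm x \<le> B2" by (rule exE)
  show ?thesis
  proof (rule that[of D "max 0 (max B1 B2)"])
    show "\<bar>\<phi> z\<bar> \<le> max 0 (max B1 B2)" for z
      using bspec[OF B1 imageI, of z] supp[of z] by (cases "z \<in> support \<phi>") (simp_all add: le_max_iff_disj)
    show "norm (D z) \<le> max 0 (max B1 B2)" for z
      using bspec[OF B2 imageI, of z] supp_D[of z] by (cases "z \<in> support \<phi>") (simp_all add: le_max_iff_disj)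
  qed (use der cont_D supp sub in auto)
qed

text \<open>The two end slices are null, and nothing outside the closed strip contributes.\<close>

lemma open_strip_integral:
  fixes f :: "real \<times> (real^'d) \<Rightarrow> real"
  assumes [measurable]: "f \<in> borel_measurable borel" and f: "\<And>z. z \<notin> S \<Longrightarrow> f z = 0"
    and g: "\<And>z. z \<in> S \<Longrightarrow> g z = f z"
  shows "(LINT z:{0<..<T} \<times> UNIV|lborel. g z) = (\<integral>z. f z \<partial>lborel)"
proof -
  have "open ({0<..<T} \<times> (UNIV :: (real^'d) set))" by (intro open_Times) auto
  then have [measurable]: "{0<..<T} \<times> (UNIV :: (real^'d) set) \<in> sets borel" by (rule borel_open)
  have "(LINT z:{0<..<T} \<times> UNIV|lborel. g z) = (\<integral>z. indicator ({0<..<T} \<times> UNIV) z *\<^sub>R f z \<partial>lborel)"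
    unfolding set_lebesgue_integral_def
    by (intro Bochner_Integration.integral_cong refl) (auto simp: indicator_def g)
  also have "\<dots> = (\<integral>z. f z \<partial>lborel)"
  proof (rule integral_cong_AE)
    show "AE z in lborel. indicator ({0<..<T} \<times> UNIV) z *\<^sub>R f z = f z"
      using AE_fst_neq[of 0] AE_fst_neq[of T]
    proof eventually_elim
      case (elim z)
      show ?case
      proof (cases "z \<in> S")
        case True
        then have "z \<in> {0<..<T} \<times> UNIV" using elim by (cases z) auto
        then show ?thesis by simp
      qed (simp add: f)
    qed
  qed measurable
  finally show ?thesis .
qed

text \<open>For \<phi> with support in the open strip both end terms vanish, so the time-derivative
  term and the flux term add up to 0. Hence the weak divergence of p u is minus the weak time
  derivative of \<open>p\<close>, which is integrable by (A3).\<close>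

lemma weak_div_of_continuity_equation:
  assumes u: "integrable M u"
    and eq: "\<And>\<phi>. \<phi> \<in> C1_bounded T \<Longrightarrow>
        (LINT x|lborel. \<phi> (T, x) * p (T, x)) - (LINT x|lborel. \<phi> (0, x) * p (0, x)) =
        (LINT z:{0..T} \<times> UNIV|lborel. transport_op T u \<phi> z * p z)"
  shows "weak_div_L1 T (\<lambda>z. p z *\<^sub>R u z)"
proof -
  obtain g where g: "set_integrable lborel ({0<..<T} \<times> UNIV) g"
    and wd: "\<And>\<phi>. \<phi> \<in> test_functions ({0<..<T} \<times> UNIV) \<Longrightarrow>
           (LINT z:{0<..<T} \<times> UNIV|lborel. p z * time_deriv T \<phi> z) =
           - (LINT z:{0<..<T} \<times> UNIV|lborel. g z * \<phi> z)"
    using A3_weak unfolding weak_time_deriv_L1_def by blast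
  have i: "integrable lborel (\<lambda>z. P z *\<^sub>R u z)" using u integrable_M_iff[of u] by auto
  have [measurable]: "(\<lambda>z. P z *\<^sub>R u z) \<in> borel_measurable borel" using i by auto
  show ?thesis
    unfolding weak_div_L1_def
  proof (intro exI[of _ "\<lambda>z. - g z"] conjI ballI)
    show "set_integrable lborel ({0<..<T} \<times> UNIV) (\<lambda>z. - g z)"
      using g unfolding set_integrable_def by simp
    fix \<phi> assume \<phi>: "\<phi> \<in> test_functions ({0<..<T} \<times> (UNIV :: (real^'d) set))"
    then obtain D B where D: "\<And>z. (\<phi> has_derivative (\<lambda>h. D z \<bullet> h)) (at z)" "continuous_on UNIV D"
      "\<And>z. \<bar>\<phi> z\<bar> \<le> B" "\<And>z. norm (D z) \<le> B" and zero: "\<And>z. z \<notin> {0<..<T} \<times> UNIV \<Longrightarrow> \<phi> z = 0"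
      by (rule test_functions_gradient) (rule that)
    have [measurable]: "(\<lambda>z. fst (D z)) \<in> borel_measurable borel" "(\<lambda>z. snd (D z)) \<in> borel_measurable borel"
      using D(2) by (auto intro!: borel_measurable_continuous_onI continuous_intros)
    have C1: "\<phi> \<in> C1_bounded T"
      unfolding C1_bounded_def
    proof (intro CollectI conjI exI[of _ D] ballI has_derivative_at_withinI[OF D(1)])
      show "bounded (\<phi> ` S)" "bounded (D ` S)" using D by (auto intro!: boundedI[where B=B])
      show "continuous_on S D" using D(2) by (rule continuous_on_subset) simp
    qed
    note top = transport_op_eq[OF has_derivative_at_withinI[OF D(1)]]
    have "0 = (\<integral>z. momentum u T z \<bullet> D z \<partial>lborel)"
      using eq[OF C1] transport_integral_eq[of \<phi> D T u, OF has_derivative_at_withinI[OF D(1)]] T_pos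
      by (simp add: zero)
    also have "\<dots> = (\<integral>z. P z * fst (D z) + (P z *\<^sub>R u z) \<bullet> snd (D z) \<partial>lborel)"
      by (intro Bochner_Integration.integral_cong refl) (simp add: momentum_def indicator_def P_def inner_prod_def)
    also have "\<dots> = (\<integral>z. P z * fst (D z) \<partial>lborel) + (\<integral>z. (P z *\<^sub>R u z) \<bullet> snd (D z) \<partial>lborel)"
    proof (rule Bochner_Integration.integral_add)
      have fs: "\<bar>fst (D z)\<bar> \<le> B" "norm (snd (D z)) \<le> B" for z
        using norm_fst_le[of "fst (D z)" "snd (D z)"] norm_snd_le[of "snd (D z)" "fst (D z)"] D(4)[of z] by simp_all
      show "integrable lborel (\<lambda>z. P z * fst (D z))"
        by (rule Bochner_Integration.integrable_bound[OF integrable_mult_left[OF integrable_abs[OF integrable_P], of B]])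
          (auto simp: abs_mult intro!: AE_I2 mult_left_mono order_trans[OF fs(1) abs_ge_self])
      show "integrable lborel (\<lambda>z. (P z *\<^sub>R u z) \<bullet> snd (D z))"
      proof (rule Bochner_Integration.integrable_bound[OF integrable_mult_left[OF integrable_norm[OF i], of B]])
        show "AE z in lborel. norm ((P z *\<^sub>R u z) \<bullet> snd (D z)) \<le> norm (norm (P z *\<^sub>R u z) * B)"
          unfolding real_norm_def
          by (intro AE_I2 order_trans[OF Cauchy_Schwarz_ineq2 order_trans[OF mult_left_mono[OF fs(2) norm_ge_zero] abs_ge_self]])
      qed measurable
    qed
    also have "(\<integral>z. P z * fst (D z) \<partial>lborel) = (LINT z:{0<..<T} \<times> UNIV|lborel. p z * time_deriv T \<phi> z)"
    proof (rule open_strip_integral[symmetric])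
      show "(\<lambda>z. P z * fst (D z)) \<in> borel_measurable borel" by measurable
    qed (auto simp: P_def top simp del: mem_Times_iff)
    also have "(\<integral>z. (P z *\<^sub>R u z) \<bullet> snd (D z) \<partial>lborel) = (LINT z:{0<..<T} \<times> UNIV|lborel. (p z *\<^sub>R u z) \<bullet> space_grad \<phi> z)"
    proof (rule open_strip_integral[symmetric])
      show "(\<lambda>z. (P z *\<^sub>R u z) \<bullet> snd (D z)) \<in> borel_measurable borel" by measurable
    qed (auto simp: P_def top simp del: mem_Times_iff)
    finally have "(LINT z:{0<..<T} \<times> UNIV|lborel. (p z *\<^sub>R u z) \<bullet> space_grad \<phi> z) = (LINT z:{0<..<T} \<times> UNIV|lborel. g z * \<phi> z)"
      using wd[OF \<phi>] by simp
    then show "(LINT z:{0<..<T} \<times> UNIV|lborel. (p z *\<^sub>R u z) \<bullet> space_grad \<phi> z) = - (LINT z:{0<..<T} \<times> UNIV|lborel. - g z * \<phi> z)"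
      by (simp add: set_lebesgue_integral_def)
  qed
qed

text \<open>With \<open>residual_U0\<close> this characterises \<open>class_U0\<close> by
  integrability and vanishing residuals; midpoints and limits can then be treated through residuals
  alone.\<close>

lemma U0_of_residual:
  assumes u: "integrable M u" and zero: "\<And>t. t \<in> {0..T} \<Longrightarrow> residual T p K u t = (\<lambda>w. 0)"
  shows "u \<in> class_U0 T p"
  unfolding class_U0_def class_U_def
proof (intro CollectI conjI ballI u)
  show "weak_div_L1 T (\<lambda>z. p z *\<^sub>R u z)"
    using T_pos by (intro weak_div_of_continuity_equation[OF u] continuity_equation[OF u _ zero]) auto
qed (rule continuity_equation[OF u _ zero])

end

section \<open>Convexity of the penalised cost\<close>

lemma (in finite_measure) L1_le_L2:
  fixes h :: "'a \<Rightarrow> 'b::{banach, second_countable_topology}"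
  assumes h[measurable]: "h \<in> borel_measurable M" and d: "d > 0" and c: "c \<ge> 0"
    and le: "(\<integral>\<^sup>+x. ennreal ((norm (h x))\<^sup>2) \<partial>M) \<le> ennreal c"
  shows "integrable M h" and "(\<integral>x. norm (h x) \<partial>M) \<le> d / 2 * measure M (space M) + c / (2 * d)"
proof -
  have sq: "integrable M (\<lambda>x. (norm (h x))\<^sup>2)"
    by (rule integrableI_bounded) (use le in \<open>auto intro: le_less_trans\<close>)
  have i: "integrable M (\<lambda>x. d / 2 + (norm (h x))\<^sup>2 / (2 * d))" using sq by simp
  \<comment> \<open>Young's inequality with a free parameter replaces Cauchy-Schwarz, so no root of
    an integral has to be taken.\<close>
  have young: "norm (h x) \<le> d / 2 + (norm (h x))\<^sup>2 / (2 * d)" for x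
    using zero_le_power2[of "norm (h x) - d"] d by (simp add: power2_eq_square field_simps)
  show int: "integrable M h"
    by (rule Bochner_Integration.integrable_bound[OF i h]) (auto intro!: AE_I2 order_trans[OF young abs_ge_self])
  have "ennreal (\<integral>x. (norm (h x))\<^sup>2 \<partial>M) \<le> ennreal c"
    using le nn_integral_eq_integral[OF sq] by simp
  then have "(\<integral>x. (norm (h x))\<^sup>2 \<partial>M) \<le> c" using c by (simp add: ennreal_le_iff)
  then have "(\<integral>x. (norm (h x))\<^sup>2 \<partial>M) / (2 * d) \<le> c / (2 * d)" using d by (intro divide_right_mono) auto
  moreover have "(\<integral>x. norm (h x) \<partial>M) \<le> (\<integral>x. d / 2 + (norm (h x))\<^sup>2 / (2 * d) \<partial>M)"
    by (intro integral_mono integrable_norm int i young)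
  ultimately show "(\<integral>x. norm (h x) \<partial>M) \<le> d / 2 * measure M (space M) + c / (2 * d)"
    using sq by (simp add: mult.commute)
qed

lemma (in finite_measure) L1_small_of_L2_small:
  assumes e: "e > 0"
  obtains c where "c > 0" "\<And>h :: 'a \<Rightarrow> 'b::{banach, second_countable_topology}. h \<in> borel_measurable M \<Longrightarrow>
      (\<integral>\<^sup>+x. ennreal ((norm (h x))\<^sup>2) \<partial>M) \<le> ennreal c \<Longrightarrow> (\<integral>x. norm (h x) \<partial>M) < e"
proof
  define m where "m = measure M (space M) + 1"
  \<comment> \<open>With threshold \<open>d * e\<close> the bound of \<open>L1_le_L2\<close> becomes
    e/4 - d/2 + e/2, which is below \<open>e\<close>.\<close>
  define d where "d = e / (2 * m)"
  have m: "m > 0" by (simp add: m_def add_nonneg_pos)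
  have d: "d > 0" using e m by (simp add: d_def)
  show "d * e > 0" using d e by simp
  fix h :: "'a \<Rightarrow> 'b" assume h: "h \<in> borel_measurable M" and le: "(\<integral>\<^sup>+x. ennreal ((norm (h x))\<^sup>2) \<partial>M) \<le> ennreal (d * e)"
  have "(\<integral>x. norm (h x) \<partial>M) \<le> d / 2 * measure M (space M) + (d * e) / (2 * d)"
    by (rule L1_le_L2(2)[OF h d _ le]) (use d e in simp)
  also have "\<dots> = d * m / 2 - d / 2 + e / 2" using d by (simp add: m_def algebra_simps add_divide_distrib)
  also have "d * m = e / 2" using m by (simp add: d_def)
  finally show "(\<integral>x. norm (h x) \<partial>M) < e" using d e by simp
qed

lemma (in finite_measure) L1_tendsto_of_L2:
  fixes h :: "nat \<Rightarrow> 'a \<Rightarrow> 'b::{banach, second_countable_topology}"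
  assumes h: "\<And>n. h n \<in> borel_measurable M"
    and lim: "(\<lambda>n. \<integral>\<^sup>+x. ennreal ((norm (h n x))\<^sup>2) \<partial>M) \<longlonglongrightarrow> 0"
  shows "(\<lambda>n. \<integral>x. norm (h n x) \<partial>M) \<longlonglongrightarrow> 0"
proof (rule order_tendstoI)
  fix e :: real assume e: "0 < e"
  obtain c where c: "c > 0" and small: "\<And>h :: 'a \<Rightarrow> 'b. h \<in> borel_measurable M \<Longrightarrow>
      (\<integral>\<^sup>+x. ennreal ((norm (h x))\<^sup>2) \<partial>M) \<le> ennreal c \<Longrightarrow> (\<integral>x. norm (h x) \<partial>M) < e"
    using L1_small_of_L2_small[OF e] by metis
  have "\<forall>\<^sub>F n in sequentially. (\<integral>\<^sup>+x. ennreal ((norm (h n x))\<^sup>2) \<partial>M) < ennreal c"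
    using lim c by (intro order_tendstoD) auto
  then show "\<forall>\<^sub>F n in sequentially. (\<integral>x. norm (h n x) \<partial>M) < e"
    by eventually_elim (intro small h less_imp_le)
next
  fix e :: real assume "e < 0"
  then show "\<forall>\<^sub>F n in sequentially. e < (\<integral>x. norm (h n x) \<partial>M)"
    by (intro always_eventually allI less_le_trans[OF _ Bochner_Integration.integral_nonneg]) auto
qed

text \<open>The \<open>f n\<close> are merely integrable; only their differences have controlled
  square integrals. A subsequence converges almost everywhere, and Fatou's lemma applied to f n - f
  (r k) turns the Cauchy bound into convergence in mean square.\<close>

lemma (in finite_measure) L2_complete:
  fixes f :: "nat \<Rightarrow> 'a \<Rightarrow> 'b::{banach, second_countable_topology}"
  assumes f: "\<And>n. integrable M (f n)"
    and cauchy: "\<And>e. e > 0 \<Longrightarrow> \<exists>N. \<forall>i\<ge>N. \<forall>j\<ge>N. (\<integral>\<^sup>+x. ennreal ((norm (f i x - f j x))\<^sup>2) \<partial>M) \<le> ennreal e"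
  obtains g where "g \<in> borel_measurable M" "(\<lambda>n. \<integral>\<^sup>+x. ennreal ((norm (f n x - g x))\<^sup>2) \<partial>M) \<longlonglongrightarrow> 0"
proof -
  have fm[measurable]: "f n \<in> borel_measurable M" for n using f by auto
  have "\<exists>N. \<forall>i\<ge>N. \<forall>j\<ge>N. (\<integral>x. norm (f i x - f j x) \<partial>M) < e" if e: "e > 0" for e
  proof -
    obtain c where c: "c > 0" and small: "\<And>h :: 'a \<Rightarrow> 'b. h \<in> borel_measurable M \<Longrightarrow>
        (\<integral>\<^sup>+x. ennreal ((norm (h x))\<^sup>2) \<partial>M) \<le> ennreal c \<Longrightarrow> (\<integral>x. norm (h x) \<partial>M) < e"
      using L1_small_of_L2_small[OF e] by metis
    obtain N where "\<forall>i\<ge>N. \<forall>j\<ge>N. (\<integral>\<^sup>+x. ennreal ((norm (f i x - f j x))\<^sup>2) \<partial>M) \<le> ennreal c"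
      using cauchy[OF c] by blast
    then show ?thesis by (intro exI[of _ N] allI impI small) auto
  qed
  from cauchy_L1_AE_cauchy_subseq[OF f this]
  obtain r where r: "strict_mono r" and ae: "AE x in M. Cauchy (\<lambda>i. f (r i) x)" by blast
  define g where "g x = lim (\<lambda>i. f (r i) x)" for x
  have g[measurable]: "g \<in> borel_measurable M" unfolding g_def[abs_def] by measurable
  have lim: "AE x in M. (\<lambda>i. f (r i) x) \<longlonglongrightarrow> g x"
    using ae by eventually_elim (simp add: g_def Cauchy_convergent_iff convergent_LIMSEQ_iff)
  have fatou: "(\<integral>\<^sup>+x. ennreal ((norm (f n x - g x))\<^sup>2) \<partial>M) \<le> e"
    if N: "\<forall>i\<ge>N. \<forall>j\<ge>N. (\<integral>\<^sup>+x. ennreal ((norm (f i x - f j x))\<^sup>2) \<partial>M) \<le> e" and n: "n \<ge> N" for n N e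
  proof -
    have "(\<integral>\<^sup>+x. ennreal ((norm (f n x - g x))\<^sup>2) \<partial>M)
        = (\<integral>\<^sup>+x. liminf (\<lambda>k. ennreal ((norm (f n x - f (r k) x))\<^sup>2)) \<partial>M)"
    proof (rule nn_integral_cong_AE)
      show "AE x in M. ennreal ((norm (f n x - g x))\<^sup>2) = liminf (\<lambda>k. ennreal ((norm (f n x - f (r k) x))\<^sup>2))"
        using lim
      proof eventually_elim
        case (elim x)
        have "(\<lambda>k. ennreal ((norm (f n x - f (r k) x))\<^sup>2)) \<longlonglongrightarrow> ennreal ((norm (f n x - g x))\<^sup>2)"
          by (intro tendsto_intros elim)
        then show ?case using lim_imp_Liminf[OF sequentially_bot] by metis
      qed
    qed
    also have "\<dots> \<le> liminf (\<lambda>k. \<integral>\<^sup>+x. ennreal ((norm (f n x - f (r k) x))\<^sup>2) \<partial>M)"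
      by (rule nn_integral_liminf) measurable
    also have "\<dots> \<le> limsup (\<lambda>k. \<integral>\<^sup>+x. ennreal ((norm (f n x - f (r k) x))\<^sup>2) \<partial>M)"
      by (rule Liminf_le_Limsup) simp
    also have "\<dots> \<le> e"
    proof (rule Limsup_bounded)
      show "\<forall>\<^sub>F k in sequentially. (\<integral>\<^sup>+x. ennreal ((norm (f n x - f (r k) x))\<^sup>2) \<partial>M) \<le> e"
        using eventually_ge_at_top[of N]
      proof eventually_elim
        case (elim k)
        then have "r k \<ge> N" using seq_suble[OF r, of k] by simp
        then show ?case using N n by blast
      qed
    qed
    finally show ?thesis .
  qed
  have "(\<lambda>n. \<integral>\<^sup>+x. ennreal ((norm (f n x - g x))\<^sup>2) \<partial>M) \<longlonglongrightarrow> 0"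
  proof (rule tendsto_zero_ennreal)
    fix e :: real assume e: "0 < e"
    obtain N where N: "\<forall>i\<ge>N. \<forall>j\<ge>N. (\<integral>\<^sup>+x. ennreal ((norm (f i x - f j x))\<^sup>2) \<partial>M) \<le> ennreal (e / 2)"
      using cauchy[of "e / 2"] e by auto
    have "(\<integral>\<^sup>+x. ennreal ((norm (f n x - g x))\<^sup>2) \<partial>M) < ennreal e" if "n \<ge> N" for n
      by (rule le_less_trans[OF fatou[OF N that]]) (use e in \<open>simp add: ennreal_less_iff\<close>)
    then show "\<forall>\<^sub>F n in sequentially. (\<integral>\<^sup>+x. ennreal ((norm (f n x - g x))\<^sup>2) \<partial>M) < ennreal e"
      unfolding eventually_sequentially by blast
  qed
  with g show ?thesis by (rule that)
qed

text \<open>The square of \<open>f\<close> is continuous and nonnegative with integral 0, hence 0 at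
  every point.\<close>

lemma continuous_AE_zero:
  fixes f :: "real \<Rightarrow> real"
  assumes ab: "a < b" and cont: "continuous_on {a..b} f" and ae: "AE t in lborel. t \<in> {a..b} \<longrightarrow> f t = 0" and t: "t \<in> {a..b}"
  shows "f t = 0"
proof -
  from AE_E[OF ae] obtain N where N: "{t \<in> space lborel. \<not> (t \<in> {a..b} \<longrightarrow> f t = 0)} \<subseteq> N"
    "emeasure lborel N = 0" "N \<in> sets lborel" by blast
  then have "N \<in> null_sets lborel" by blast
  then have "negligible N" using null_sets_completionI negligible_iff_null_sets by blast
  then have "((\<lambda>t. (f t)\<^sup>2) has_integral 0) (cbox a b)"
    by (rule has_integral_negligible) (use N(1) in auto)
  then have "(f t)\<^sup>2 = 0"
    using ab cont t by (intro has_integral_0_cbox_imp_0[of a b "\<lambda>t. (f t)\<^sup>2"]) (auto intro!: continuous_intros)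
  then show ?thesis by simp
qed

section \<open>Energy, residual and penalty at midpoints; closedness of the constraint\<close>

context transport_problem
begin

abbreviation midpoint_field :: "(real \<times> (real^'d) \<Rightarrow> real^'d) \<Rightarrow> (real \<times> (real^'d) \<Rightarrow> real^'d) \<Rightarrow> real \<times> (real^'d) \<Rightarrow> real^'d"
  where "midpoint_field u v \<equiv> \<lambda>z. (1/2) *\<^sub>R (u z + v z)"

lemma integrable_U: "u \<in> class_U T p \<Longrightarrow> integrable M u"
  by (simp add: class_U_def)

lemma U0_subset_U: "class_U0 T p \<subseteq> class_U T p"
  by (auto simp: class_U0_def)

text \<open>With the difference term added on the left, no subtraction occurs, and the identity
  holds in the extended nonnegative reals even for infinite energies.\<close>

lemma parallelogram:
  fixes u v :: "real \<times> (real^'d) \<Rightarrow> real^'d"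
  assumes [measurable]: "u \<in> borel_measurable M" "v \<in> borel_measurable M"
  shows "energy T p (midpoint_field u v) + ennreal (1/4) * energy T p (\<lambda>z. u z - v z)
    = ennreal (1/2) * energy T p u + ennreal (1/2) * energy T p v"
proof -
  have "energy T p (midpoint_field u v) + ennreal (1/4) * energy T p (\<lambda>z. u z - v z)
    = (\<integral>\<^sup>+z. ennreal ((norm ((1/2) *\<^sub>R (u z + v z)))\<^sup>2) + ennreal (1/4) * ennreal ((norm (u z - v z))\<^sup>2) \<partial>M)"
    unfolding energy_def by (subst nn_integral_add) (auto simp: nn_integral_cmult)
  also have "\<dots> = (\<integral>\<^sup>+z. ennreal (1/2) * ennreal ((norm (u z))\<^sup>2) + ennreal (1/2) * ennreal ((norm (v z))\<^sup>2) \<partial>M)"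
  proof (rule nn_integral_cong)
    fix z
    have "(norm ((1/2) *\<^sub>R (u z + v z)))\<^sup>2 + 1/4 * (norm (u z - v z))\<^sup>2 = 1/2 * (norm (u z))\<^sup>2 + 1/2 * (norm (v z))\<^sup>2"
      unfolding power2_norm_eq_inner by (simp add: inner_add_left inner_add_right inner_diff_left inner_diff_right inner_commute field_simps)
    then show "ennreal ((norm ((1/2) *\<^sub>R (u z + v z)))\<^sup>2) + ennreal (1/4) * ennreal ((norm (u z - v z))\<^sup>2)
      = ennreal (1/2) * ennreal ((norm (u z))\<^sup>2) + ennreal (1/2) * ennreal ((norm (v z))\<^sup>2)"
      by (simp only: ennreal_mult'[symmetric] ennreal_plus[symmetric] zero_le_power2 mult_nonneg_nonneg zero_le_divide_1_iff zero_le_numeral)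
  qed
  also have "\<dots> = ennreal (1/2) * energy T p u + ennreal (1/2) * energy T p v"
    unfolding energy_def by (subst nn_integral_add) (auto simp: nn_integral_cmult)
  finally show ?thesis .
qed

text \<open>The pointwise Young inequality, integrated. It stands in for the triangle inequality of
  the L^2 norm and avoids roots of extended reals; \<open>d\<close> is later sent to 0.\<close>

lemma energy_triangle:
  fixes u v :: "real \<times> (real^'d) \<Rightarrow> real^'d"
  assumes [measurable]: "u \<in> borel_measurable M" "v \<in> borel_measurable M" and d: "d > 0"
  shows "energy T p v \<le> ennreal (1 + d) * energy T p u + ennreal (1 + 1 / d) * energy T p (\<lambda>z. u z - v z)"
proof -
  have "energy T p v \<le> (\<integral>\<^sup>+z. ennreal (1 + d) * ennreal ((norm (u z))\<^sup>2) + ennreal (1 + 1 / d) * ennreal ((norm (u z - v z))\<^sup>2) \<partial>M)"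
    unfolding energy_def
  proof (rule nn_integral_mono)
    fix z
    let ?x = "norm (u z)" and ?y = "norm (u z - v z)"
    have "norm (v z) \<le> ?x + ?y" using norm_triangle_ineq4[of "u z" "u z - v z"] by simp
    then have "(norm (v z))\<^sup>2 \<le> (?x + ?y)\<^sup>2" by (intro power_mono) auto
    also have "\<dots> \<le> (1 + d) * ?x\<^sup>2 + (1 + 1 / d) * ?y\<^sup>2"
    proof -
      have "0 \<le> (d * ?x - ?y)\<^sup>2 / d" using d by simp
      also have "\<dots> = d * ?x\<^sup>2 - 2 * ?x * ?y + 1 / d * ?y\<^sup>2" using d by (simp add: power2_eq_square field_simps)
      finally show ?thesis by (simp add: power2_sum distrib_right)
    qed
    finally show "ennreal ((norm (v z))\<^sup>2) \<le> ennreal (1 + d) * ennreal (?x\<^sup>2) + ennreal (1 + 1 / d) * ennreal (?y\<^sup>2)"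
      using d by (simp add: ennreal_mult'[symmetric] ennreal_plus[symmetric] ennreal_leI del: ennreal_plus)
  qed
  also have "\<dots> = ennreal (1 + d) * energy T p u + ennreal (1 + 1 / d) * energy T p (\<lambda>z. u z - v z)"
    unfolding energy_def by (subst nn_integral_add) (auto simp: nn_integral_cmult)
  finally show ?thesis .
qed

lemma integrable_midpoint: "integrable M u \<Longrightarrow> integrable M v \<Longrightarrow> integrable M (midpoint_field u v)"
  by (intro integrable_scaleR_right Bochner_Integration.integrable_add)

text \<open>The time component of the momentum and both end states do not depend on the field, so
  the residual is affine in it.\<close>

lemma residual_midpoint:
  assumes u: "integrable M u" and v: "integrable M v" and t: "t \<in> {0..T}"
  shows "residual T p K (midpoint_field u v) t = (\<lambda>w. (residual T p K u t w + residual T p K v t w) / 2)"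
proof
  fix w
  have i: "integrable lborel (\<lambda>z. momentum u t z \<bullet> - DK (w - z))" "integrable lborel (\<lambda>z. momentum v t z \<bullet> - DK (w - z))"
    by (auto intro!: flux.integrable_inner[OF flux_momentum[OF u t], where B=C]
        flux.integrable_inner[OF flux_momentum[OF v t], where B=C] norm_DK_le simp del: inner_minus_right)
  have "momentum (midpoint_field u v) t z = (1/2) *\<^sub>R (momentum u t z + momentum v t z)" for z
    by (simp add: momentum_def scaleR_add_right algebra_simps flip: scaleR_add_left)
  then have "(\<integral>z. momentum (midpoint_field u v) t z \<bullet> - DK (w - z) \<partial>lborel) =
      (\<integral>z. (1/2) * (momentum u t z \<bullet> - DK (w - z) + momentum v t z \<bullet> - DK (w - z)) \<partial>lborel)"
    by (simp only: inner_scaleR_left inner_add_left)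
  also have "\<dots> = (1/2) * ((\<integral>z. momentum u t z \<bullet> - DK (w - z) \<partial>lborel) + (\<integral>z. momentum v t z \<bullet> - DK (w - z) \<partial>lborel))"
    unfolding Bochner_Integration.integral_add[OF i, symmetric] by (rule integral_mult_right_zero)
  finally show "residual T p K (midpoint_field u v) t w = (residual T p K u t w + residual T p K v t w) / 2"
    unfolding residual_eq_functional[OF u t] residual_eq_functional[OF v t] residual_eq_functional[OF integrable_midpoint[OF u v] t]
      flux.functional_def[OF flux_momentum[OF u t]] flux.functional_def[OF flux_momentum[OF v t]]
      flux.functional_def[OF flux_momentum[OF integrable_midpoint[OF u v] t]]
    by (simp only:) (simp add: field_simps)
qed

lemma penalty_eq:
  assumes u: "integrable M u"
  shows "penalty T p K ip u = (\<integral>\<^sup>+t. ennreal (indicator {0..T} t *\<^sub>R ip (residual T p K u t) (residual T p K u t)) \<partial>lborel)"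
  unfolding penalty_def rkhs_norm_def
  using ip_nonneg[OF residual_mem[OF u]] by (intro nn_integral_cong) (auto simp: indicator_def)

lemma measurable_ip_residual:
  assumes u: "integrable M u"
  shows "(\<lambda>t. indicator {0..T} t *\<^sub>R ip (residual T p K u t) (residual T p K u t)) \<in> borel_measurable borel"
proof -
  have "(\<lambda>t. ip (residual T p K u t) (residual T p K u t)) \<in> borel_measurable (restrict_space borel {0..T})"
    by (rule borel_measurable_ip[OF residual_mem[OF u] residual_continuous[OF u]]) auto
  then show ?thesis by (subst (asm) borel_measurable_restrict_space_iff) auto
qed

lemma ennreal_half_add:
  assumes "x \<ge> 0" "y \<ge> 0"
  shows "ennreal (1/2) * ennreal x + ennreal (1/2) * ennreal y = ennreal ((x + y) / 2)"
proof -
  have "ennreal (1/2) * ennreal x = ennreal (x / 2)" "ennreal (1/2) * ennreal y = ennreal (y / 2)"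
    using ennreal_mult'[of "1/2" x] ennreal_mult'[of "1/2" y] by simp_all
  then show ?thesis using ennreal_plus[of "x / 2" "y / 2"] assms by (simp add: add_divide_distrib del: ennreal_plus)
qed

lemma penalty_midpoint_le:
  assumes u: "integrable M u" and v: "integrable M v"
  shows "penalty T p K ip (midpoint_field u v) \<le> ennreal (1/2) * penalty T p K ip u + ennreal (1/2) * penalty T p K ip v"
proof -
  note [measurable] = measurable_ip_residual[OF u] measurable_ip_residual[OF v]
  let ?f = "\<lambda>u t. indicator {0..T} t *\<^sub>R ip (residual T p K u t) (residual T p K u t)"
  have "penalty T p K ip (midpoint_field u v) \<le> (\<integral>\<^sup>+t. ennreal (1/2) * ennreal (?f u t) + ennreal (1/2) * ennreal (?f v t) \<partial>lborel)"
    unfolding penalty_eq[OF integrable_midpoint[OF u v]]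
  proof (rule nn_integral_mono)
    fix t
    show "ennreal (?f (midpoint_field u v) t) \<le> ennreal (1/2) * ennreal (?f u t) + ennreal (1/2) * ennreal (?f v t)"
    proof (cases "t \<in> {0..T}")
      case True
      have "?f (midpoint_field u v) t \<le> (?f u t + ?f v t) / 2"
        using ip_midpoint_le[OF residual_mem[OF u True] residual_mem[OF v True]] True
        by (simp add: residual_midpoint[OF u v True])
      moreover have "?f u t \<ge> 0" "?f v t \<ge> 0"
        using ip_nonneg[OF residual_mem[OF u True]] ip_nonneg[OF residual_mem[OF v True]] by auto
      ultimately show ?thesis unfolding ennreal_half_add[OF \<open>?f u t \<ge> 0\<close> \<open>?f v t \<ge> 0\<close>] by (intro ennreal_leI)
    qed simp
  qed
  also have "\<dots> = ennreal (1/2) * penalty T p K ip u + ennreal (1/2) * penalty T p K ip v"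
  proof -
    have m: "(\<lambda>t. ennreal (?f u t)) \<in> borel_measurable lborel" "(\<lambda>t. ennreal (?f v t)) \<in> borel_measurable lborel"
      by measurable
    show ?thesis
      unfolding penalty_eq[OF u] penalty_eq[OF v] nn_integral_cmult[OF m(1), symmetric] nn_integral_cmult[OF m(2), symmetric]
      by (intro nn_integral_add borel_measurable_times_ennreal borel_measurable_const m)
  qed
  finally show ?thesis .
qed

text \<open>Obtained from the characterisation by vanishing residuals, without averaging the
  continuity equations for general test functions.\<close>

lemma midpoint_U0: "u \<in> class_U0 T p \<Longrightarrow> v \<in> class_U0 T p \<Longrightarrow> midpoint_field u v \<in> class_U0 T p"
proof -
  assume U: "u \<in> class_U0 T p" "v \<in> class_U0 T p"
  then have i: "integrable M u" "integrable M v" using U0_subset_U integrable_U by auto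
  show "midpoint_field u v \<in> class_U0 T p"
    using residual_U0[OF U(1)] residual_U0[OF U(2)]
    by (intro U0_of_residual integrable_midpoint i) (simp add: residual_midpoint[OF i])
qed

text \<open>Midpoints of near-minimisers must be admissible for the penalised problem, where no
  continuity equation is at hand, so the residual characterisation cannot help; the two weak
  divergences are averaged directly.\<close>

lemma midpoint_U:
  assumes U: "u \<in> class_U T p" "v \<in> class_U T p"
  shows "midpoint_field u v \<in> class_U T p"
proof -
  let ?I = "{0<..<T} \<times> (UNIV :: (real^'d) set)"
  have i: "integrable M u" "integrable M v" using U integrable_U by auto
  obtain g h where g: "set_integrable lborel ?I g" "set_integrable lborel ?I h"
    and gh: "\<And>\<phi>. \<phi> \<in> test_functions ?I \<Longrightarrow> (LINT z:?I|lborel. (p z *\<^sub>R u z) \<bullet> space_grad \<phi> z) = - (LINT z:?I|lborel. g z * \<phi> z)"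
      "\<And>\<phi>. \<phi> \<in> test_functions ?I \<Longrightarrow> (LINT z:?I|lborel. (p z *\<^sub>R v z) \<bullet> space_grad \<phi> z) = - (LINT z:?I|lborel. h z * \<phi> z)"
    using U unfolding class_U_def weak_div_L1_def by blast
  have "weak_div_L1 T (\<lambda>z. p z *\<^sub>R midpoint_field u v z)"
    unfolding weak_div_L1_def
  proof (intro exI[of _ "\<lambda>z. (1/2) * (g z + h z)"] conjI ballI)
    show "set_integrable lborel ?I (\<lambda>z. (1/2) * (g z + h z))"
      using g by (intro set_integrable_mult_right set_integral_add) auto
    fix \<phi> assume \<phi>: "\<phi> \<in> test_functions ?I"
    then obtain D B where D: "\<And>z. (\<phi> has_derivative (\<lambda>h. D z \<bullet> h)) (at z)" "continuous_on UNIV D"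
      "\<And>z. \<bar>\<phi> z\<bar> \<le> B" "\<And>z. norm (D z) \<le> B" and "\<And>z. z \<notin> ?I \<Longrightarrow> \<phi> z = 0"
      by (rule test_functions_gradient) (rule that)
    have cont_\<phi>: "continuous_on UNIV \<phi>"
      unfolding continuous_on_eq_continuous_within by (intro ballI has_derivative_continuous[OF D(1)])
    have [measurable]: "\<phi> \<in> borel_measurable borel" "(\<lambda>z. snd (D z)) \<in> borel_measurable borel"
      using D(2) cont_\<phi> by (auto intro!: borel_measurable_continuous_onI continuous_intros)
    have snd_le: "norm (snd (D z)) \<le> B" for z
      using norm_snd_le[of "snd (D z)" "fst (D z)"] D(4)[of z] by simp
    have int_g: "set_integrable lborel ?I (\<lambda>z. g z * \<phi> z)" if g: "set_integrable lborel ?I g" for g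
    proof -
      have [measurable]: "(\<lambda>z. indicator ?I z *\<^sub>R g z) \<in> borel_measurable borel"
        using g unfolding set_integrable_def by auto
      have "integrable lborel (\<lambda>z. (indicator ?I z *\<^sub>R g z) * \<phi> z)"
      proof (rule Bochner_Integration.integrable_bound)
        show "integrable lborel (\<lambda>z. norm (indicator ?I z *\<^sub>R g z) * B)"
          using g unfolding set_integrable_def by (intro integrable_mult_left integrable_norm)
        show "AE z in lborel. norm ((indicator ?I z *\<^sub>R g z) * \<phi> z) \<le> norm (norm (indicator ?I z *\<^sub>R g z) * B)"
        proof (rule AE_I2)
          fix z
          have "\<bar>indicator ?I z *\<^sub>R g z\<bar> * \<bar>\<phi> z\<bar> \<le> \<bar>indicator ?I z *\<^sub>R g z\<bar> * \<bar>B\<bar>"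
            by (intro mult_left_mono order_trans[OF D(3) abs_ge_self]) auto
          then show "norm ((indicator ?I z *\<^sub>R g z) * \<phi> z) \<le> norm (norm (indicator ?I z *\<^sub>R g z) * B)"
            by (simp only: real_norm_def abs_mult abs_idempotent)
        qed
      qed measurable
      then show ?thesis by (simp add: set_integrable_def mult.assoc)
    qed
    have grad: "(LINT z:?I|lborel. (p z *\<^sub>R u z) \<bullet> space_grad \<phi> z) = (\<integral>z. (P z *\<^sub>R u z) \<bullet> snd (D z) \<partial>lborel)"
      and int_u: "integrable lborel (\<lambda>z. (P z *\<^sub>R u z) \<bullet> snd (D z))"
      if u: "integrable M u" for u
    proof -
      have iu: "integrable lborel (\<lambda>z. P z *\<^sub>R u z)" using u integrable_M_iff[of u] by auto
      then have [measurable]: "(\<lambda>z. P z *\<^sub>R u z) \<in> borel_measurable borel" by auto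
      show "(LINT z:?I|lborel. (p z *\<^sub>R u z) \<bullet> space_grad \<phi> z) = (\<integral>z. (P z *\<^sub>R u z) \<bullet> snd (D z) \<partial>lborel)"
      proof (rule open_strip_integral)
        show "(\<lambda>z. (P z *\<^sub>R u z) \<bullet> snd (D z)) \<in> borel_measurable borel" by measurable
      qed (auto simp: P_def transport_op_eq[OF has_derivative_at_withinI[OF D(1)]] simp del: mem_Times_iff)
      show "integrable lborel (\<lambda>z. (P z *\<^sub>R u z) \<bullet> snd (D z))"
      proof (rule Bochner_Integration.integrable_bound[OF integrable_mult_left[OF integrable_norm[OF iu], of B]])
        show "AE z in lborel. norm ((P z *\<^sub>R u z) \<bullet> snd (D z)) \<le> norm (norm (P z *\<^sub>R u z) * B)"
          unfolding real_norm_def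
          by (intro AE_I2 order_trans[OF Cauchy_Schwarz_ineq2 order_trans[OF mult_left_mono[OF snd_le norm_ge_zero] abs_ge_self]])
      qed measurable
    qed
    have "(LINT z:?I|lborel. (p z *\<^sub>R midpoint_field u v z) \<bullet> space_grad \<phi> z)
        = (\<integral>z. (1/2) * ((P z *\<^sub>R u z) \<bullet> snd (D z) + (P z *\<^sub>R v z) \<bullet> snd (D z)) \<partial>lborel)"
      unfolding grad[OF integrable_midpoint[OF i]]
      by (intro Bochner_Integration.integral_cong refl) (simp add: algebra_simps inner_add_left)
    also have "\<dots> = (1/2) * ((\<integral>z. (P z *\<^sub>R u z) \<bullet> snd (D z) \<partial>lborel) + (\<integral>z. (P z *\<^sub>R v z) \<bullet> snd (D z) \<partial>lborel))"
      unfolding Bochner_Integration.integral_add[OF int_u[OF i(1)] int_u[OF i(2)], symmetric] by (rule integral_mult_right_zero)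
    also have "\<dots> = - (1/2) * ((LINT z:?I|lborel. g z * \<phi> z) + (LINT z:?I|lborel. h z * \<phi> z))"
      unfolding grad[OF i(1), symmetric] grad[OF i(2), symmetric] gh[OF \<phi>]
      by (simp add: add_divide_distrib)
    also have "\<dots> = - ((1/2) * (LINT z:?I|lborel. g z * \<phi> z + h z * \<phi> z))"
      unfolding set_integral_add(2)[OF int_g[OF g(1)] int_g[OF g(2)]] by simp
    also have "(1/2) * (LINT z:?I|lborel. g z * \<phi> z + h z * \<phi> z) = (LINT z:?I|lborel. (1/2) * (g z + h z) * \<phi> z)"
      unfolding set_lebesgue_integral_def integral_mult_right_zero[symmetric]
      by (intro Bochner_Integration.integral_cong refl) (simp add: algebra_simps)
    finally show "(LINT z:?I|lborel. (p z *\<^sub>R midpoint_field u v z) \<bullet> space_grad \<phi> z) = - (LINT z:?I|lborel. (1/2) * (g z + h z) * \<phi> z)" .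
  qed
  then show ?thesis using integrable_midpoint[OF i] by (simp add: class_U_def)
qed

text \<open>The energy contributes its exact parallelogram surplus, the penalty only its
  convexity.\<close>

lemma J_midpoint_le:
  assumes U: "u \<in> class_U T p" "v \<in> class_U T p"
  shows "J T p K ip l (midpoint_field u v) + ennreal (1/4) * energy T p (\<lambda>z. u z - v z)
    \<le> ennreal (1/2) * J T p K ip l u + ennreal (1/2) * J T p K ip l v"
proof -
  have i: "integrable M u" "integrable M v" using U integrable_U by auto
  have "J T p K ip l (midpoint_field u v) + ennreal (1/4) * energy T p (\<lambda>z. u z - v z)
      = (energy T p (midpoint_field u v) + ennreal (1/4) * energy T p (\<lambda>z. u z - v z)) + ennreal l * penalty T p K ip (midpoint_field u v)"
    by (simp add: J_def add_ac)
  also have "\<dots> \<le> (ennreal (1/2) * energy T p u + ennreal (1/2) * energy T p v)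
      + ennreal l * (ennreal (1/2) * penalty T p K ip u + ennreal (1/2) * penalty T p K ip v)"
    unfolding parallelogram[OF borel_measurable_integrable[OF i(1)] borel_measurable_integrable[OF i(2)]]
    by (intro add_left_mono mult_left_mono penalty_midpoint_le i) simp
  also have "\<dots> = ennreal (1/2) * J T p K ip l u + ennreal (1/2) * J T p K ip l v"
    unfolding J_def distrib_left by (simp only: mult_ac add_ac)
  finally show ?thesis .
qed

lemma penalty_U0:
  assumes u: "u \<in> class_U0 T p"
  shows "penalty T p K ip u = 0"
proof -
  have "penalty T p K ip u = (\<integral>\<^sup>+t. 0 \<partial>(lborel :: real measure))"
    unfolding penalty_def
  proof (rule nn_integral_cong)
    fix t
    show "ennreal ((rkhs_norm ip (residual T p K u t))\<^sup>2) * indicator {0..T} t = 0"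
      by (cases "t \<in> {0..T}") (simp_all add: residual_U0[OF u] rkhs_norm_def ip_zero)
  qed
  then show ?thesis by simp
qed

text \<open>Residuals converge for each \<open>t\<close> and \<open>w\<close>. Fatou's lemma and the
  evaluation bound \<open>eval_le\<close> make the time integral of the squared limit at most
  \<open>K 0\<close> times the limit of the penalties, which is 0; continuity in \<open>t\<close>
  then removes the exceptional null set.\<close>

lemma U0_of_limit:
  assumes u: "\<And>n. integrable M (u n)" and v: "v \<in> borel_measurable M"
    and lim: "(\<lambda>n. energy T p (\<lambda>z. u n z - v z)) \<longlonglongrightarrow> 0"
    and pen: "(\<lambda>n. penalty T p K ip (u n)) \<longlonglongrightarrow> 0"
  shows "integrable M v" and "v \<in> class_U0 T p"
proof -
  have um: "\<And>n. u n \<in> borel_measurable M" using u by auto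
  have diff_m: "(\<lambda>z. u n z - v z) \<in> borel_measurable M" for n using um v by measurable
  have "\<forall>\<^sub>F n in sequentially. energy T p (\<lambda>z. u n z - v z) < 1"
    using lim by (rule order_tendstoD) simp
  then obtain n where "energy T p (\<lambda>z. u n z - v z) < 1" by (auto simp: eventually_sequentially)
  \<comment> \<open>One difference with finite energy is integrable, and \<open>v\<close> inherits
    integrability from it and \<open>u n\<close>.\<close>
  then have "integrable M (\<lambda>z. u n z - v z)"
    by (intro M.L1_le_L2(1)[OF diff_m, of 1 1]) (auto simp: energy_def)
  from Bochner_Integration.integrable_diff[OF u[of n] this] show iv: "integrable M v" by simp
  have L1: "(\<lambda>n. \<integral>z. norm (u n z - v z) \<partial>M) \<longlonglongrightarrow> 0"
    using M.L1_tendsto_of_L2[OF diff_m] lim by (simp add: energy_def)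
  have conv: "(\<lambda>n. residual T p K (u n) t w) \<longlonglongrightarrow> residual T p K v t w" if t: "t \<in> {0..T}" for t w
  proof -
    have "(\<lambda>n. residual T p K (u n) t w - residual T p K v t w) \<longlonglongrightarrow> 0"
      by (rule Lim_null_comparison[OF _ tendsto_mult_left_zero[OF L1, of C]])
        (use residual_diff_le[OF u iv t] in auto)
    then show ?thesis by (rule LIM_zero_cancel)
  qed
  have "residual T p K v t w = 0" if t: "t \<in> {0..T}" for t w
  proof (rule continuous_AE_zero[OF T_pos residual_continuous[OF iv] _ t])
    let ?r = "\<lambda>u t. indicator {0..T} t *\<^sub>R (residual T p K u t w)\<^sup>2"
    have [measurable]: "?r u \<in> borel_measurable borel" if u: "integrable M u" for u
      by (rule borel_measurable_continuous_on_indicator) (auto intro!: continuous_intros residual_continuous u)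
    note [measurable] = this[OF u] this[OF iv]
    have "(\<integral>\<^sup>+t. ennreal (?r v t) \<partial>lborel) = (\<integral>\<^sup>+t. liminf (\<lambda>n. ennreal (?r (u n) t)) \<partial>lborel)"
    proof (rule nn_integral_cong)
      fix t
      have "(\<lambda>n. ennreal (?r (u n) t)) \<longlonglongrightarrow> ennreal (?r v t)"
        using conv[of t w] by (cases "t \<in> {0..T}") (auto intro!: tendsto_intros)
      then show "ennreal (?r v t) = liminf (\<lambda>n. ennreal (?r (u n) t))"
        using lim_imp_Liminf[OF sequentially_bot] by metis
    qed
    also have "\<dots> \<le> liminf (\<lambda>n. \<integral>\<^sup>+t. ennreal (?r (u n) t) \<partial>lborel)"
      by (rule nn_integral_liminf) measurable
    also have "\<dots> \<le> liminf (\<lambda>n. ennreal (K 0) * penalty T p K ip (u n))"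
    proof (intro Liminf_mono always_eventually allI)
      fix n
      have "(\<integral>\<^sup>+t. ennreal (?r (u n) t) \<partial>lborel) \<le>
          (\<integral>\<^sup>+t. ennreal (K 0) * ennreal (indicator {0..T} t *\<^sub>R ip (residual T p K (u n) t) (residual T p K (u n) t)) \<partial>lborel)"
      proof (rule nn_integral_mono)
        fix t
        show "ennreal (?r (u n) t) \<le> ennreal (K 0) * ennreal (indicator {0..T} t *\<^sub>R ip (residual T p K (u n) t) (residual T p K (u n) t))"
          using eval_le[OF residual_mem[OF u], of t n w] K_zero_nonneg
          by (cases "t \<in> {0..T}") (auto simp: ennreal_mult'[symmetric] mult.commute intro!: ennreal_leI)
      qed
      also have "\<dots> = ennreal (K 0) * penalty T p K ip (u n)"
        unfolding penalty_eq[OF u] using measurable_ip_residual[OF u] by (intro nn_integral_cmult) auto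
      finally show "(\<integral>\<^sup>+t. ennreal (?r (u n) t) \<partial>lborel) \<le> ennreal (K 0) * penalty T p K ip (u n)" .
    qed
    also have "\<dots> = 0"
    proof -
      have "(\<lambda>n. ennreal (K 0) * penalty T p K ip (u n)) \<longlonglongrightarrow> ennreal (K 0) * 0"
        by (intro ennreal_tendsto_cmult pen) simp
      then show ?thesis using lim_imp_Liminf[OF sequentially_bot] by fastforce
    qed
    finally have "(\<integral>\<^sup>+t. ennreal (?r v t) \<partial>lborel) = 0" by simp
    moreover have "(\<integral>\<^sup>+t. ennreal (?r v t) \<partial>lborel) = 0 \<longleftrightarrow> (AE t in lborel. ennreal (?r v t) = 0)"
      by (rule nn_integral_0_iff_AE) measurable
    ultimately have "AE t in lborel. ennreal (?r v t) = 0" by simp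
    then show "AE t in lborel. t \<in> {0..T} \<longrightarrow> residual T p K v t w = 0"
      by eventually_elim (auto simp: ennreal_eq_0_iff)
  qed
  then show "v \<in> class_U0 T p" by (intro U0_of_residual iv) auto
qed

end

section \<open>Convergence of near-minimisers\<close>

context transport_problem
begin

abbreviation J_inf :: "real \<Rightarrow> ennreal" where
  "J_inf l \<equiv> INF v\<in>class_U T p. J T p K ip l v"

text \<open>The penalty is 0 on \<open>class_U0\<close>, so every competitor of the constrained
  problem competes in the penalised one at the same cost.\<close>

lemma J_inf_le_V0: "J_inf l \<le> V0 T p"
  unfolding V0_def
proof (rule INF_mono)
  fix v assume v: "v \<in> class_U0 T p"
  then have "J T p K ip l v = energy T p v" by (simp add: J_def penalty_U0)
  then show "\<exists>w\<in>class_U T p. J T p K ip l w \<le> energy T p v"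
    using v U0_subset_U by (intro bexI[of _ v]) auto
qed

lemma J_mono: "l \<le> l' \<Longrightarrow> J T p K ip l v \<le> J T p K ip l' v"
  unfolding J_def by (intro add_left_mono mult_right_mono ennreal_leI) auto

lemma J_inf_mono: "l \<le> l' \<Longrightarrow> J_inf l \<le> J_inf l'"
  by (rule INF_mono) (use J_mono in blast)

text \<open>\<open>lam\<close> itself may oscillate, but \<open>J_inf\<close> is monotone: once
  \<open>lam n\<close> has passed a parameter whose infimum exceeds \<open>a\<close>, its own
  infimum exceeds \<open>a\<close> too.\<close>

lemma J_inf_tendsto:
  assumes lam: "filterlim lam at_top sequentially" and pos: "\<forall>n\<ge>1. lam n > 0"
  shows "(\<lambda>n. J_inf (lam n)) \<longlonglongrightarrow> (SUP l\<in>{0<..}. J_inf l)"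
proof (rule order_tendstoI)
  fix a assume "a < (SUP l\<in>{0<..}. J_inf l)"
  then obtain l where "a < J_inf l" unfolding less_SUP_iff by blast
  have "\<forall>\<^sub>F n in sequentially. l \<le> lam n" using lam by (simp add: filterlim_at_top)
  then show "\<forall>\<^sub>F n in sequentially. a < J_inf (lam n)"
    by eventually_elim (rule less_le_trans[OF \<open>a < J_inf l\<close> J_inf_mono])
next
  fix a assume a: "(SUP l\<in>{0<..}. J_inf l) < a"
  show "\<forall>\<^sub>F n in sequentially. J_inf (lam n) < a"
    using eventually_ge_at_top[of 1]
  proof eventually_elim
    case (elim n)
    have "J_inf (lam n) \<le> (SUP l\<in>{0<..}. J_inf l)" by (rule SUP_upper) (use pos elim in auto)
    then show ?case using a by (rule le_less_trans)
  qed
qed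

text \<open>Near-minimisers are close in \<open>L\<^sup>2\<close>: their midpoint is admissible, so the parallelogram
  identity turns the gap between their cost and the infimum into a bound on the distance.\<close>

lemma near_minimizers_close:
  assumes U: "u \<in> class_U T p" "v \<in> class_U T p" and e: "e > 0" and i: "i \<ge> 0"
    and J: "J T p K ip l u \<le> ennreal (i + e)" "J T p K ip l v \<le> ennreal (i + e)"
    and inf: "ennreal (i - e) \<le> J_inf l"
  shows "energy T p (\<lambda>z. u z - v z) \<le> ennreal (8 * e)"
proof -
  let ?E = "energy T p (\<lambda>z. u z - v z)"
  have "J_inf l \<le> J T p K ip l (midpoint_field u v)" by (rule INF_lower) (rule midpoint_U[OF U])
  then have "ennreal (i - e) + ennreal (1/4) * ?E \<le> J T p K ip l (midpoint_field u v) + ennreal (1/4) * ?E"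
    using inf by (intro add_right_mono) (rule order_trans)
  also have "\<dots> \<le> ennreal (1/2) * J T p K ip l u + ennreal (1/2) * J T p K ip l v" by (rule J_midpoint_le[OF U])
  also have "\<dots> \<le> ennreal (1/2) * ennreal (i + e) + ennreal (1/2) * ennreal (i + e)"
    by (intro add_mono mult_left_mono J) auto
  also have "\<dots> = ennreal (i + e)"
  proof -
    have nn: "0 \<le> i + e" and eq: "(i + e + (i + e)) / 2 = i + e" using i e by simp_all
    show ?thesis unfolding ennreal_half_add[OF nn nn] eq ..
  qed
  finally have le: "ennreal (i - e) + ennreal (1/4) * ?E \<le> ennreal (i + e)" .
  show ?thesis
  proof (cases ?E)
    case (real x)
    \<comment> \<open>\<open>ennreal\<close> sends a negative i - e to 0, hence the maximum. The
      constant 8 comes from x/4 <= (i + e) - (i - e) = 2 e.\<close>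
    have A: "ennreal (i - e) = ennreal (max 0 (i - e))" by (simp add: max_def ennreal_neg)
    have B: "ennreal (1/4) * ?E = ennreal (x / 4)" using real ennreal_mult'[of "1/4" x] by simp
    have "ennreal (max 0 (i - e) + x / 4) = ennreal (max 0 (i - e)) + ennreal (x / 4)"
      using real by (intro ennreal_plus) auto
    then have "ennreal (max 0 (i - e) + x / 4) \<le> ennreal (i + e)"
      using le unfolding A B by (simp only:)
    then have "max 0 (i - e) + x / 4 \<le> i + e" using i e by (subst (asm) ennreal_le_iff) auto
    then have "x \<le> 8 * e" by linarith
    then show ?thesis using real by (simp add: ennreal_leI)
  next
    case top
    then show ?thesis using le by (simp add: ennreal_mult_top top_unique)
  qed
qed

theorem penalized_convergence:
  fixes u :: "nat \<Rightarrow> real \<times> (real^'d) \<Rightarrow> real^'d"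
  assumes V0_fin: "V0 T p < \<infinity>"
    and eps_lim: "eps \<longlonglongrightarrow> 0"
    and lam_pos: "\<forall>n\<ge>1. lam n > 0" and lam_lim: "filterlim lam at_top sequentially"
    and u_adm: "\<forall>n\<ge>1. u n \<in> class_U T p"
    and u_opt: "\<forall>n\<ge>1. J T p K ip (lam n) (u n) \<le> J_inf (lam n) + ennreal (eps n)"
  shows "(\<lambda>n. ennreal (lam n) * penalty T p K ip (u n)) \<longlonglongrightarrow> 0 \<and>
    (\<lambda>n. J T p K ip (lam n) (u n)) \<longlonglongrightarrow> V0 T p \<and>
    (SUP l\<in>{0<..}. J_inf l) = V0 T p \<and>
    (\<exists>u_star. is_arg_min (energy T p) (\<lambda>v. v \<in> class_U0 T p) u_star \<and>
       (\<forall>v. is_arg_min (energy T p) (\<lambda>v. v \<in> class_U0 T p) v \<longrightarrow>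
          (AE z in spacetime_measure T p. v z = u_star z)) \<and>
       energy T p u_star < \<infinity> \<and> (\<forall>n\<ge>1. energy T p (u n) < \<infinity>) \<and>
       (\<lambda>n. energy T p (\<lambda>z. u n z - u_star z)) \<longlonglongrightarrow> 0)"
proof -
  \<comment> \<open>\<open>s\<close> is kept apart from \<open>V0 T p\<close> until the limit field
    is known to be admissible with energy at most \<open>s\<close>.\<close>
  define s where "s = (SUP l\<in>{0<..}. J_inf l)"
  have s_le: "s \<le> V0 T p" unfolding s_def by (intro SUP_least J_inf_le_V0)
  then obtain i where i: "i \<ge> 0" "s = ennreal i"
    using V0_fin by (cases s) (auto simp: top_unique)
  define j where "j n = J T p K ip (lam n) (u n)" for n
  have inf_lim: "(\<lambda>n. J_inf (lam n)) \<longlonglongrightarrow> s" unfolding s_def by (rule J_inf_tendsto[OF lam_lim lam_pos])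
  have j_le: "j n \<le> s + ennreal (eps n)" if "n \<ge> 1" for n
  proof -
    have "J_inf (lam n) \<le> s" unfolding s_def by (rule SUP_upper) (use lam_pos that in auto)
    then show ?thesis using u_opt that unfolding j_def by (meson add_right_mono order_trans)
  qed
  have j_lim: "j \<longlonglongrightarrow> s"
  proof (rule tendsto_sandwich[OF _ _ inf_lim])
    show "\<forall>\<^sub>F n in sequentially. J_inf (lam n) \<le> j n"
      using eventually_ge_at_top[of 1] by eventually_elim (use u_adm in \<open>auto simp: j_def intro: INF_lower\<close>)
    show "\<forall>\<^sub>F n in sequentially. j n \<le> s + ennreal (eps n)"
      using eventually_ge_at_top[of 1] by eventually_elim (rule j_le)
    have "(\<lambda>n. s + ennreal (eps n)) \<longlonglongrightarrow> s + ennreal 0"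
      by (intro tendsto_add tendsto_const tendsto_ennrealI eps_lim)
    then show "(\<lambda>n. s + ennreal (eps n)) \<longlonglongrightarrow> s" by simp
  qed
  have upper: "\<forall>\<^sub>F n in sequentially. j n \<le> ennreal (i + e)" if "e > 0" for e
  proof -
    have "s < ennreal (i + e)" using i that by (simp add: ennreal_lessI)
    from order_tendstoD(2)[OF j_lim this] show ?thesis by eventually_elim simp
  qed
  have lower: "\<forall>\<^sub>F n in sequentially. ennreal (i - e) \<le> J_inf (lam n)" if "e > 0" for e
  proof (cases "i \<le> e")
    case True
    then show ?thesis by (simp add: ennreal_neg)
  next
    case False
    then have "ennreal (i - e) < s" using i that by (simp add: ennreal_lessI)
    from order_tendstoD(1)[OF inf_lim this] show ?thesis by eventually_elim simp
  qed
  \<comment> \<open>Admissibility is given from index 1 on, hence the shift by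
    \<open>Suc\<close>.\<close>
  have int_u: "integrable M (u (Suc n))" for n using u_adm integrable_U by simp
  have cauchy: "\<exists>N. \<forall>m\<ge>N. \<forall>n\<ge>N. (\<integral>\<^sup>+z. ennreal ((norm (u (Suc m) z - u (Suc n) z))\<^sup>2) \<partial>M) \<le> ennreal e" if e: "e > 0" for e
  proof -
    have e8: "e / 8 > 0" using e by simp
    obtain N where N: "\<And>n. n \<ge> N \<Longrightarrow> j n \<le> ennreal (i + e / 8) \<and> ennreal (i - e / 8) \<le> J_inf (lam n)"
      using eventually_conj[OF upper[OF e8] lower[OF e8]] unfolding eventually_sequentially by blast
    \<comment> \<open>Both fields are compared at the smaller of their two parameters:
      \<open>J\<close> only decreases there, and the infimum is one of the two values of
      \<open>J_inf\<close> known to be at least i - e/8.\<close>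
    have "energy T p (\<lambda>z. u (Suc m) z - u (Suc n) z) \<le> ennreal (8 * (e / 8))" if mn: "m \<ge> N" "n \<ge> N" for m n
    proof (rule near_minimizers_close[OF _ _ e8 i(1), where l="min (lam (Suc m)) (lam (Suc n))"])
      show "J T p K ip (min (lam (Suc m)) (lam (Suc n))) (u (Suc m)) \<le> ennreal (i + e / 8)"
        "J T p K ip (min (lam (Suc m)) (lam (Suc n))) (u (Suc n)) \<le> ennreal (i + e / 8)"
        using N[of "Suc m"] N[of "Suc n"] mn order_trans[OF J_mono[OF min.cobounded1]] order_trans[OF J_mono[OF min.cobounded2]]
        unfolding j_def by simp_all
      show "ennreal (i - e / 8) \<le> J_inf (min (lam (Suc m)) (lam (Suc n)))"
        using N[of "Suc m"] N[of "Suc n"] mn by (simp add: min_def)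
    qed (use u_adm in auto)
    then show ?thesis unfolding energy_def by (intro exI[of _ N]) simp
  qed
  obtain w where w[measurable]: "w \<in> borel_measurable M"
    and "(\<lambda>n. \<integral>\<^sup>+z. ennreal ((norm (u (Suc n) z - w z))\<^sup>2) \<partial>M) \<longlonglongrightarrow> 0"
    by (rule M.L2_complete[of "\<lambda>n. u (Suc n)", OF int_u cauchy])
  then have lim_Suc: "(\<lambda>n. energy T p (\<lambda>z. u (Suc n) z - w z)) \<longlonglongrightarrow> 0" by (simp add: energy_def)
  then have lim: "(\<lambda>n. energy T p (\<lambda>z. u n z - w z)) \<longlonglongrightarrow> 0" by (rule LIMSEQ_imp_Suc)
  \<comment> \<open>Eventually \<open>lam n\<close> times the penalty is at most i + 1, while
    \<open>lam n\<close> is at least (i + 2)/e.\<close>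
  have "(\<lambda>n. penalty T p K ip (u n)) \<longlonglongrightarrow> 0"
  proof (rule tendsto_zero_ennreal)
    fix e :: real assume e: "0 < e"
    have "\<forall>\<^sub>F n in sequentially. (i + 2) / e \<le> lam n" using lam_lim by (simp add: filterlim_at_top)
    then show "\<forall>\<^sub>F n in sequentially. penalty T p K ip (u n) < ennreal e"
      using upper[OF zero_less_one]
    proof eventually_elim
      case (elim n)
      show ?case
      proof (rule ccontr)
        assume "\<not> penalty T p K ip (u n) < ennreal e"
        then have "ennreal (lam n) * ennreal e \<le> ennreal (lam n) * penalty T p K ip (u n)"
          by (intro mult_left_mono) auto
        also have "\<dots> \<le> j n" by (simp add: j_def J_def)
        also have "\<dots> \<le> ennreal (i + 1)" using elim by simp
        finally have "ennreal (lam n * e) \<le> ennreal (i + 1)" using e by (simp add: ennreal_mult'')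
        then have "lam n * e \<le> i + 1" using i(1) by (subst (asm) ennreal_le_iff) auto
        moreover have "i + 2 \<le> lam n * e" using elim e by (simp add: divide_le_eq)
        ultimately show False by simp
      qed
    qed
  qed
  then have "(\<lambda>n. penalty T p K ip (u (Suc n))) \<longlonglongrightarrow> 0" by (rule LIMSEQ_Suc)
  then have w_U0: "w \<in> class_U0 T p" and int_w: "integrable M w"
    using U0_of_limit[OF int_u w lim_Suc] by auto
  have V0_le_w: "V0 T p \<le> energy T p w" unfolding V0_def using w_U0 by (rule INF_lower)
  \<comment> \<open>\<open>energy_triangle\<close> with the difference term below \<open>d\<close>,
    which holds as soon as the energy of the difference is below d / (1 + 1/d).\<close>
  have ev_w: "\<forall>\<^sub>F n in sequentially. energy T p w \<le> ennreal (1 + d) * energy T p (u n) + ennreal d" if d: "d > 0" for d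
  proof -
    have "\<forall>\<^sub>F n in sequentially. energy T p (\<lambda>z. u n z - w z) < ennreal (d / (1 + 1 / d))"
      using d by (intro order_tendstoD(2)[OF lim]) (simp add: add_pos_pos)
    then show ?thesis using eventually_ge_at_top[of 1]
    proof eventually_elim
      case (elim n)
      have un: "u n \<in> borel_measurable M" using u_adm integrable_U elim by (intro borel_measurable_integrable) auto
      define q where "q = 1 + 1 / d"
      have q: "q > 0" using d by (simp add: q_def add_pos_pos)
      have "ennreal (1 + 1 / d) * energy T p (\<lambda>z. u n z - w z) \<le> ennreal (1 + 1 / d) * ennreal (d / (1 + 1 / d))"
        using elim by (intro mult_left_mono) auto
      also have "\<dots> = ennreal d" unfolding q_def[symmetric] using q by (simp add: ennreal_mult'[symmetric])
      finally show ?case using order_trans[OF energy_triangle[OF un w d] add_left_mono] by blast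
    qed
  qed
  have "energy T p w \<le> ennreal i"
  proof (rule ennreal_le_epsilon)
    fix e :: real assume e: "0 < e"
    \<comment> \<open>For d <= 1 the bound (1 + d) (i + d) + d is at most i + d (i + 3), hence the
      denominator.\<close>
    define d where "d = min 1 (e / (i + 3))"
    have d: "d > 0" "d \<le> 1" "d \<le> e / (i + 3)" using e i(1) by (auto simp: d_def)
    have di: "d * (i + 3) \<le> e" using d(3) i(1) by (subst (asm) pos_le_divide_eq) auto
    obtain n where n: "energy T p w \<le> ennreal (1 + d) * energy T p (u n) + ennreal d" "j n \<le> ennreal (i + d)"
      using eventually_conj[OF ev_w[OF d(1)] upper[OF d(1)]] unfolding eventually_sequentially by blast
    have "energy T p (u n) \<le> ennreal (i + d)" using n(2) by (simp add: j_def J_def) (metis add_increasing2 order_trans zero_le le_iff_add)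
    then have "ennreal (1 + d) * energy T p (u n) + ennreal d \<le> ennreal (1 + d) * ennreal (i + d) + ennreal d"
      by (intro add_right_mono mult_left_mono) auto
    also have "\<dots> = ennreal ((1 + d) * (i + d) + d)"
      using d i(1) by (simp add: ennreal_mult'[symmetric] ennreal_plus[symmetric] del: ennreal_plus)
    also have "\<dots> \<le> ennreal (i + e)"
    proof (rule ennreal_leI)
      have "d * d \<le> d * 1" using d by (intro mult_left_mono) auto
      then show "(1 + d) * (i + d) + d \<le> i + e" using di by (simp add: algebra_simps)
    qed
    finally show "energy T p w \<le> ennreal i + ennreal e"
      using n(1) i(1) e by (simp add: ennreal_plus[symmetric] del: ennreal_plus)
  qed
  \<comment> \<open>The chain V0 <= energy of \<open>w\<close> <= i = s <= V0 closes.\<close>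
  then have s_eq: "s = V0 T p" and w_eq: "energy T p w = V0 T p"
    using s_le V0_le_w i(2) by auto
  \<comment> \<open>Now the weight \<open>lam n\<close> is included: the total cost tends to
    \<open>i\<close>, and the energy of \<open>u n\<close> is asymptotically at least the energy
    \<open>i\<close> of \<open>w\<close>, so nothing is left for the weighted penalty.\<close>
  have pen_lim: "(\<lambda>n. ennreal (lam n) * penalty T p K ip (u n)) \<longlonglongrightarrow> 0"
  proof (rule tendsto_zero_ennreal)
    fix e :: real assume e: "0 < e"
    \<comment> \<open>The computation below bounds the weighted penalty by d (i + 1) + 2 d = d (i +
      3), which this choice makes at most e/2.\<close>
    define d where "d = min 1 (e / (2 * (i + 3)))"
    have d: "d > 0" "d \<le> 1" "d \<le> e / (2 * (i + 3))" using e i(1) by (auto simp: d_def)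
    have di: "d * (2 * (i + 3)) \<le> e" using d(3) i(1) by (subst (asm) pos_le_divide_eq) auto
    show "\<forall>\<^sub>F n in sequentially. ennreal (lam n) * penalty T p K ip (u n) < ennreal e"
      using ev_w[OF d(1)] upper[OF d(1)]
    proof eventually_elim
      case (elim n)
      have sum: "energy T p (u n) + ennreal (lam n) * penalty T p K ip (u n) \<le> ennreal (i + d)"
        using elim(2) by (simp add: j_def J_def)
      obtain x y where x: "x \<ge> 0" "energy T p (u n) = ennreal x" and y: "y \<ge> 0" "ennreal (lam n) * penalty T p K ip (u n) = ennreal y"
        using sum by (cases "energy T p (u n)"; cases "ennreal (lam n) * penalty T p K ip (u n)") (auto simp: top_unique)
      have "x + y \<le> i + d"
      proof -
        have "ennreal (x + y) \<le> ennreal (i + d)" using sum unfolding x(2) y(2) ennreal_plus[OF x(1) y(1)] .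
        then show ?thesis using i(1) d(1) by (subst (asm) ennreal_le_iff) auto
      qed
      moreover have "i \<le> (1 + d) * x + d"
      proof -
        have "ennreal i \<le> ennreal (1 + d) * ennreal x + ennreal d"
          using elim(1) x(2) w_eq s_eq i(2) by simp
        then have "ennreal i \<le> ennreal ((1 + d) * x + d)"
          using d x by (simp add: ennreal_mult'[symmetric] ennreal_plus[symmetric] del: ennreal_plus)
        then show ?thesis using d x(1) by (subst (asm) ennreal_le_iff) auto
      qed
      ultimately have "y \<le> d * x + 2 * d" by (simp add: algebra_simps)
      also have "\<dots> \<le> d * (i + 1) + 2 * d"
        using \<open>x + y \<le> i + d\<close> y(1) d by (intro add_right_mono mult_left_mono) auto
      also have "\<dots> \<le> e / 2" using di by (simp add: algebra_simps)
      finally have "y < e" using e by simp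
      then show ?case using y e by (simp add: ennreal_lessI)
    qed
  qed
  have "is_arg_min (energy T p) (\<lambda>v. v \<in> class_U0 T p) w"
    unfolding is_arg_min_def w_eq V0_def using w_U0 INF_lower[of _ "class_U0 T p" "energy T p"] by (auto simp: not_less)
  moreover have "AE z in M. v z = w z" if v: "is_arg_min (energy T p) (\<lambda>v. v \<in> class_U0 T p) v" for v
  proof -
    have v_U0: "v \<in> class_U0 T p" and "\<not> energy T p w < energy T p v"
      using v w_U0 by (auto simp: is_arg_min_def)
    moreover have "V0 T p \<le> energy T p v" unfolding V0_def using v_U0 by (rule INF_lower)
    ultimately have v_eq: "energy T p v = ennreal i" using w_eq s_eq i(2) by auto
    have vm[measurable]: "v \<in> borel_measurable M"
      using v_U0 U0_subset_U integrable_U by (intro borel_measurable_integrable) auto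
    \<comment> \<open>The midpoint of two minimisers is admissible and cannot fall below the
      minimum, so the parallelogram surplus is 0.\<close>
    have "V0 T p \<le> energy T p (midpoint_field v w)"
      unfolding V0_def by (rule INF_lower) (rule midpoint_U0[OF v_U0 w_U0])
    then have "ennreal i + ennreal (1/4) * energy T p (\<lambda>z. v z - w z)
        \<le> energy T p (midpoint_field v w) + ennreal (1/4) * energy T p (\<lambda>z. v z - w z)"
      using s_eq i(2) by (intro add_right_mono) simp
    also have "\<dots> = ennreal (1/2) * ennreal i + ennreal (1/2) * ennreal i"
      unfolding parallelogram[OF vm w] v_eq using w_eq s_eq i(2) by simp
    also have "\<dots> = ennreal i + 0" using i(1) by (subst ennreal_half_add) auto
    finally have "ennreal (1/4) * energy T p (\<lambda>z. v z - w z) = 0"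
      unfolding ennreal_add_left_cancel_le by simp
    then have "energy T p (\<lambda>z. v z - w z) = 0" by simp
    then have "AE z in M. ennreal ((norm (v z - w z))\<^sup>2) = 0"
      unfolding energy_def by (subst (asm) nn_integral_0_iff_AE) auto
    then show ?thesis by eventually_elim (simp add: ennreal_eq_0_iff)
  qed
  moreover have "energy T p (u n) < \<infinity>" if "n \<ge> 1" for n
  proof -
    have "energy T p (u n) \<le> j n" by (simp add: j_def J_def)
    also have "\<dots> \<le> ennreal i + ennreal (eps n)" using j_le[OF that] i(2) by simp
    also have "\<dots> < \<infinity>" by (simp add: ennreal_add_eq_top less_top)
    finally show ?thesis .
  qed
  ultimately show ?thesis
    using pen_lim j_lim lim w_eq V0_fin s_eq unfolding j_def s_def by (intro conjI exI[of _ w]) auto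
qed

end

theorem theorem2:
  fixes T :: real
    and \<mu> :: "real \<Rightarrow> (real^'d) measure"
    and p :: "real \<times> (real^'d) \<Rightarrow> real"
    and K :: "real \<times> (real^'d) \<Rightarrow> real"
    and H :: "(real \<times> (real^'d) \<Rightarrow> real) set"
    and ip :: "(real \<times> (real^'d) \<Rightarrow> real) \<Rightarrow> (real \<times> (real^'d) \<Rightarrow> real) \<Rightarrow> real"
    and eps lam :: "nat \<Rightarrow> real"
    and u :: "nat \<Rightarrow> real \<times> (real^'d) \<Rightarrow> real^'d"
  assumes T_pos: "T > 0"
    and mu_prob: "\<forall>t\<in>{0..T}. sets (\<mu> t) = sets borel \<and> prob_space (\<mu> t)"
    and mu_cont: "weakly_continuous_on {0..T} \<mu>"
    and mu_dens: "\<forall>t\<in>{0..T}. \<mu> t = density lborel (\<lambda>x. ennreal (p (t, x)))"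
    and rkhs: "is_rkhs (\<lambda>\<xi> \<eta>. K (\<xi> - \<eta>)) H ip"
    and A1_cont: "continuous_on UNIV K"
    and A1_int: "integrable lborel K"
    and A1_pd: "positive_definite K"
    and A1_univ: "support (fourier K) = UNIV"
    and A2: "integrable lborel (\<lambda>z. (1 + (norm z)\<^sup>2) *\<^sub>R fourier K z)"
    and A3_meas: "p \<in> borel_measurable (restrict_space lborel ({0..T} \<times> UNIV))"
    and A3_cont: "\<forall>t\<in>{0..T}. integrable lborel (\<lambda>x. p (t, x)) \<and>
          ((\<lambda>s. LINT x|lborel. \<bar>p (s, x) - p (t, x)\<bar>) \<longlongrightarrow> 0) (at t within {0..T})"
    and A3_bdd: "\<exists>M. AE z in restrict_space lborel ({0..T} \<times> UNIV). \<bar>p z\<bar> \<le> M"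
    and A3_dens: "\<forall>t\<in>{0..T}. (AE x in lborel. 0 \<le> p (t, x)) \<and> (LINT x|lborel. p (t, x)) = 1"
    and A3_weak: "weak_time_deriv_L1 T p"
    and V0_fin: "V0 T p < \<infinity>"
    and eps_pos: "\<forall>n\<ge>1. eps n > 0" and eps_lim: "eps \<longlonglongrightarrow> 0"
    and lam_pos: "\<forall>n\<ge>1. lam n > 0" and lam_lim: "filterlim lam at_top sequentially"
    and u_adm: "\<forall>n\<ge>1. u n \<in> class_U T p"
    and u_opt: "\<forall>n\<ge>1. J T p K ip (lam n) (u n) \<le>
          (INF v\<in>class_U T p. J T p K ip (lam n) v) + ennreal (eps n)"
  shows "(\<lambda>n. ennreal (lam n) * penalty T p K ip (u n)) \<longlonglongrightarrow> 0 \<and>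
    (\<lambda>n. J T p K ip (lam n) (u n)) \<longlonglongrightarrow> V0 T p \<and>
    (SUP l\<in>{0<..}. INF v\<in>class_U T p. J T p K ip l v) = V0 T p \<and>
    (\<exists>u_star. is_arg_min (energy T p) (\<lambda>v. v \<in> class_U0 T p) u_star \<and>
       (\<forall>v. is_arg_min (energy T p) (\<lambda>v. v \<in> class_U0 T p) v \<longrightarrow>
          (AE z in spacetime_measure T p. v z = u_star z)) \<and>
       energy T p u_star < \<infinity> \<and> (\<forall>n\<ge>1. energy T p (u n) < \<infinity>) \<and>
       (\<lambda>n. energy T p (\<lambda>z. u n z - u_star z)) \<longlonglongrightarrow> 0)"
proof -
  interpret transport_problem T p K H ip
    by (rule transport_problem.intro; fact)
  show ?thesis
    by (rule penalized_convergence; fact)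
qed

end
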